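(* For integers $0\le m\le 10$ and $1\le b\le 5$ define $$f_m(b)=\sum_{n=0}^{\infty}\left(M_{\omega}(b,11,11n+m)-M_{\omega}(11-b,11,11n+m)\right)q^n.$$ Then \begin{align*} &f_0(1)-f_0(3)-2f_0(4)+2f_0(5)=-11q\frac{J_{5,11}J_{11}^5}{J_{1,11}J_{3,11}J_{4,11}},\\ &f_2(1)+f_2(3)-f_2(4)=-11q\frac{J_{11}^5}{J_{2,11}^2},\\ &f_5(1)-2f_5(3)+f_5(5)=-11q\frac{J_{3,11}J_{11}^5}{J_{1,11}J_{4,11}^2},\\ &2f_7(3)+f_7(5)=-11\frac{J_{3,11}J_{4,11}J_{11}^5}{J_{1,11}J_{2,11}^2J_{5,11}},\\ &f_{10}(1)+f_{10}(2)+2f_{10}(4)=-11\frac{J_{5,11}J_{11}^5}{J_{2,11}^2J_{3,11}}. \end{align*}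
   Context: For a partition $\pi$ let $\omega(\pi)$ denote the number of ones in $\pi$. The crank of $\pi$ is the largest part of $\pi$ if $\omega(\pi)=0$; otherwise it is (the number of parts of $\pi$ larger than $\omega(\pi)$) minus $\omega(\pi)$. For integers $r$, $m\ge 1$, $n\ge 0$, $M_{\omega}(r,m,n)=\sum \omega(\pi)$, the sum being over all partitions $\pi$ of $n$ whose crank is congruent to $r$ modulo $m$. For $|q|<1$ put $(x;q)_\infty=\prod_{k\ge0}(1-xq^k)$, $(x_1,\dots,x_m;q)_\infty=\prod_{i}(x_i;q)_\infty$, $J_{a,b}=(q^a,q^{b-a},q^b;q^b)_\infty$ and $J_a=(q^a;q^a)_\infty$. *)

theory Defs
  imports
    "HOL-Analysis.Analysis"
    "HOL-Library.Multiset"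
    "HOL-Number_Theory.Cong"
begin

definition partitions :: "nat \<Rightarrow> nat multiset set" where
  "partitions n = {p. 0 \<notin># p \<and> sum_mset p = n}"

lemma finite_partitions: "finite (partitions n)"
proof -
  have "partitions n \<subseteq> mset ` {xs. set xs \<subseteq> {..n} \<and> length xs \<le> n}"
  proof
    fix p assume p: "p \<in> partitions n"
    obtain xs where xs: "p = mset xs" by (metis ex_mset)
    have s: "sum_list xs = n" and z: "0 \<notin> set xs"
      using p by (auto simp: partitions_def xs sum_mset_sum_list)
    have "length ys \<le> sum_list ys" if "0 \<notin> set ys" for ys :: "nat list"
      using that by (induction ys) auto
    with s z have "length xs \<le> n" by blast
    moreover have "set xs \<subseteq> {..n}"
      using s member_le_sum_list[of _ xs] by auto
    ultimately show "p \<in> mset ` {xs. set xs \<subseteq> {..n} \<and> length xs \<le> n}"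
      using xs by blast
  qed
  thus ?thesis
    by (rule finite_subset) (intro finite_imageI finite_lists_length_le finite_atMost)
qed

definition num_ones :: "nat multiset \<Rightarrow> nat" where
  "num_ones p = count p 1"

(* The 0 inserted below only affects the empty partition, whose crank is thereby 0;
   it contributes nothing to M_omega since it has no ones. *)
definition crank :: "nat multiset \<Rightarrow> int" where
  "crank p =
     (if num_ones p = 0 then int (Max (insert 0 (set_mset p)))
      else int (size {# k \<in># p. num_ones p < k #}) - int (num_ones p))"

definition M_omega :: "int \<Rightarrow> nat \<Rightarrow> nat \<Rightarrow> nat" where
  "M_omega r m n = (\<Sum>p \<in> {p \<in> partitions n. [crank p = r] (mod int m)}. num_ones p)"

definition qpoch_inf :: "complex \<Rightarrow> complex \<Rightarrow> complex" where
  "qpoch_inf x q = (\<Prod>k. 1 - x * q ^ k)"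

definition qpochs_inf :: "complex list \<Rightarrow> complex \<Rightarrow> complex" where
  "qpochs_inf xs q = (\<Prod>x\<leftarrow>xs. qpoch_inf x q)"

(* Only meant for a \<le> b: the exponent b - a is a subtraction of naturals. *)
definition J2 :: "nat \<Rightarrow> nat \<Rightarrow> complex \<Rightarrow> complex" where
  "J2 a b q = qpochs_inf [q ^ a, q ^ (b - a), q ^ b] (q ^ b)"

definition J1 :: "nat \<Rightarrow> complex \<Rightarrow> complex" where
  "J1 a q = qpoch_inf (q ^ a) (q ^ a)"

definition f11 :: "nat \<Rightarrow> int \<Rightarrow> complex \<Rightarrow> complex" where
  "f11 m b q =
     (\<Sum>n. of_int (int (M_omega b 11 (11 * n + m)) - int (M_omega (11 - b) 11 (11 * n + m))) * q ^ n)"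

end

theory Submission
  imports Defs
begin

text \<open>Weight each partition by its number of ones times \<open>z^crank\<close>. By the q-binomial theorem the
generating function is the crank product times a difference of two Lambert series, and at an eleventh
root of unity only \<open>L(q/z) - L(qz)\<close> survives in the differences between the classes \<open>b\<close> and \<open>11 - b\<close>.
Dissecting the crank product (through the triple and quintuple products) and the Lambert series modulo 11
expresses every \<open>f_m(b)\<close> through the \<open>J_{k,11}\<close>, values of the Kronecker function, which are theta
quotients, and Lambert series \<open>E(r)\<close> in \<open>Q = q^11\<close>. In the five stated combinations the latter only occur
in the pattern \<open>E(a) + E(b) - E(c) - E(d)\<close> with \<open>a + b = c + d\<close>, which is again a theta quotient; the
remaining polynomial identities follow from Weierstrass' three-term relations among the \<open>J_{k,11}\<close>.
The point \<open>q = 0\<close> is reached by continuity, since the dissections divide by powers of \<open>q\<close>.\<close>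

subsection \<open>Unconditional summation\<close>

text \<open>All identities are proved at a fixed complex nome by rearranging absolutely convergent
  families; no elliptic function theory enters, and the constant in the theta quotient for the
  Kronecker function comes from a limit at its pole. Passing to the difference of the classes b and
  11 - b does two things. It removes the Lambert series at p^2, and it makes everything odd under z
  -> 1/z, so that coefficients of the five functions z^b - z^(11-b) can be compared over all
  eleventh roots of unity. Oddness also joins the residue classes (r, s) and (11 - r, 11 - s) of the
  double series behind the Lambert series into the two quadrants of one Kronecker series; only the
  column s = 11 is left over and gives E(r). As E(11 - r) = - E(r), a combination like E(2) - E(3) -
  2 E(5) still has the pattern E(2) + E(6) - E(3) - E(5). In residue class m only the component p^m
  of the crank product meets the E(r). For m = 2, 5, 7, 10 the given weights leave one pattern up to
  sign, for m = 0 a combination of two.\<close>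

lemma has_sum_mult:
  fixes f :: "'a \<Rightarrow> complex" and g :: "'b \<Rightarrow> complex"
  assumes f: "(f has_sum S) A" and g: "(g has_sum T) B"
  shows "((\<lambda>(x, y). f x * g y) has_sum S * T) (A \<times> B)"
proof (rule has_sum_SigmaI)
  show "((\<lambda>y. case (x, y) of (x, y) \<Rightarrow> f x * g y) has_sum f x * T) B" for x
    using has_sum_cmult_right[OF g] by simp
  show "((\<lambda>x. f x * T) has_sum S * T) A"
    using has_sum_cmult_left[OF f] .
  have *: "(\<lambda>x. norm (f x)) summable_on A" "(\<lambda>y. norm (g y)) summable_on B"
    using f g by (simp_all add: has_sum_imp_summable flip: summable_on_iff_abs_summable_on_complex)
  have "(\<lambda>p. norm (case p of (x, y) \<Rightarrow> f x * g y)) summable_on A \<times> B"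
  proof (subst Infinite_Sum.abs_summable_on_Sigma_iff, intro conjI ballI)
    fix x
    show "(\<lambda>y. norm (case (x, y) of (x, y) \<Rightarrow> f x * g y)) summable_on B"
      using summable_on_cmult_right[OF *(2), of "norm (f x)"] by (simp add: norm_mult)
    have "(\<lambda>x. infsum (\<lambda>y. norm (case (x, y) of (x, y) \<Rightarrow> f x * g y)) B) =
          (\<lambda>x. norm (f x) * infsum (\<lambda>y. norm (g y)) B)"
      by (simp add: norm_mult infsum_cmult_right')
    moreover have "(\<lambda>x. norm (f x) * infsum (\<lambda>y. norm (g y)) B) summable_on A"
      using *(1) by (rule summable_on_cmult_left)
    moreover have "infsum (\<lambda>y. norm (g y)) B \<ge> 0"
      by (intro infsum_nonneg) auto
    ultimately show "(\<lambda>x. norm (infsum (\<lambda>y. norm (case (x, y) of (x, y) \<Rightarrow> f x * g y)) B)) summable_on A"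
      by (simp add: norm_mult infsum_cmult_right' abs_mult)
  qed
  thus "(\<lambda>(x, y). f x * g y) summable_on A \<times> B"
    by (rule abs_summable_summable)
qed

lemma summable_on_dominated:
  fixes f :: "'a \<Rightarrow> complex"
  assumes h: "h summable_on A" and le: "\<And>k. k \<in> A \<Longrightarrow> norm (f k) \<le> h k"
  shows "f summable_on A"
proof (rule abs_summable_summable, rule Infinite_Sum.abs_summable_on_comparison_test)
  show "(\<lambda>k. norm (h k)) summable_on A"
    using Infinite_Sum.summable_on_iff_abs_summable_on_real[of h A] h by blast
  show "norm (f k) \<le> norm (h k)" if "k \<in> A" for k
    using le[OF that] by simp
qed

text \<open>Dominated convergence for sums along an arbitrary filter. It serves limits of partial
  products, the pole of the Kronecker function and the behaviour at nome 0.\<close>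

lemma infsum_dominated_tendsto:
  fixes f :: "'c \<Rightarrow> 'a \<Rightarrow> complex"
  assumes lim: "\<And>k. k \<in> A \<Longrightarrow> ((\<lambda>n. f n k) \<longlongrightarrow> g k) F"
    and bound: "eventually (\<lambda>n. \<forall>k\<in>A. norm (f n k) \<le> h k) F"
    and h: "h summable_on A"
  shows "((\<lambda>n. infsum (f n) A) \<longlongrightarrow> infsum g A) F"
proof (cases "F = bot")
  case False
  have gh: "norm (g k) \<le> h k" if "k \<in> A" for k
  proof (rule tendsto_upperbound[OF tendsto_norm[OF lim[OF that]]])
    show "\<forall>\<^sub>F n in F. norm (f n k) \<le> h k"
      using bound by eventually_elim (use that in auto)
  qed fact
  have g: "g summable_on A"
    by (rule summable_on_dominated[OF h gh])
  show ?thesis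
  proof (rule tendstoI)
    fix e :: real assume e: "e > 0"
    \<comment> \<open>Outside the finite set \<open>B\<close> the majorant sums to less than e/4; on
      \<open>B\<close> the convergence is that of a finite sum. The three pieces stay below 3e/4 in
      total.\<close>
    obtain B where B: "finite B" "B \<subseteq> A" "dist (sum h B) (infsum h A) < e / 4"
      using infsum_finite_approximation[OF h, of "e / 8"] e by (force simp: dist_commute)
    have hB: "h summable_on (A - B)"
      by (rule summable_on_subset[OF h]) auto
    have "infsum h (A - B) = infsum h A - infsum h B"
      by (rule infsum_Diff) (use h B in auto)
    hence tail: "infsum h (A - B) < e / 4"
      using B(3) infsum_finite[OF B(1), of h] unfolding dist_real_def by arith
    have "((\<lambda>n. \<Sum>k\<in>B. f n k) \<longlongrightarrow> (\<Sum>k\<in>B. g k)) F"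
      using B by (intro tendsto_sum lim) auto
    hence "eventually (\<lambda>n. dist (\<Sum>k\<in>B. f n k) (\<Sum>k\<in>B. g k) < e / 4) F"
      by (rule tendstoD) (use e in simp)
    with bound show "eventually (\<lambda>n. dist (infsum (f n) A) (infsum g A) < e) F"
    proof eventually_elim
      case (elim n)
      have f: "f n summable_on A"
        by (rule summable_on_dominated[OF h]) (use elim in auto)
      have tl: "norm (infsum u (A - B)) < e / 4" if "\<And>k. k \<in> A \<Longrightarrow> norm (u k) \<le> h k" for u :: "'a \<Rightarrow> complex"
      proof -
        have "u summable_on (A - B)"
          by (rule summable_on_dominated[OF hB]) (use that in auto)
        hence "norm (infsum u (A - B)) \<le> infsum h (A - B)"
          by (intro norm_infsum_le[OF has_sum_infsum has_sum_infsum[OF hB]]) (use that in auto)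
        with tail show ?thesis by simp
      qed
      have "infsum (f n) A = sum (f n) B + infsum (f n) (A - B)" "infsum g A = sum g B + infsum g (A - B)"
        using infsum_Diff[OF f summable_on_subset[OF f B(2)] B(2)]
              infsum_Diff[OF g summable_on_subset[OF g B(2)] B(2)] B(1) by auto
      hence "infsum (f n) A - infsum g A =
          (sum (f n) B - sum g B) + infsum (f n) (A - B) - infsum g (A - B)"
        by simp
      also have "norm \<dots> \<le> norm (sum (f n) B - sum g B) + norm (infsum (f n) (A - B)) + norm (infsum g (A - B))"
        by norm
      also have "\<dots> < e"
        using tl[of "f n"] tl[of g] elim gh e unfolding dist_norm by simp
      finally show ?case by (simp add: dist_norm)
    qed
  qed
qed auto

section \<open>Theta series and their exponents\<close>

definition tri :: "int \<Rightarrow> int" where "tri n = n * (n - 1) div 2"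

text \<open>Removes the division once and for all: identities between exponents are checked in
  doubled form, where they are polynomial.\<close>

lemma two_tri: "2 * tri n = n * (n - 1)"
  unfolding tri_def by (cases "even n") auto

lemma tri_nonneg: "tri n \<ge> 0"
proof -
  have "n * (n - 1) \<ge> 0" by (cases "n \<ge> 1") (auto simp: mult_nonneg_nonneg mult_nonpos_nonpos)
  thus ?thesis using two_tri[of n] by linarith
qed

lemma tri_add: "tri (m + n) = tri m + tri n + m * n"
  using two_tri[of "m + n"] two_tri[of m] two_tri[of n] by (auto simp: algebra_simps)

lemma tri_one_minus: "tri (1 - n) = tri n"
  using two_tri[of "1 - n"] two_tri[of n] by (auto simp: algebra_simps)

text \<open>Consecutive terms have ratio r^n s, which tends to 0, so the ratio test settles n \<ge>
  0. The involution n -> 1 - n fixes \<open>tri n\<close> and turns s into 1/s, which covers the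
  remaining indices.\<close>

lemma theta_summable_real:
  fixes r s :: real
  assumes r: "0 < r" "r < 1" and s: "0 < s"
  shows "(\<lambda>n. r powi tri n * s powi n) summable_on UNIV"
proof -
  have nat: "summable (\<lambda>n. r powi tri (int n) * s powi int n)" if s: "0 < s" for s
  proof -
    have "(\<lambda>n. r ^ n * s) \<longlonglongrightarrow> 0 * s"
      by (intro tendsto_intros LIMSEQ_realpow_zero) (use r in auto)
    hence "eventually (\<lambda>n. r ^ n * s < 1 / 2) sequentially"
      by (rule order_tendstoD) auto
    then obtain N where N: "\<And>n. n \<ge> N \<Longrightarrow> r ^ n * s < 1 / 2"
      by (auto simp: eventually_at_top_linorder)
    show ?thesis
    proof (rule summable_ratio_test[of "1 / 2" N])
      fix n assume n: "n \<ge> N"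
      have "tri (int (Suc n)) = tri (int n) + int n"
        using tri_add[of "int n" 1] by (simp add: tri_def add.commute)
      hence "r powi tri (int (Suc n)) * s powi int (Suc n) =
             (r ^ n * s) * (r powi tri (int n) * s powi int n)"
        using r s by (simp add: power_int_add power_int_of_nat)
      moreover have "r powi tri (int n) * s powi int n > 0"
        using r s by simp
      ultimately show "norm (r powi tri (int (Suc n)) * s powi int (Suc n)) \<le>
             1 / 2 * norm (r powi tri (int n) * s powi int n)"
        using N[OF n] r s by (simp add: abs_mult)
    qed auto
  qed
  have on_nat: "(\<lambda>n. r powi tri n * s powi n) summable_on range int" if s: "0 < s" for s
  proof -
    have "(\<lambda>n. r powi tri (int n) * s powi int n) summable_on UNIV"
      by (rule summable_nonneg_imp_summable_on[OF nat[OF s]]) (use r s in auto)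
    thus ?thesis
      by (subst summable_on_reindex) (auto simp: o_def)
  qed
  have "(\<lambda>n. s * (r powi tri n * (1 / s) powi n)) summable_on range int"
    using s by (intro summable_on_cmult_right on_nat) auto
  also have "(\<lambda>n. s * (r powi tri n * (1 / s) powi n)) = (\<lambda>n. r powi tri n * s powi n) \<circ> (\<lambda>n. 1 - n)"
    using s by (auto simp: tri_one_minus power_int_diff power_int_one_over field_simps)
  also have "\<dots> summable_on range int \<longleftrightarrow> (\<lambda>n. r powi tri n * s powi n) summable_on (\<lambda>n. 1 - n) ` range int"
    by (subst summable_on_reindex) (auto simp: inj_on_def)
  finally have "(\<lambda>n. r powi tri n * s powi n) summable_on (range int \<union> (\<lambda>n. 1 - n) ` range int)"
    by (intro summable_on_union on_nat s)
  also have "range int \<union> (\<lambda>n. 1 - n) ` range int = UNIV"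
  proof -
    have "n \<in> range int \<union> (\<lambda>n. 1 - n) ` range int" for n
    proof (cases "n \<ge> 0")
      case True thus ?thesis by (auto intro: range_eqI[of _ _ "nat n"])
    next
      case False
      hence "n = 1 - int (nat (1 - n))" by auto
      thus ?thesis by blast
    qed
    thus ?thesis by auto
  qed
  finally show ?thesis .
qed

text \<open>Normalised so that \<open>theta x q\<close> is the triple product (x, q/x, q; q) and
  \<open>J2 a 11 Q\<close> becomes \<open>theta (Q ^ a) (Q ^ 11)\<close>.\<close>

definition theta_term :: "complex \<Rightarrow> complex \<Rightarrow> int \<Rightarrow> complex" where
  "theta_term x q n = (-1) powi n * q powi tri n * x powi n"

definition theta :: "complex \<Rightarrow> complex \<Rightarrow> complex" where
  "theta x q = infsum (theta_term x q) UNIV"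

lemma norm_theta_term: "norm (theta_term x q n) = norm q powi tri n * norm x powi n"
  by (simp add: theta_term_def norm_mult norm_power_int)

lemma theta_term_abs_summable:
  assumes "q \<noteq> 0" "norm q < 1" "x \<noteq> 0"
  shows "(\<lambda>n. norm (theta_term x q n)) summable_on UNIV"
  unfolding norm_theta_term by (rule theta_summable_real) (use assms in auto)

lemma theta_has_sum:
  assumes "q \<noteq> 0" "norm q < 1" "x \<noteq> 0"
  shows "(theta_term x q has_sum theta x q) UNIV"
  unfolding theta_def
  by (rule has_sum_infsum, rule abs_summable_summable, rule theta_term_abs_summable) (use assms in auto)

section \<open>Infinite products\<close>

lemma qpoch_convergent:
  fixes q :: complex
  assumes "norm q < 1"
  shows "convergent_prod (\<lambda>k. 1 - x * q ^ k)"
proof -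
  have "summable (\<lambda>k. norm x * norm q ^ k)"
    using assms by (intro summable_mult summable_geometric) auto
  hence "abs_convergent_prod (\<lambda>k. 1 - x * q ^ k)"
    by (simp add: abs_convergent_prod_conv_summable norm_mult norm_power)
  thus ?thesis by (rule abs_convergent_prod_imp_convergent_prod)
qed

lemma qpoch_LIMSEQ:
  assumes "norm q < 1"
  shows "(\<lambda>n. \<Prod>k<n. 1 - x * q ^ k) \<longlonglongrightarrow> qpoch_inf x q"
proof -
  have "(\<lambda>n. \<Prod>k\<le>n. 1 - x * q ^ k) \<longlonglongrightarrow> qpoch_inf x q"
    unfolding qpoch_inf_def by (rule convergent_prod_LIMSEQ[OF qpoch_convergent[OF assms]])
  hence "(\<lambda>n. \<Prod>k<Suc n. 1 - x * q ^ k) \<longlonglongrightarrow> qpoch_inf x q"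
    by (simp only: lessThan_Suc_atMost)
  thus ?thesis by (rule LIMSEQ_imp_Suc)
qed

lemma qpoch_split:
  assumes "norm q < 1"
  shows "qpoch_inf x q = (\<Prod>k<n. 1 - x * q ^ k) * qpoch_inf (x * q ^ n) q"
proof -
  have "(\<lambda>m. \<Prod>k<m + n. 1 - x * q ^ k) \<longlonglongrightarrow> qpoch_inf x q"
    using qpoch_LIMSEQ[OF assms, of x] by (rule LIMSEQ_ignore_initial_segment)
  moreover have "(\<Prod>k<m + n. 1 - x * q ^ k) = (\<Prod>k<n. 1 - x * q ^ k) * (\<Prod>k<m. 1 - x * q ^ n * q ^ k)" for m
    by (induction m) (auto simp: power_add mult_ac)
  ultimately have "(\<lambda>m. (\<Prod>k<n. 1 - x * q ^ k) * (\<Prod>k<m. 1 - x * q ^ n * q ^ k)) \<longlonglongrightarrow> qpoch_inf x q"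
    by simp
  moreover have "(\<lambda>m. (\<Prod>k<n. 1 - x * q ^ k) * (\<Prod>k<m. 1 - x * q ^ n * q ^ k)) \<longlonglongrightarrow>
      (\<Prod>k<n. 1 - x * q ^ k) * qpoch_inf (x * q ^ n) q"
    by (intro tendsto_intros qpoch_LIMSEQ assms)
  ultimately show ?thesis by (rule LIMSEQ_unique)
qed

lemma qpoch_0 [simp]: "qpoch_inf 0 q = 1"
  by (simp add: qpoch_inf_def)

lemma qpoch_nonzero:
  assumes "norm q < 1" "\<And>k. x * q ^ k \<noteq> 1"
  shows "qpoch_inf x q \<noteq> 0"
  unfolding qpoch_inf_def
  by (rule prodinf_nonzero[OF qpoch_convergent[OF assms(1)]]) (use assms(2) in auto)

lemma qpoch_nonzero':
  assumes "norm q < 1" "norm x < 1"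
  shows "qpoch_inf x q \<noteq> 0"
proof (rule qpoch_nonzero[OF assms(1)])
  fix k
  have "norm x * norm q ^ k \<le> norm x * 1"
    using assms by (intro mult_left_mono power_le_one) auto
  hence "norm (x * q ^ k) < 1" using assms by (simp add: norm_mult norm_power)
  thus "x * q ^ k \<noteq> 1" by auto
qed

subsection \<open>The triple product\<close>

text \<open>1/(q;q)_k, extended by 0 to negative k: the finite triple product becomes a sum over all
  integers, and the recurrence \<open>recip_qfact_pred\<close> holds at every index.\<close>

definition recip_qfact :: "complex \<Rightarrow> int \<Rightarrow> complex" where
  "recip_qfact q k = (if k < 0 then 0 else 1 / (\<Prod>i<nat k. 1 - q * q ^ i))"

lemma qfact_nonzero:
  assumes "norm q < 1"
  shows "(\<Prod>i<n. 1 - q * q ^ i) \<noteq> (0 :: complex)"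
proof -
  have "q ^ Suc i \<noteq> 1" for i
    using assms by (metis norm_one norm_power power_Suc_less_one less_irrefl norm_ge_zero power_0_Suc zero_neq_one
        power_strict_mono zero_less_Suc one_power2 power_one)
  thus ?thesis by auto
qed

lemma recip_qfact_pred:
  assumes "norm q < 1"
  shows "recip_qfact q (k - 1) = recip_qfact q k * (1 - q powi k)"
proof (cases "k \<le> 0")
  case True
  thus ?thesis by (cases "k = 0") (auto simp: recip_qfact_def)
next
  case False
  then obtain n where k: "k = int (Suc n)"
    by (metis not_le pos_int_cases gr0_implies_Suc)
  have "1 - q * q ^ n \<noteq> 0"
    using qfact_nonzero[OF assms, of "Suc n"] by simp
  moreover have "q powi (1 + int n) = q * q ^ n"
    by (metis power_Suc power_int_of_nat of_nat_Suc)
  ultimately show ?thesis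
    by (simp add: k recip_qfact_def nat_add_distrib) 
qed

text \<open>The coefficients are the q-binomials [2N, N + n], which vanish for |n| > N. Induction on
  N multiplies by (1 - x q^N)(1 - q^(N+1)/x), whose monomials in x keep the summation index or shift
  it by one.\<close>

lemma finite_triple_product:
  assumes q: "norm q < 1" "q \<noteq> 0" and x: "x \<noteq> 0"
  shows "((\<lambda>n. theta_term x q n * (\<Prod>i<2*N. 1 - q * q ^ i) * recip_qfact q (int N - n) * recip_qfact q (int N + n))
           has_sum (\<Prod>k<N. 1 - x * q ^ k) * (\<Prod>k<N. 1 - q / x * q ^ k)) UNIV"
proof (induction N)
  case 0
  have "((\<lambda>n. theta_term x q n * recip_qfact q (- n) * recip_qfact q n) has_sum 1) UNIV"
    by (rule has_sum_finite_neutralI[of "{0}"]) (auto simp: recip_qfact_def theta_term_def tri_def)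
  thus ?case by simp
next
  case (Suc N)
  define c where "c = (\<lambda>n. theta_term x q n * (\<Prod>i<2*N. 1 - q * q ^ i) * recip_qfact q (int N - n) * recip_qfact q (int N + n))"
  define P where "P = (\<Prod>k<N. 1 - x * q ^ k) * (\<Prod>k<N. 1 - q / x * q ^ k)"
  have IH: "(c has_sum P) UNIV" using Suc by (simp add: c_def P_def)
  have IH1: "((\<lambda>n. c (n - 1)) has_sum P) UNIV" and IH2: "((\<lambda>n. c (n + 1)) has_sum P) UNIV"
    using has_sum_reindex_bij_betw[of "\<lambda>n. n - 1" UNIV UNIV c P] IH
          has_sum_reindex_bij_betw[of "\<lambda>n. n + 1" UNIV UNIV c P]
    by (simp_all add: bij_plus_right bij_diff_right)
  have "((\<lambda>n. (1 + q ^ (2 * N + 1)) * c n + (- x * q ^ N) * c (n - 1) + (- (q / x) * q ^ N) * c (n + 1)) has_sum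
          (1 + q ^ (2 * N + 1)) * P + (- x * q ^ N) * P + (- (q / x) * q ^ N) * P) UNIV"
    by (intro has_sum_add has_sum_cmult_right IH IH1 IH2)
  also have "(1 + q ^ (2 * N + 1)) * P + (- x * q ^ N) * P + (- (q / x) * q ^ N) * P =
      (\<Prod>k<Suc N. 1 - x * q ^ k) * (\<Prod>k<Suc N. 1 - q / x * q ^ k)"
  proof -
    have e: "q ^ (2 * N + 1) = q * (q ^ N * q ^ N)"
      by (simp add: mult_2 power_add)
    show ?thesis
      unfolding e P_def prod.lessThan_Suc using x by (simp add: algebra_simps)
  qed
  also have "(\<lambda>n. (1 + q ^ (2 * N + 1)) * c n + (- x * q ^ N) * c (n - 1) + (- (q / x) * q ^ N) * c (n + 1)) =
      (\<lambda>n. theta_term x q n * (\<Prod>i<2*Suc N. 1 - q * q ^ i) * recip_qfact q (int (Suc N) - n) * recip_qfact q (int (Suc N) + n))"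
  proof
    fix n
    \<comment> \<open>All terms are reduced to the reciprocal factorials \<open>u\<close>,
      \<open>v\<close> of level N + 1. What remains is a polynomial identity in q, A and B, with A B
      = q^(2N) supplying the two new factors of (q;q)_(2N+2).\<close>
    define u where "u = recip_qfact q (int (Suc N) - n)"
    define v where "v = recip_qfact q (int (Suc N) + n)"
    define A where "A = q powi (int N - n)"
    define B where "B = q powi (int N + n)"
    define F where "F = (\<Prod>i<2*N. 1 - q * q ^ i)"
    have AB: "A * B = q ^ (2 * N)"
      using q by (simp add: A_def B_def flip: power_int_add) (simp add: power_int_def nat_mult_distrib)
    have qA: "q powi (int (Suc N) - n) = q * A" and qB: "q powi (int (Suc N) + n) = q * B"
      using q by (simp_all add: A_def B_def power_int_add power_int_diff)
    have r1: "recip_qfact q (int N - n) = u * (1 - q * A)" 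
      using recip_qfact_pred[OF q(1), of "int (Suc N) - n"] unfolding qA u_def by (simp add: algebra_simps)
    have r2: "recip_qfact q (int N + n) = v * (1 - q * B)"
      using recip_qfact_pred[OF q(1), of "int (Suc N) + n"] unfolding qB v_def by (simp add: algebra_simps)
    have r3: "recip_qfact q (int N - n - 1) = u * (1 - q * A) * (1 - A)"
      using recip_qfact_pred[OF q(1), of "int N - n"] unfolding r1 A_def .
    have r4: "recip_qfact q (int N + n - 1) = v * (1 - q * B) * (1 - B)"
      using recip_qfact_pred[OF q(1), of "int N + n"] unfolding r2 B_def .
    have t: "- x * q ^ N * theta_term x q (n - 1) = theta_term x q n * (q * A)"
            "- (q / x) * q ^ N * theta_term x q (n + 1) = theta_term x q n * (q * B)"
    proof -
      have tr: "tri (n - 1) = tri n - n + 1" "tri (n + 1) = tri n + n"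
        using two_tri[of n] two_tri[of "n - 1"] two_tri[of "n + 1"] by (auto simp: algebra_simps)
      show "- x * q ^ N * theta_term x q (n - 1) = theta_term x q n * (q * A)"
            "- (q / x) * q ^ N * theta_term x q (n + 1) = theta_term x q n * (q * B)"
        unfolding theta_term_def tr A_def B_def using q x
        by (simp_all add: power_int_add power_int_diff field_simps)
    qed
    have "(1 + q ^ (2 * N + 1)) * c n + (- x * q ^ N) * c (n - 1) + (- (q / x) * q ^ N) * c (n + 1) =
      theta_term x q n * F * u * v * ((1 + q * (A * B)) * (1 - q * A) * (1 - q * B)
        + q * A * (1 - q * B) * (1 - B) + q * B * (1 - q * A) * (1 - A))"
    proof -
      have e: "int N - (n - 1) = int (Suc N) - n" "int N + (n - 1) = int N + n - 1"
              "int N + (n + 1) = int (Suc N) + n" "int N - (n + 1) = int N - n - 1"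
        by auto
      have c0: "c n = theta_term x q n * F * (u * (1 - q * A)) * (v * (1 - q * B))"
        by (simp add: c_def r1 r2 F_def)
      have c1: "- x * q ^ N * c (n - 1) = (- x * q ^ N * theta_term x q (n - 1)) * F * u * (v * (1 - q * B) * (1 - B))"
        unfolding c_def e u_def[symmetric] r4 F_def[symmetric] by (simp only: mult_ac)
      have c2: "- (q / x) * q ^ N * c (n + 1) = (- (q / x) * q ^ N * theta_term x q (n + 1)) * F * (u * (1 - q * A) * (1 - A)) * v"
        unfolding c_def e v_def[symmetric] r3 F_def[symmetric] by (simp only: mult_ac)
      have qN: "q ^ (2 * N + 1) = q * (A * B)"
        by (simp add: AB)
      show ?thesis
        unfolding c0 c1 c2 t qN by algebra
    qed
    also have "(1 + q * (A * B)) * (1 - q * A) * (1 - q * B)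
        + q * A * (1 - q * B) * (1 - B) + q * B * (1 - q * A) * (1 - A) = (1 - q * (A * B)) * (1 - q * (q * (A * B)))"
      by (simp add: algebra_simps)
    finally show "(1 + q ^ (2 * N + 1)) * c n + (- x * q ^ N) * c (n - 1) + (- (q / x) * q ^ N) * c (n + 1) =
      theta_term x q n * (\<Prod>i<2*Suc N. 1 - q * q ^ i) * recip_qfact q (int (Suc N) - n) * recip_qfact q (int (Suc N) + n)"
      by (simp add: F_def u_def v_def AB mult_ac)
  qed
  finally show ?case .
qed

text \<open>N tends to infinity in the finite form. (q;q)_(2N) and the reciprocal factorials
  converge, hence are bounded by M and K, and the theta series times M K^2 is a summable
  majorant.\<close>

lemma triple_product:
  assumes q: "norm q < 1" "q \<noteq> 0" and x: "x \<noteq> 0"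
  shows "theta x q = qpoch_inf x q * qpoch_inf (q / x) q * qpoch_inf q q"
proof -
  define r where "r = recip_qfact q"
  define f where "f = (\<lambda>N n. theta_term x q n * (\<Prod>i<2*N. 1 - q * q ^ i) * r (int N - n) * r (int N + n))"
  have Q0: "qpoch_inf q q \<noteq> 0" using q by (intro qpoch_nonzero') auto
  have lr: "(\<lambda>n. 1 / (\<Prod>i<n. 1 - q * q ^ i)) \<longlonglongrightarrow> 1 / qpoch_inf q q"
    by (intro tendsto_intros qpoch_LIMSEQ q Q0)
  have "Bseq (\<lambda>n. 1 / (\<Prod>i<n. 1 - q * q ^ i))"
    using lr by (intro convergent_imp_Bseq convergentI)
  then obtain K where K: "K > 0" "\<And>n. norm (1 / (\<Prod>i<n. 1 - q * q ^ i)) \<le> K"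
    by (auto simp: Bseq_def)
  have rK: "norm (r k) \<le> K" for k
    using K by (auto simp: r_def recip_qfact_def)
  have "Bseq (\<lambda>n. \<Prod>i<n. 1 - q * q ^ i)"
    using qpoch_LIMSEQ[OF q(1), of q] by (intro convergent_imp_Bseq convergentI)
  then obtain M where M: "M > 0" "\<And>n. norm (\<Prod>i<n. 1 - q * q ^ i) \<le> M"
    by (auto simp: Bseq_def)
  have lim_r: "(\<lambda>N. r (int N + c)) \<longlonglongrightarrow> 1 / qpoch_inf q q" for c
  proof -
    have "filterlim (\<lambda>N. nat (int N + c)) at_top sequentially"
      unfolding filterlim_at_top eventually_at_top_linorder
    proof
      fix Z :: nat
      show "\<exists>N. \<forall>n\<ge>N. Z \<le> nat (int n + c)"
        by (rule exI[of _ "nat (int Z - c)"]) auto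
    qed
    from filterlim_compose[OF lr this]
    have "(\<lambda>N. 1 / (\<Prod>i<nat (int N + c). 1 - q * q ^ i)) \<longlonglongrightarrow> 1 / qpoch_inf q q" .
    moreover have "eventually (\<lambda>N. 1 / (\<Prod>i<nat (int N + c). 1 - q * q ^ i) = r (int N + c)) sequentially"
      using eventually_ge_at_top[of "nat (- c)"] by eventually_elim (auto simp: r_def recip_qfact_def)
    ultimately show ?thesis by (rule Lim_transform_eventually)
  qed
  have "(\<lambda>N. infsum (f N) UNIV) \<longlonglongrightarrow> infsum (\<lambda>n. theta_term x q n * qpoch_inf q
      q * (1 / qpoch_inf q q) * (1 / qpoch_inf q q)) UNIV"
  proof (rule infsum_dominated_tendsto)
    fix n
    have "(\<lambda>N. \<Prod>i<2*N. 1 - q * q ^ i) \<longlonglongrightarrow> qpoch_inf q q"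
      by (rule filterlim_compose[OF qpoch_LIMSEQ[OF q(1)]]) (simp add: filterlim_subseq strict_mono_def)
    thus "(\<lambda>N. f N n) \<longlonglongrightarrow> theta_term x q n * qpoch_inf q q * (1 / qpoch_inf q q) * (1 / qpoch_inf q q)"
      unfolding f_def using lim_r[of n] lim_r[of "- n"] by (intro tendsto_intros) auto
    show "\<forall>\<^sub>F N in sequentially. \<forall>n\<in>UNIV. norm (f N n) \<le> norm (theta_term x q n) * (M * K * K)"
      by (intro always_eventually allI ballI)
         (auto simp: f_def norm_mult mult.assoc intro!: mult_left_mono mult_mono M(2) rK mult_nonneg_nonneg less_imp_le[OF M(1)] less_imp_le[OF K(1)])
    show "(\<lambda>n. norm (theta_term x q n) * (M * K * K)) summable_on UNIV"
      by (rule summable_on_cmult_left, rule theta_term_abs_summable) (use q x in auto)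
  qed
  moreover have "infsum (f N) UNIV = (\<Prod>k<N. 1 - x * q ^ k) * (\<Prod>k<N. 1 - q / x * q ^ k)" for N
    using finite_triple_product[OF q x, of N] unfolding f_def r_def by (rule infsumI)
  moreover have "(\<lambda>N. (\<Prod>k<N. 1 - x * q ^ k) * (\<Prod>k<N. 1 - q / x * q ^ k))
      \<longlonglongrightarrow> qpoch_inf x q * qpoch_inf (q / x) q"
    by (intro tendsto_intros qpoch_LIMSEQ q)
  moreover have "infsum (\<lambda>n. theta_term x q n * qpoch_inf q q * (1 / qpoch_inf q q) * (1 / qpoch_inf q q)) UNIV
      = theta x q / qpoch_inf q q"
    using Q0 infsum_cmult_left'[of "theta_term x q" "1 / qpoch_inf q q" UNIV] by (simp add: theta_def)
  ultimately have "qpoch_inf x q * qpoch_inf (q / x) q = theta x q / qpoch_inf q q"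
    using LIMSEQ_unique by force
  thus ?thesis using Q0 by (simp add: field_simps)
qed

lemma has_sum_reindex_bij:
  assumes "(f has_sum S) UNIV" "bij h"
  shows "((\<lambda>x. f (h x)) has_sum S) UNIV"
  using has_sum_reindex_bij_betw[OF assms(2), of f S] assms(1) by simp

text \<open>Used to split lattice points by parity, and the integers into n \<ge> 0 and n < 0; both
  pieces are given as injective images.\<close>

lemma has_sum_split:
  fixes f :: "'a \<Rightarrow> complex"
  assumes "inj g" "inj h" "range g \<inter> range h = {}" "range g \<union> range h = UNIV"
  assumes "((\<lambda>x. f (g x)) has_sum S) UNIV" "((\<lambda>x. f (h x)) has_sum T) UNIV"
  shows "(f has_sum S + T) UNIV"
proof -
  have "(f has_sum S) (range g)" "(f has_sum T) (range h)"
    using assms by (auto simp: has_sum_reindex o_def)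
  from has_sum_Un_disjoint[OF this assms(3)] show ?thesis using assms(4) by simp
qed

lemma has_sum_split_infsum:
  fixes f :: "'a \<Rightarrow> complex"
  assumes "inj g" "inj h" "range g \<inter> range h = {}" "range g \<union> range h = UNIV" "(f has_sum S) UNIV"
  shows "S = infsum (\<lambda>x. f (g x)) UNIV + infsum (\<lambda>x. f (h x)) UNIV"
    and "(\<lambda>x. f (g x)) summable_on UNIV" and "(\<lambda>x. f (h x)) summable_on UNIV"
proof -
  have "f summable_on range g" "f summable_on range h"
    using has_sum_imp_summable[OF assms(5)] by (auto intro: summable_on_subset)
  thus *: "(\<lambda>x. f (g x)) summable_on UNIV" "(\<lambda>x. f (h x)) summable_on UNIV"
    using assms by (auto simp: summable_on_reindex o_def)
  show "S = infsum (\<lambda>x. f (g x)) UNIV + infsum (\<lambda>x. f (h x)) UNIV"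
    using has_sum_split[of g h f, OF assms(1-4) has_sum_infsum has_sum_infsum] * assms(5) has_sum_unique by blast
qed

lemma theta_shift:
  assumes "q \<noteq> 0" "norm q < 1" "x \<noteq> 0"
  shows "theta (x * q) q = - theta x q / x"
proof -
  have "((\<lambda>n. theta_term x q (n + 1)) has_sum theta x q) UNIV"
    by (rule has_sum_reindex_bij[OF theta_has_sum[OF assms]]) (simp add: bij_plus_right)
  hence "((\<lambda>n. (- 1 / x) * theta_term x q (n + 1)) has_sum (- 1 / x) * theta x q) UNIV"
    by (rule has_sum_cmult_right)
  also have "(\<lambda>n. (- 1 / x) * theta_term x q (n + 1)) = theta_term (x * q) q"
  proof
    fix n
    have "tri (n + 1) = tri n + n" using tri_add[of n 1] by (simp add: tri_def)
    thus "(- 1 / x) * theta_term x q (n + 1) = theta_term (x * q) q n"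
      using assms by (simp add: theta_term_def power_int_add power_int_mult_distrib)
  qed
  finally show ?thesis using theta_has_sum[of q "x * q"] assms has_sum_unique by fastforce
qed

lemma theta_inverse:
  assumes "q \<noteq> 0" "norm q < 1" "x \<noteq> 0"
  shows "theta (1 / x) q = - theta x q / x"
proof -
  have "((\<lambda>n. theta_term x q (1 - n)) has_sum theta x q) UNIV"
    by (rule has_sum_reindex_bij[OF theta_has_sum[OF assms]])
       (rule bij_betw_byWitness[of _ "\<lambda>n. 1 - n"], auto)
  hence "((\<lambda>n. (- 1 / x) * theta_term x q (1 - n)) has_sum (- 1 / x) * theta x q) UNIV"
    by (rule has_sum_cmult_right)
  also have "(\<lambda>n. (- 1 / x) * theta_term x q (1 - n)) = theta_term (1 / x) q"
  proof
    fix n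
    have "(-1 :: complex) powi (1 - n) = - ((-1) powi n)"
      by (auto simp: power_int_minus_left)
    moreover have "x powi (1 - n) = x * (1 / x) powi n"
      using assms by (simp add: power_int_diff power_int_one_over)
    ultimately show "(- 1 / x) * theta_term x q (1 - n) = theta_term (1 / x) q n"
      using assms by (simp add: theta_term_def tri_one_minus)
  qed
  finally show ?thesis using theta_has_sum[of q "1 / x"] assms has_sum_unique by fastforce
qed

lemma theta_reflect:
  assumes "q \<noteq> 0" "norm q < 1" "x \<noteq> 0"
  shows "theta (q / x) q = theta x q"
  using theta_shift[of q "1 / x"] theta_inverse[of q x] assms by simp

lemma theta_1 [simp]:
  assumes "q \<noteq> 0" "norm q < 1"
  shows "theta 1 q = 0"
  using theta_inverse[of q 1] assms by simp

lemma theta_nome: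
  assumes "q \<noteq> 0" "norm q < 1"
  shows "theta q q = 0"
  using theta_reflect[of q 1] assms by simp

subsection \<open>Weierstrass relation\<close>

text \<open>Pairs (m, n) with m + n even are (i + j, i - j), those with m + n odd are (i + j, i - j
  + 1). On either class the exponent separates into a part in i and a part in j, which leaves
  products of theta series of nome q^2.\<close>

lemma theta_addition:
  assumes q: "q \<noteq> 0" "norm q < 1" and x: "x \<noteq> 0" and y: "y \<noteq> 0"
  shows "theta (x * y) q * theta (x / y) q =
    theta (- (x ^ 2)) (q ^ 2) * theta (- q * y ^ 2) (q ^ 2)
    - x / y * theta (- q * x ^ 2) (q ^ 2) * theta (- (y ^ 2)) (q ^ 2)"
proof -
  define P where "P = (\<lambda>x. theta_term (- (x ^ 2)) (q ^ 2))"
  define R where "R = (\<lambda>x. theta_term (- q * x ^ 2) (q ^ 2))"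
  define f where "f = (\<lambda>(m, n). theta_term (x * y) q m * theta_term (x / y) q n)"
  define g where "g = (\<lambda>(i, j). (i + j, i - j :: int))"
  define h where "h = (\<lambda>(i, j). (i + j, i - j + 1 :: int))"
  have q2: "q ^ 2 \<noteq> 0" "norm (q ^ 2) < 1"
    using q by (auto simp: norm_power power_less_one_iff abs_square_less_1)
  have P: "(P x has_sum theta (- (x ^ 2)) (q ^ 2)) UNIV" if "x \<noteq> 0" for x
    unfolding P_def by (rule theta_has_sum) (use q2 that in auto)
  have R: "(R x has_sum theta (- q * x ^ 2) (q ^ 2)) UNIV" if "x \<noteq> 0" for x
    unfolding R_def by (rule theta_has_sum) (use q2 q that in auto)
  have Pe: "P x i = q powi (i\<^sup>2 - i) * x powi (2 * i)" if "x \<noteq> 0" for x i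
  proof -
    have sq: "(z ^ 2) powi k = z powi (2 * k)" for z :: complex and k
      by (simp add: power_int_mult)
    have "2 * tri i = i\<^sup>2 - i"
      using two_tri[of i] by (simp add: power2_eq_square algebra_simps)
    hence "(q ^ 2) powi tri i = q powi (i\<^sup>2 - i)"
      by (simp only: sq)
    moreover have "(- (x ^ 2)) powi i = (-1) powi i * x powi (2 * i)"
      using power_int_mult_distrib[of "-1" "x^2" i] by (simp only: sq mult_minus1)
    moreover have "(-1) powi i * (-1) powi i = (1 :: complex)"
      by (auto simp: power_int_minus_left)
    moreover have "s * a * (s * b) = a * b" if "s * s = 1" for s a b :: complex
      using that by algebra
    ultimately show ?thesis
      unfolding P_def theta_term_def by metis
  qed
  have Re: "R x i = q powi (i\<^sup>2) * x powi (2 * i)" if "x \<noteq> 0" for x i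
  proof -
    have "R x i = P x i * q powi i"
      using power_int_mult_distrib[of "q" "- (x^2)" i] by (simp add: R_def P_def theta_term_def)
    also have "\<dots> = q powi ((i\<^sup>2 - i) + i) * x powi (2 * i)"
      using q by (subst power_int_add) (auto simp: Pe that)
    finally show ?thesis by simp
  qed
  have f: "(f has_sum theta (x * y) q * theta (x / y) q) UNIV"
    unfolding f_def using has_sum_mult[OF theta_has_sum[of q "x * y"] theta_has_sum[of q "x / y"]] q x y by simp
  have "(\<lambda>p. f (g p)) = (\<lambda>(i, j). P x i * R y j)"
  proof (intro ext, clarify)
    fix i j
    have "tri (i + j) + tri (i - j) = i\<^sup>2 - i + j\<^sup>2"
      using two_tri[of "i + j"] two_tri[of "i - j"] by (auto simp: algebra_simps power2_eq_square)
    hence "q powi tri (i + j) * q powi tri (i - j) = q powi (i\<^sup>2 - i) * q powi (j\<^sup>2)"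
      using q by (metis power_int_add)
    moreover have "(x * y) powi (i + j) * (x / y) powi (i - j) = x powi (2 * i) * y powi (2 * j)"
      using x y by (simp add: power_int_mult_distrib power_int_divide_distrib power_int_add power_int_diff
          power_int_mult power2_eq_square field_simps)
    moreover have "(-1 :: complex) powi (i + j) * (-1) powi (i - j) = 1"
      by (subst power_int_add [symmetric]) (auto simp: power_int_minus_left)
    moreover have "f (g (i, j)) = ((-1) powi (i + j) * (-1) powi (i - j)) * (q powi tri (i + j) * q powi tri (i - j))
        * ((x * y) powi (i + j) * (x / y) powi (i - j))"
      by (simp add: f_def g_def theta_term_def)
    ultimately show "f (g (i, j)) = P x i * R y j"
      unfolding Pe[OF x] Re[OF y] by simp
  qed
  hence fg: "((\<lambda>p. f (g p)) has_sum theta (- (x ^ 2)) (q ^ 2) * theta (- q * y ^ 2) (q ^ 2)) UNIV"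
    using has_sum_mult[OF P[OF x] R[OF y]] by simp
  have "(\<lambda>p. f (h p)) = (\<lambda>(i, j). - (x / y) * R x i * P y j)"
  proof (intro ext, clarify)
    fix i j
    have "tri (i + j) + tri (i - j + 1) = i\<^sup>2 + (j\<^sup>2 - j)"
      using two_tri[of "i + j"] two_tri[of "i - j + 1"] by (auto simp: algebra_simps power2_eq_square)
    hence "q powi tri (i + j) * q powi tri (i - j + 1) = q powi (i\<^sup>2) * q powi (j\<^sup>2 - j)"
      using q by (metis power_int_add)
    moreover have "(x * y) powi (i + j) * (x / y) powi (i - j + 1) = x / y * x powi (2 * i) * y powi (2 * j)"
      using x y by (simp add: power_int_mult_distrib power_int_divide_distrib power_int_add power_int_diff
          power_int_mult power2_eq_square field_simps)
    moreover have "(-1 :: complex) powi (i + j) * (-1) powi (i - j + 1) = -1"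
      by (subst power_int_add [symmetric]) (auto simp: power_int_minus_left)
    moreover have "f (h (i, j)) = ((-1) powi (i + j) * (-1) powi (i - j + 1)) * (q powi tri (i + j) * q powi tri (i - j + 1))
        * ((x * y) powi (i + j) * (x / y) powi (i - j + 1))"
      by (simp add: f_def h_def theta_term_def)
    ultimately show "f (h (i, j)) = - (x / y) * R x i * P y j"
      unfolding Pe[OF y] Re[OF x] by simp
  qed
  hence fh: "((\<lambda>p. f (h p)) has_sum - (x / y) * theta (- q * x ^ 2) (q ^ 2) * theta (- (y ^ 2)) (q ^ 2)) UNIV"
    using has_sum_mult[OF has_sum_cmult_right[OF R[OF x], of "- (x / y)"] P[OF y]] by (simp add: mult_ac)
  have "(f has_sum theta (- (x ^ 2)) (q ^ 2) * theta (- q * y ^ 2) (q ^ 2)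
      + - (x / y) * theta (- q * x ^ 2) (q ^ 2) * theta (- (y ^ 2)) (q ^ 2)) UNIV"
  proof (rule has_sum_split[where f = f and g = g and h = h])
    show "inj g" "inj h" by (auto simp: inj_def g_def h_def)
    show "range g \<inter> range h = {}"
    proof -
      have False if "g (i, j) = h (k, l)" for i j k l
        using that unfolding g_def h_def by simp presburger
      thus ?thesis by (metis (no_types, lifting) disjoint_iff imageE surj_pair)
    qed
    have "(m, n) \<in> range g \<union> range h" for m n
    proof (cases "even (m + n)")
      case True
      hence "g ((m + n) div 2, (m - n) div 2) = (m, n)" unfolding g_def by simp presburger
      thus ?thesis by (metis UnI1 rangeI)
    next
      case False
      hence "h ((m + n - 1) div 2, (m - n + 1) div 2) = (m, n)" unfolding h_def by simp presburger
      thus ?thesis by (metis UnI2 rangeI)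
    qed
    thus "range g \<union> range h = UNIV" by auto
  qed (rule fg fh)+
  thus ?thesis using f has_sum_unique by fastforce
qed

text \<open>By \<open>theta_addition\<close>, y theta(xy) theta(x/y) is the determinant of the
  vectors v_x and v_y, where v_x = (theta(-x^2), x theta(-q x^2)) at nome q^2. The claim is the
  Pluecker relation for v_x, v_y, v_u and v_1.\<close>

lemma theta_three_term:
  assumes q: "q \<noteq> 0" "norm q < 1" and "x \<noteq> 0" "y \<noteq> 0" "u \<noteq> 0"
  shows "y / u * (theta (x * y) q * theta (x / y) q) * theta u q ^ 2 =
    theta (x * u) q * theta (x / u) q * theta y q ^ 2 - theta x q ^ 2 * (theta (y * u) q * theta (y / u) q)"
proof -
  have 1: "theta z q ^ 2 = theta (z * 1) q * theta (z / 1) q" for z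
    by (simp add: power2_eq_square)
  show ?thesis
    unfolding 1 using assms
    by (simp only: theta_addition[OF q] one_neq_zero not_False_eq_True) (simp add: field_simps)
qed

subsection \<open>The quintuple product\<close>

lemma filterlim_mult_nat: "0 < c \<Longrightarrow> filterlim (\<lambda>n::nat. c * n) at_top sequentially"
  by (rule filterlim_subseq) (simp add: strict_mono_def)

text \<open>Euler's pentagonal number theorem: the factors sorted by exponent modulo 3 form (q, q^2,
  q^3; q^3).\<close>

lemma qpoch_eq_theta:
  assumes q: "q \<noteq> 0" "norm q < 1"
  shows "qpoch_inf q q = theta q (q ^ 3)"
proof -
  have q3: "q ^ 3 \<noteq> 0" "norm (q ^ 3) < 1"
    using q power_less_one_iff[of "norm q" 3] by (auto simp: norm_power)
  have "(\<lambda>n. \<Prod>k<3 * n. 1 - q * q ^ k) \<longlonglongrightarrow> qpoch_inf q q"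
    by (rule filterlim_compose[OF qpoch_LIMSEQ[OF q(2)] filterlim_mult_nat]) simp
  moreover have "(\<Prod>k<3 * n. 1 - q * q ^ k) =
     (\<Prod>k<n. 1 - q * (q ^ 3) ^ k) * (\<Prod>k<n. 1 - q\<^sup>2 * (q ^ 3) ^ k) * (\<Prod>k<n. 1 - q ^ 3 * (q ^ 3) ^ k)" for n
    by (induction n) (simp_all add: power_mult[symmetric] power_add[symmetric] flip: power_Suc, simp add: eval_nat_numeral)
  moreover have "(\<lambda>n. (\<Prod>k<n. 1 - q * (q ^ 3) ^ k) * (\<Prod>k<n. 1 - q\<^sup>2 * (q ^ 3) ^ k) * (\<Prod>k<n. 1 - q ^ 3 * (q ^ 3) ^ k))
     \<longlonglongrightarrow> qpoch_inf q (q ^ 3) * qpoch_inf (q\<^sup>2) (q ^ 3) * qpoch_inf (q ^ 3) (q ^ 3)"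
    by (intro tendsto_intros qpoch_LIMSEQ q3)
  ultimately have "qpoch_inf q q = qpoch_inf q (q ^ 3) * qpoch_inf (q\<^sup>2) (q ^ 3) * qpoch_inf (q ^ 3) (q ^ 3)"
    using LIMSEQ_unique by force
  moreover have "q ^ 3 / q = q\<^sup>2"
    using q by (simp add: power2_eq_square power3_eq_cube)
  ultimately show ?thesis
    using triple_product[OF q3(2,1) q(1)] by simp
qed

text \<open>Since (q;q) is itself a theta series, all three products are double series. The left
  side has only even powers of x; the even parts of the two products on the right are its two
  halves, and their odd parts cancel.\<close>

lemma quintuple_product:
  assumes q: "q \<noteq> 0" "norm q < 1" and x: "x \<noteq> 0"
  shows "qpoch_inf q q * theta (x ^ 2) q =
    theta x q * (theta (q * x ^ 3) (q ^ 3) + x * theta (q / x ^ 3) (q ^ 3))"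
proof -
  have q3: "q ^ 3 \<noteq> 0" "norm (q ^ 3) < 1"
    using q power_less_one_iff[of "norm q" 3] by (auto simp: norm_power)
  have pw: "(z ^ 2) powi k = z powi (2 * k)" "(z ^ 3) powi k = z powi (3 * k)" for z :: complex and k
    by (simp_all add: power_int_mult)
  define l where "l = (\<lambda>(j, k). theta_term q (q ^ 3) j * theta_term (x ^ 2) q k)"
  define r1 where "r1 = (\<lambda>(m, n). theta_term x q m * theta_term (q * x ^ 3) (q ^ 3) n)"
  define r2 where "r2 = (\<lambda>(m, n). theta_term x q m * (x * theta_term (q / x ^ 3) (q ^ 3) n))"
  have l: "(l has_sum qpoch_inf q q * theta (x ^ 2) q) UNIV"
    unfolding l_def qpoch_eq_theta[OF q]
    using has_sum_mult[OF theta_has_sum[OF q3 q(1)] theta_has_sum[OF q, of "x ^ 2"]] x by simp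
  have r1: "(r1 has_sum theta x q * theta (q * x ^ 3) (q ^ 3)) UNIV"
    unfolding r1_def
    using has_sum_mult[OF theta_has_sum[OF q x] theta_has_sum[OF q3, of "q * x ^ 3"]] x q by simp
  have r2: "(r2 has_sum theta x q * (x * theta (q / x ^ 3) (q ^ 3))) UNIV"
    unfolding r2_def
    using has_sum_mult[OF theta_has_sum[OF q x] has_sum_cmult_right[OF theta_has_sum[OF q3, of "q / x ^ 3"], of x]] x q by simp
  \<comment> \<open>E and O stand for even and odd powers of x, the digit for the first or second
    product on the right.\<close>
  define E1 where "E1 = (\<lambda>(k, n). q powi (tri (2 * k - 3 * n) + 3 * tri n + n) * x powi (2 * k))"
  define E2 where "E2 = (\<lambda>(k, n). - (q powi (tri (2 * k - 1 + 3 * n) + 3 * tri n + n) * x powi (2 * k)))"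
  define O1 where "O1 = (\<lambda>(k, n). - (q powi (tri (2 * k + 1 - 3 * n) + 3 * tri n + n) * x powi (2 * k + 1)))"
  define O2 where "O2 = (\<lambda>(k, n). q powi (tri (2 * k + 3 * n) + 3 * tri n + n) * x powi (2 * k + 1))"
  have sgn: "(-1 :: complex) powi a * (-1) powi b = (if even (a + b) then 1 else -1)" for a b
    by (auto simp: power_int_minus_left)
  have lt: "l (j, k) = (if even (j + k) then 1 else -1) * (q powi (3 * tri j + j + tri k) * x powi (2 * k))" for j k
  proof -
    have "l (j, k) = ((-1) powi j * (-1) powi k) * (((q ^ 3) powi tri j * q powi j * q powi tri k) * (x ^ 2) powi k)"
      unfolding l_def theta_term_def by (simp add: mult_ac)
    thus ?thesis unfolding sgn pw using q by (simp add: power_int_add)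
  qed
  have r1t: "r1 (m, n) = (if even (m + n) then 1 else -1) * (q powi (tri m + 3 * tri n + n) * x powi (m + 3 * n))" for m n
  proof -
    have "r1 (m, n) = ((-1) powi m * (-1) powi n) * ((q powi tri m * (q ^ 3) powi tri n * q powi n) * (x powi m * (x ^ 3) powi n))"
      unfolding r1_def theta_term_def by (simp add: mult_ac power_int_mult_distrib)
    thus ?thesis unfolding sgn pw using q x by (simp add: power_int_add)
  qed
  have r2t: "r2 (m, n) = (if even (m + n) then 1 else -1) * (q powi (tri m + 3 * tri n + n) * x powi (m + 1 - 3 * n))" for m n
  proof -
    have "r2 (m, n) = ((-1) powi m * (-1) powi n) * ((q powi tri m * (q ^ 3) powi tri n * q powi n) * (x powi m * x / (x ^ 3) powi n))"
      unfolding r2_def theta_term_def by (simp add: mult_ac power_int_divide_distrib)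
    thus ?thesis unfolding sgn pw using q x by (simp add: power_int_add power_int_diff)
  qed
  define g1 where "g1 = (\<lambda>(k, n). (2 * k - 3 * n, n :: int))"
  define g2 where "g2 = (\<lambda>(k, n). (2 * k + 1 - 3 * n, n :: int))"
  define h1 where "h1 = (\<lambda>(k, n). (2 * k - 1 + 3 * n, n :: int))"
  define h2 where "h2 = (\<lambda>(k, n). (2 * k + 3 * n, n :: int))"
  \<comment> \<open>The left side is split by the parity of j + k and parametrised so that its
    halves agree term by term with \<open>E1\<close> and \<open>E2\<close>.\<close>
  define w1 where "w1 = (\<lambda>(k, n). (k - 2 * n, k :: int))"
  define w2 where "w2 = (\<lambda>(k, n). (1 - k - 2 * n, k :: int))"
  have split_r1: "inj g1" "inj g2" "range g1 \<inter> range g2 = {}" "range g1 \<union> range g2 = UNIV"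
  proof -
    show "inj g1" "inj g2" by (auto simp: inj_def g1_def g2_def)
    have False if "g1 (i, j) = g2 (k, l)" for i j k l
      using that unfolding g1_def g2_def by (simp; presburger)
    thus "range g1 \<inter> range g2 = {}" by (metis (no_types, lifting) disjoint_iff imageE surj_pair)
    have "(m, n) \<in> range g1 \<union> range g2" for m n
    proof (cases "even (m + n)")
      case True
      hence "g1 ((m + 3 * n) div 2, n) = (m, n)" unfolding g1_def by simp
      thus ?thesis by (metis UnI1 rangeI)
    next
      case False
      hence "g2 ((m + 3 * n - 1) div 2, n) = (m, n)" unfolding g2_def by (simp; presburger)
      thus ?thesis by (metis UnI2 rangeI)
    qed
    thus "range g1 \<union> range g2 = UNIV" by auto
  qed
  have split_r2: "inj h1" "inj h2" "range h1 \<inter> range h2 = {}" "range h1 \<union> range h2 = UNIV"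
  proof -
    show "inj h1" "inj h2" by (auto simp: inj_def h1_def h2_def)
    have False if "h1 (i, j) = h2 (k, l)" for i j k l
      using that unfolding h1_def h2_def by (simp; presburger)
    thus "range h1 \<inter> range h2 = {}" by (metis (no_types, lifting) disjoint_iff imageE surj_pair)
    have "(m, n) \<in> range h1 \<union> range h2" for m n
    proof (cases "even (m + n)")
      case True
      hence "h2 ((m - 3 * n) div 2, n) = (m, n)" unfolding h2_def by simp
      thus ?thesis by (metis UnI2 rangeI)
    next
      case False
      hence "h1 ((m - 3 * n + 1) div 2, n) = (m, n)" unfolding h1_def by (simp; presburger)
      thus ?thesis by (metis UnI1 rangeI)
    qed
    thus "range h1 \<union> range h2 = UNIV" by auto
  qed
  have split_l: "inj w1" "inj w2" "range w1 \<inter> range w2 = {}" "range w1 \<union> range w2 = UNIV"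
  proof -
    show "inj w1" "inj w2" by (auto simp: inj_def w1_def w2_def)
    have False if "w1 (i, j) = w2 (k, l)" for i j k l
      using that unfolding w1_def w2_def by (simp; presburger)
    thus "range w1 \<inter> range w2 = {}" by (metis (no_types, lifting) disjoint_iff imageE surj_pair)
    have "(m, n) \<in> range w1 \<union> range w2" for m n
    proof (cases "even (m + n)")
      case True
      hence "w1 (n, (n - m) div 2) = (m, n)" unfolding w1_def by (simp; presburger)
      thus ?thesis by (metis UnI1 rangeI)
    next
      case False
      hence "w2 (n, (1 - n - m) div 2) = (m, n)" unfolding w2_def by (simp; presburger)
      thus ?thesis by (metis UnI2 rangeI)
    qed
    thus "range w1 \<union> range w2 = UNIV" by auto
  qed
  have e: "r1 (g1 p) = E1 p" "r1 (g2 p) = O1 p" "r2 (h1 p) = E2 p" "r2 (h2 p) = O2 p" "l (w1 p) = E1 p" "l (w2 p) = E2 p" for p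
  proof -
    obtain k n where p: "p = (k, n)" by force
    show "r1 (g1 p) = E1 p" "r1 (g2 p) = O1 p" "r2 (h1 p) = E2 p" "r2 (h2 p) = O2 p"
      unfolding p g1_def g2_def h1_def h2_def prod.case r1t r2t E1_def E2_def O1_def O2_def
      by (simp_all add: algebra_simps)
    have w1e: "3 * tri (k - 2 * n) + (k - 2 * n) + tri k = tri (2 * k - 3 * n) + 3 * tri n + n"
      using two_tri[of "k - 2 * n"] two_tri[of k] two_tri[of "2 * k - 3 * n"] two_tri[of n] by (auto simp: algebra_simps)
    show "l (w1 p) = E1 p" unfolding p w1_def prod.case lt E1_def w1e by simp
    have w2e: "3 * tri (1 - k - 2 * n) + (1 - k - 2 * n) + tri k = tri (2 * k - 1 + 3 * n) + 3 * tri n + n"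
      using two_tri[of "1 - k - 2 * n"] two_tri[of k] two_tri[of "2 * k - 1 + 3 * n"] two_tri[of n] by (auto simp: algebra_simps)
    show "l (w2 p) = E2 p" unfolding p w2_def prod.case lt E2_def w2e by simp
  qed
  \<comment> \<open>The shear n -> n + k preserves the power of x and carries the exponent of q in
    \<open>O1\<close> to that in \<open>O2\<close>, with opposite sign.\<close>
  have "bij (\<lambda>(k, n). (k, n + k :: int))"
    by (rule bij_betw_byWitness[of _ "\<lambda>(k, n). (k, n - k)"]) auto
  hence "infsum (\<lambda>p. O1 ((\<lambda>(k, n). (k, n + k)) p)) UNIV = infsum O1 UNIV"
    by (rule infsum_reindex_bij_betw)
  also have "(\<lambda>p. O1 ((\<lambda>(k, n). (k, n + k)) p)) = (\<lambda>p. - O2 p)"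
  proof (intro ext, clarify)
    fix k n :: int
    have tr: "tri (2 * k + 1 - 3 * (n + k)) + 3 * tri (n + k) + (n + k) = tri (2 * k + 3 * n) + 3 * tri n + n"
      using two_tri[of "2 * k + 1 - 3 * (n + k)"] two_tri[of "n + k"] two_tri[of "2 * k + 3 * n"] two_tri[of n]
      by (auto simp: algebra_simps)
    show "O1 (k, n + k) = - O2 (k, n)" unfolding O1_def O2_def prod.case tr by simp
  qed
  finally have OO: "infsum O1 UNIV = - infsum O2 UNIV" by (simp add: infsum_uminus)
  show ?thesis
    using has_sum_split_infsum(1)[OF split_l l] has_sum_split_infsum(1)[OF split_r1 r1]
      has_sum_split_infsum(1)[OF split_r2 r2] OO unfolding e by (simp add: algebra_simps)
qed

subsection \<open>The Kronecker function\<close>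

lemma norm_mult_power_less_1:
  fixes x q :: complex
  assumes "norm x < 1" "norm q < 1"
  shows "norm (x * q ^ m) < 1"
proof -
  have "norm x * norm q ^ m \<le> norm x * 1"
    using assms by (intro mult_left_mono power_le_one) auto
  also have "\<dots> < 1" using assms by simp
  finally show ?thesis by (simp add: norm_mult norm_power)
qed

text \<open>\<open>kron\<close> is Kronecker's double series, the sum of \<open>x^i y^j q^(ij)\<close> over the
    quadrant \<open>i, j \<ge> 0\<close> minus
the one over \<open>i, j < 0\<close>; \<open>geom2\<close> is a single quadrant.\<close>

definition geom2 :: "complex \<Rightarrow> complex \<Rightarrow> complex \<Rightarrow> complex" where
  "geom2 x y q = infsum (\<lambda>(i, j). x ^ i * y ^ j * q ^ (i * j)) UNIV"

lemma geom2_has_sum: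
  assumes "norm x < 1" "norm y < 1" "norm q < 1"
  shows "((\<lambda>(i, j). x ^ i * y ^ j * q ^ (i * j)) has_sum geom2 x y q) UNIV"
proof -
  have "((\<lambda>i. x ^ i) has_sum 1 / (1 - x)) UNIV" "((\<lambda>j. y ^ j) has_sum 1 / (1 - y)) UNIV"
    using assms by (auto intro!: norm_summable_imp_has_sum geometric_sums simp: norm_power)
  from has_sum_imp_summable[OF has_sum_mult[OF this]]
  have h: "(\<lambda>(i, j). norm (x ^ i * y ^ j)) summable_on UNIV"
    by (simp add: summable_on_iff_abs_summable_on_complex case_prod_unfold)
  show ?thesis
    unfolding geom2_def
  proof (rule has_sum_infsum, rule summable_on_dominated[OF h], clarify)
    fix i j
    have "norm q ^ (i * j) \<le> 1" using assms by (intro power_le_one) auto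
    thus "norm (x ^ i * y ^ j * q ^ (i * j)) \<le> norm (x ^ i * y ^ j)"
      by (simp add: norm_mult norm_power mult_left_le)
  qed
qed

lemma geom2_commute:
  shows "geom2 x y q = geom2 y x q"
proof -
  have "bij (\<lambda>(i, j). (j, i :: nat))" by (rule bij_betw_byWitness[of _ "\<lambda>(i, j). (j, i)"]) auto
  from infsum_reindex_bij_betw[OF this, of "\<lambda>(i, j). x ^ i * y ^ j * q ^ (i * j)"]
  show ?thesis by (simp add: geom2_def case_prod_unfold mult_ac)
qed

lemma geom2_has_sum1:
  assumes "norm x < 1" "norm y < 1" "norm q < 1"
  shows "((\<lambda>j. y ^ j / (1 - x * q ^ j)) has_sum geom2 x y q) UNIV"
proof -
  have "((\<lambda>(j, i). x ^ i * y ^ j * q ^ (i * j)) has_sum geom2 x y q) (UNIV \<times> UNIV)"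
    using geom2_has_sum[OF assms(2,1,3)] by (simp add: geom2_commute[of x y] mult_ac)
  thus ?thesis
  proof (rule has_sum_SigmaD)
    fix j
    have "norm (x * q ^ j) < 1"
      using assms by (intro norm_mult_power_less_1)
    hence "((\<lambda>i. (x * q ^ j) ^ i) has_sum 1 / (1 - x * q ^ j)) UNIV"
      by (auto intro!: norm_summable_imp_has_sum geometric_sums simp: norm_power norm_mult)
    from has_sum_cmult_right[OF this, of "y ^ j"]
    show "((\<lambda>i. case (j, i) of (j, i) \<Rightarrow> x ^ i * y ^ j * q ^ (i * j)) has_sum y ^ j / (1 - x * q ^ j)) UNIV"
      by (simp add: power_mult_distrib mult_ac flip: power_mult)
  qed
qed

definition kron :: "complex \<Rightarrow> complex \<Rightarrow> complex \<Rightarrow> complex" where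
  "kron x y q = geom2 x y q - q / (x * y) * geom2 (q / x) (q / y) q"

lemma kron_commute: "kron x y q = kron y x q"
  by (simp add: kron_def geom2_commute mult.commute)

text \<open>The region where both quadrants of \<open>kron\<close> converge, that is |x| < 1 and
  |q/x| < 1; it is stable under x -> q/x.\<close>

definition annulus :: "complex \<Rightarrow> complex set" where
  "annulus q = {x. norm q < norm x \<and> norm x < 1}"

lemma annulusD:
  assumes "x \<in> annulus q" "q \<noteq> 0"
  shows "norm x < 1" "norm (q / x) < 1" "norm q < 1" "x \<noteq> 0" "q / x \<in> annulus q"
proof -
  show *: "norm x < 1" "norm q < 1" "x \<noteq> 0" "norm (q / x) < 1"
    using assms by (auto simp: annulus_def norm_divide divide_simps)
  have "norm q < norm q / norm x"
    using * assms(2) by (simp add: field_simps)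
  thus "q / x \<in> annulus q" using *(4) by (simp add: annulus_def norm_divide)
qed

lemma power_int_neg_index:
  fixes q :: complex
  shows "q powi (- 1 - int j) = 1 / (q * q ^ j)"
proof -
  have "q powi (- 1 - int j) = q powi (- int (Suc j))" by simp
  also have "\<dots> = inverse (q ^ Suc j)"
    by (simp only: power_int_minus power_int_of_nat)
  finally show ?thesis by (simp add: inverse_eq_divide)
qed

lemma annulus_nonzero:
  assumes "x \<in> annulus q" "q \<noteq> 0"
  shows "1 - x * q powi n \<noteq> 0"
proof (cases "n \<ge> 0")
  case True
  then obtain m where m: "n = int m" using nonneg_int_cases by blast
  have "norm (x * q powi n) < 1"
    using norm_mult_power_less_1[of x q m] annulusD[OF assms] by (simp add: m)
  thus ?thesis by auto
next
  case False
  hence "n = - 1 - int (nat (- n - 1))" by auto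
  then obtain m where m: "n = - 1 - int m" ..
  have "norm (q / x * q ^ m) < 1"
    using annulusD[OF assms] by (intro norm_mult_power_less_1)
  moreover have "x * q powi n * (q / x * q ^ m) = 1"
    using annulusD[OF assms] assms by (simp add: m power_int_neg_index)
  ultimately show ?thesis by (metis less_irrefl mult_1 norm_one right_minus_eq)
qed

lemma int_split: "inj int" "inj (\<lambda>j. - 1 - int j)" "range int \<inter> range (\<lambda>j. - 1 - int j) = {}"
  "range int \<union> range (\<lambda>j. - 1 - int j) = UNIV"
proof -
  have "n \<in> range int \<union> range (\<lambda>j. - 1 - int j)" for n
  proof (cases "n \<ge> 0")
    case True
    thus ?thesis using nonneg_int_cases by blast
  next
    case False
    hence "n = - 1 - int (nat (- n - 1))" by auto
    thus ?thesis by blast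
  qed
  thus "range int \<union> range (\<lambda>j. - 1 - int j) = UNIV" by auto
qed (auto simp: inj_def)

text \<open>If u v = 1 then 1/(1 - u) = - v/(1 - v). This turns the negative indices of a bilateral
  series in x into a one-sided series in q/x.\<close>

lemma inverse_neg_index:
  fixes x q :: complex
  assumes "x \<noteq> 0" "q \<noteq> 0" "1 - x * q powi (- 1 - int j) \<noteq> 0"
  shows "1 / (1 - x * q powi (- 1 - int j)) = - (q / x * q ^ j) / (1 - q / x * q ^ j)"
proof -
  have "x * q powi (- 1 - int j) * (q / x * q ^ j) = 1"
    using assms(1,2) by (simp add: power_int_neg_index)
  moreover have "1 / (1 - u) = - v / (1 - v)" if "u * v = 1" "1 - u \<noteq> 0" for u v :: complex
  proof -
    have "1 - v \<noteq> 0" using that by auto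
    thus ?thesis using that by (simp add: divide_simps algebra_simps)
  qed
  ultimately show ?thesis using assms(3) by blast
qed

text \<open>Summing one geometric progression in each quadrant gives the bilateral series; the
  second quadrant supplies the indices n = -1 - j.\<close>

lemma kron_has_sum:
  assumes "q \<noteq> 0" and x: "x \<in> annulus q" and y: "y \<in> annulus q"
  shows "((\<lambda>n. y powi n / (1 - x * q powi n)) has_sum kron x y q) UNIV"
proof -
  note X = annulusD[OF x assms(1)] and Y = annulusD[OF y assms(1)]
  have "((\<lambda>j. y powi int j / (1 - x * q powi int j)) has_sum geom2 x y q) UNIV"
    using geom2_has_sum1[OF X(1) Y(1) X(3)] by simp
  moreover have "((\<lambda>j. y powi (- 1 - int j) / (1 - x * q powi (- 1 - int j))) has_sum - (q / (x * y)) * geom2 (q / x) (q / y) q) UNIV"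
  proof -
    have "y powi (- 1 - int j) / (1 - x * q powi (- 1 - int j)) =
       - (q / (x * y)) * ((q / y) ^ j / (1 - q / x * q ^ j))" for j
    proof -
      have "1 / (1 - x * q powi (- 1 - int j)) = - (q / x * q ^ j) / (1 - q / x * q ^ j)"
        by (rule inverse_neg_index) (use X assms annulus_nonzero[OF x assms(1)] in auto)
      hence "y powi (- 1 - int j) * (1 / (1 - x * q powi (- 1 - int j))) =
          1 / (y * y ^ j) * (- (q / x * q ^ j) / (1 - q / x * q ^ j))"
        by (simp only: power_int_neg_index)
      thus ?thesis by (simp add: power_divide mult_ac)
    qed
    thus ?thesis
      using has_sum_cmult_right[OF geom2_has_sum1[OF X(2) Y(2) X(3)], of "- (q / (x * y))"] by simp
  qed
  ultimately have "((\<lambda>n. y powi n / (1 - x * q powi n)) has_sum (geom2 x y q + - (q / (x * y)) * geom2 (q / x) (q / y) q)) UNIV"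
    by (rule has_sum_split[OF int_split, where f = "\<lambda>n. y powi n / (1 - x * q powi n)"])
  thus ?thesis by (simp add: kron_def)
qed

lemma theta_term_Suc:
  assumes "q \<noteq> 0" "x \<noteq> 0"
  shows "theta_term x q (n + 1) = - x * q powi n * theta_term x q n"
proof -
  have tr: "tri (n + 1) = tri n + n" using tri_add[of n 1] by (simp add: tri_def)
  show ?thesis
    unfolding theta_term_def tr using assms by (simp add: power_int_add)
qed

text \<open>The product of the bilateral series for \<open>kron\<close> with the series for
  \<open>theta y q\<close> is sorted by the total power y^N. Its coefficients \<open>u N\<close>
  obey the recurrence of the coefficients of theta in x, so they sum up to theta(xy) times
  \<open>u 0\<close>, which is free of y.\<close>

lemma kron_theta:
  assumes q: "q \<noteq> 0" and x: "x \<in> annulus q" and y: "y \<in> annulus q"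
  shows "((\<lambda>m. (-1) powi m * q powi tri m / (1 - x * q powi (- m))) has_sum
            infsum (\<lambda>m. (-1) powi m * q powi tri m / (1 - x * q powi (- m))) UNIV) UNIV" (is ?A)
    and "kron x y q * theta y q = infsum (\<lambda>m. (-1) powi m * q powi tri m / (1 - x * q powi (- m))) UNIV * theta (x * y) q" (is ?B)
proof -
  note X = annulusD[OF x q] and Y = annulusD[OF y q]
  define u where "u = (\<lambda>N. infsum (\<lambda>m. (-1) powi m * q powi tri m / (1 - x * q powi (N - m))) UNIV)"
  have nz: "1 - x * q powi n \<noteq> 0" for n by (rule annulus_nonzero[OF x q])
  have "((\<lambda>(n, m). y powi n / (1 - x * q powi n) * theta_term y q m) has_sum kron x y q * theta y q) UNIV"
    using has_sum_mult[OF kron_has_sum[OF q x y] theta_has_sum[of q y]] q X Y by simp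
  moreover have "bij (\<lambda>(N, m). (N - m, m :: int))"
    by (rule bij_betw_byWitness[of _ "\<lambda>(n, m). (n + m, m)"]) auto
  ultimately have S: "((\<lambda>(N, m). y powi (N - m) / (1 - x * q powi (N - m)) * theta_term y q m) has_sum kron x
      y q * theta y q) (UNIV \<times> UNIV)"
    using has_sum_reindex_bij by (fastforce simp: case_prod_unfold)
  have t: "y powi (N - m) / (1 - x * q powi (N - m)) * theta_term y q m =
      y powi N * ((-1) powi m * q powi tri m / (1 - x * q powi (N - m)))" for N m
    using Y by (simp add: theta_term_def power_int_diff)
  have su: "(\<lambda>m. (-1) powi m * q powi tri m / (1 - x * q powi (N - m))) summable_on UNIV" for N
  proof -
    have "(\<lambda>m. y powi N * ((-1) powi m * q powi tri m / (1 - x * q powi (N - m)))) summable_on UNIV"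
      using summable_on_SigmaD1[OF has_sum_imp_summable[OF S], of N] unfolding t by simp
    from summable_on_cmult_right[OF this, of "1 / y powi N"] show ?thesis
      using Y by simp
  qed
  hence hu: "((\<lambda>m. (-1) powi m * q powi tri m / (1 - x * q powi (N - m))) has_sum u N) UNIV" for N
    by (simp add: u_def)
  show ?A using hu[of 0] by (simp add: u_def)
  have "((\<lambda>N. y powi N * u N) has_sum kron x y q * theta y q) UNIV"
    by (rule has_sum_SigmaD[OF S], simp only: prod.case t, rule has_sum_cmult_right[OF hu])
  \<comment> \<open>In u(N + 1) + x q^N u(N) the numerator over each denominator is divisible by it,
    and what is left is - theta(q; q) = 0.\<close>
  moreover have step: "u (N + 1) = - x * q powi N * u N" for N
  proof -
    have "bij (\<lambda>m::int. m + 1)" by (simp add: bij_plus_right)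
    from has_sum_reindex_bij[OF hu[of "N + 1"] this]
    have "((\<lambda>m. (-1) powi (m + 1) * q powi tri (m + 1) / (1 - x * q powi (N - m))) has_sum u (N + 1)) UNIV"
      by simp
    from has_sum_add[OF this has_sum_cmult_right[OF hu[of N], of "x * q powi N"]]
    have "((\<lambda>m. (-1) powi (m + 1) * q powi tri (m + 1) / (1 - x * q powi (N - m)) +
        x * q powi N * ((-1) powi m * q powi tri m / (1 - x * q powi (N - m)))) has_sum u (N + 1) + x * q powi N * u N) UNIV" .
    also have "(\<lambda>m. (-1) powi (m + 1) * q powi tri (m + 1) / (1 - x * q powi (N - m)) +
        x * q powi N * ((-1) powi m * q powi tri m / (1 - x * q powi (N - m)))) = (\<lambda>m. - theta_term q q m)"
    proof
      fix m
      have tr: "tri (m + 1) = tri m + m" using tri_add[of m 1] by (simp add: tri_def)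
      have "(-1) powi (m + 1) * q powi tri (m + 1) + x * q powi N * ((-1) powi m * q powi tri m) =
            - (theta_term q q m) * (1 - x * q powi (N - m))"
        unfolding theta_term_def tr using q
        by (simp add: power_int_add power_int_diff power_int_minus_left field_simps)
      thus "(-1) powi (m + 1) * q powi tri (m + 1) / (1 - x * q powi (N - m)) +
        x * q powi N * ((-1) powi m * q powi tri m / (1 - x * q powi (N - m))) = - theta_term q q m"
        using nz[of "N - m"] by (simp add: divide_simps)
    qed
    finally have "((\<lambda>m. - theta_term q q m) has_sum u (N + 1) + x * q powi N * u N) UNIV" .
    moreover have "((\<lambda>m. - theta_term q q m) has_sum 0) UNIV"
      using has_sum_uminusI[OF theta_has_sum[of q q]] q X theta_nome[of q] by simp
    ultimately have "u (N + 1) + x * q powi N * u N = 0" by (rule has_sum_unique)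
    thus ?thesis by (simp add: eq_neg_iff_add_eq_0)
  qed
  have uN: "u N = theta_term x q N * u 0" for N
  proof (induction N rule: int_induct[of _ 0])
    case base thus ?case by (simp add: theta_term_def tri_def)
  next
    case (step1 i)
    thus ?case using step[of i] q X by (simp add: theta_term_Suc)
  next
    case (step2 i)
    have "theta_term x q i = - x * q powi (i - 1) * theta_term x q (i - 1)"
      using theta_term_Suc[of q x "i - 1"] q X by simp
    moreover have "u i = - x * q powi (i - 1) * u (i - 1)"
      using step[of "i - 1"] by simp
    ultimately have "(- x * q powi (i - 1)) * u (i - 1) = (- x * q powi (i - 1)) * (theta_term x q (i - 1) * u 0)"
      using step2(2) by (simp only: mult.assoc)
    thus ?case using q X by auto
  qed
  have "(\<lambda>N. y powi N * u N) = (\<lambda>N. theta_term (x * y) q N * u 0)"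
    by (subst uN) (simp add: theta_term_def power_int_mult_distrib mult_ac)
  ultimately have "((\<lambda>N. theta_term (x * y) q N * u 0) has_sum kron x y q * theta y q) UNIV" by simp
  moreover have "((\<lambda>N. theta_term (x * y) q N * u 0) has_sum theta (x * y) q * u 0) UNIV"
    by (rule has_sum_cmult_left[OF theta_has_sum]) (use q X Y in auto)
  ultimately show ?B using has_sum_unique by (fastforce simp: u_def mult.commute)
qed

text \<open>Locally uniform convergence by the M-test; it is needed for the zero of theta at 1 in
  the limit that fixes the constant of \<open>kron_eq\<close>.\<close>

lemma qpoch_continuous:
  fixes q :: complex
  assumes q: "norm q < 1"
  shows "continuous_on UNIV (\<lambda>x. qpoch_inf x q)"
proof -
  have "continuous_on (cball 0 R) (\<lambda>x. qpoch_inf x q)" for R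
  proof -
    have "uniformly_convergent_on (cball 0 R) (\<lambda>N x. \<Sum>n<N. norm (- x * q ^ n))"
    proof (rule Weierstrass_m_test')
      show "norm (norm (- x * q ^ n)) \<le> R * norm q ^ n" if "x \<in> cball 0 R" for x n
        using that by (auto simp: norm_mult norm_power intro!: mult_right_mono)
      show "summable (\<lambda>n. R * norm q ^ n)" using q by (intro summable_mult summable_geometric) auto
    qed
    hence "uniformly_convergent_on (cball 0 R) (\<lambda>N x. \<Prod>n<N. 1 + (- x * q ^ n))"
      by (intro uniformly_convergent_on_prod continuous_intros) auto
    then obtain l where l: "uniform_limit (cball 0 R) (\<lambda>N x. \<Prod>n<N. 1 + (- x * q ^ n)) l sequentially"
      by (auto simp: uniformly_convergent_on_def)
    have lx: "l x = qpoch_inf x q" if "x \<in> cball 0 R" for x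
      using tendsto_uniform_limitI[OF l that] qpoch_LIMSEQ[OF q, of x] LIMSEQ_unique by fastforce
    have "continuous_on (cball 0 R) l"
      by (rule uniform_limit_theorem[OF _ l]) (auto intro!: always_eventually continuous_intros)
    thus ?thesis using lx by (rule continuous_on_eq)
  qed
  hence "continuous_on (ball 0 R) (\<lambda>x. qpoch_inf x q)" for R
    by (rule continuous_on_subset[of "cball 0 R"]) auto
  hence "isCont (\<lambda>x. qpoch_inf x q) x" for x
    by (rule continuous_on_interior[of "ball 0 (norm x + 1)"]) auto
  thus ?thesis by (simp add: continuous_at_imp_continuous_on)
qed

text \<open>Symmetry of \<open>kron\<close> gives u(x) theta(x) = u(y) theta(y) unless x y = q, so
  this product is a constant. Its value appears as y tends to 1, where u has a simple pole and theta
  a simple zero.\<close>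

lemma kron_eq:
  assumes q: "q \<noteq> 0" and x: "x \<in> annulus q" and y: "y \<in> annulus q"
  shows "kron x y q * theta x q * theta y q = qpoch_inf q q ^ 3 * theta (x * y) q"
proof -
  define u where "u = (\<lambda>x. infsum (\<lambda>m. (-1) powi m * q powi tri m / (1 - x * q powi (- m))) UNIV)"
  note X = annulusD[OF x q]
  have K: "kron x y q * theta y q = u x * theta (x * y) q" if "x \<in> annulus q" "y \<in> annulus q" for x y
    using kron_theta(2)[OF q that] by (simp add: u_def)
  have sym: "u x * theta x q = u y * theta y q" if x: "x \<in> annulus q" and y: "y \<in> annulus q" and ne: "x * y \<noteq> q" for x y
  proof -
    note X = annulusD[OF x q] and Y = annulusD[OF y q]
    have "u x * theta x q * theta (x * y) q = u y * theta y q * theta (x * y) q"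
      using K[OF x y] K[OF y x] unfolding kron_commute[of y x] mult.commute[of y x] by algebra
    \<comment> \<open>As |q|^2 < |x y| < 1, the only zero of theta within reach is x y = q.\<close>
    moreover have "theta (x * y) q \<noteq> 0"
    proof -
      have xy: "norm (x * y) < 1"
      proof -
        have "norm x * norm y < 1 * 1" by (intro mult_strict_mono X Y) auto
        thus ?thesis by (simp add: norm_mult)
      qed
      have "qpoch_inf (q / (x * y)) q \<noteq> 0"
      proof (rule qpoch_nonzero[OF X(3)])
        fix k
        show "q / (x * y) * q ^ k \<noteq> 1"
        proof (cases k)
          case 0 thus ?thesis using ne X Y by (auto simp: field_simps)
        next
          case (Suc j)
          have "norm (q / x * (q / y)) < 1 * 1"
            unfolding norm_mult by (intro mult_strict_mono X Y) auto
          hence "norm ((q / x * (q / y)) * q ^ j) < 1"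
            by (intro norm_mult_power_less_1 X) auto
          hence "q / x * (q / y) * q ^ j \<noteq> 1" by force
          thus ?thesis by (simp add: Suc mult_ac)
        qed
      qed
      thus ?thesis using triple_product[OF X(3) q, of "x * y"] X Y xy qpoch_nonzero'[OF X(3) xy] qpoch_nonzero'[OF X(3) X(3)]
        by simp
    qed
    ultimately show ?thesis by simp
  qed
  \<comment> \<open>Real points tending to 1 from inside the unit circle; they lie in the annulus
    eventually.\<close>
  define Y where "Y = (\<lambda>k. complex_of_real (1 - 1 / real (k + 2)))"
  have Y1: "Y \<longlonglongrightarrow> 1"
  proof -
    have "(\<lambda>k. complex_of_real (1 - 1 / real (k + 2))) \<longlonglongrightarrow> complex_of_real (1 - 0)"
      by (intro tendsto_intros LIMSEQ_ignore_initial_segment[OF lim_1_over_n, of 2])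
    thus ?thesis by (simp add: Y_def)
  qed
  have normY: "norm (Y k) = 1 - 1 / real (k + 2)" for k
    unfolding Y_def norm_of_real by (auto simp: field_simps)
  have Yne: "Y k \<noteq> 1" "Y k \<noteq> 0" for k
    using normY[of k] by (auto simp: field_simps)
  have nY: "(\<lambda>k. norm (Y k)) \<longlonglongrightarrow> 1"
    using tendsto_norm[OF Y1] by simp
  have evq: "eventually (\<lambda>k. norm (Y k) > (1 + norm q) / 2) sequentially"
    by (rule order_tendstoD(1)[OF nY]) (use X in auto)
  have evA: "eventually (\<lambda>k. Y k \<in> annulus q) sequentially"
    using evq by eventually_elim (use X in \<open>auto simp: annulus_def normY\<close>)
  have "(\<lambda>k. x * Y k) \<longlonglongrightarrow> x * 1" by (intro tendsto_intros Y1)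
  moreover have "x * 1 \<noteq> q" using x by (auto simp: annulus_def)
  ultimately have evne: "eventually (\<lambda>k. x * Y k \<noteq> q) sequentially"
    by (rule tendsto_imp_eventually_ne)
  have lim1: "(\<lambda>k. u (Y k) * (1 - Y k)) \<longlonglongrightarrow> 1"
  proof -
    \<comment> \<open>A bound for |(1 - y)/(1 - y q^(-m))|. The quotient is 1 for m = 0; otherwise
      |y q^(-m)| is at most |q| (m < 0) or at least (1 + |q|)/(2 |q|) (m > 0), which keeps the
      denominator away from 0.\<close>
    define B where "B = 1 + 2 / (1 - norm q)"
    have "(\<lambda>k. infsum (\<lambda>m. (-1) powi m * q powi tri m / (1 - Y k * q powi (- m)) * (1 - Y k)) UNIV) \<longlonglongrightarrow>
        infsum (\<lambda>m. if m = 0 then 1 else 0) (UNIV :: int set)"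
    proof (rule infsum_dominated_tendsto)
      fix m :: int
      show "(\<lambda>k. (-1) powi m * q powi tri m / (1 - Y k * q powi (- m)) * (1 - Y k)) \<longlonglongrightarrow> (if m = 0 then 1 else 0)"
      proof (cases "m = 0")
        case True
        have "(-1) powi m * q powi tri m / (1 - Y k * q powi (- m)) * (1 - Y k) = 1" for k
          using True Yne[of k] by (simp add: tri_def)
        thus ?thesis using True by simp
      next
        case False
        have "1 - 1 * q powi (- m) \<noteq> 0"
        proof
          assume "1 - 1 * q powi (- m) = 0"
          hence "norm q powi (- m) = 1" by (metis diff_eq_diff_eq cancel_comm_monoid_add_class.diff_cancel mult_1 norm_one norm_power_int)
          moreover have "norm q powi (- m) = (if m \<ge> 0 then inverse (norm q ^ nat m) else norm q ^ nat (- m))"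
            by (auto simp: power_int_minus) (auto simp: power_int_def power_inverse)
          ultimately have "norm q ^ nat \<bar>m\<bar> = 1"
            by (auto split: if_splits)
          thus False using X q False power_less_one_iff[of "norm q" "nat \<bar>m\<bar>"] by auto
        qed
        hence "(\<lambda>k. (-1) powi m * q powi tri m / (1 - Y k * q powi (- m)) * (1 - Y k)) \<longlonglongrightarrow>
            (-1) powi m * q powi tri m / (1 - 1 * q powi (- m)) * (1 - 1)"
          by (intro tendsto_intros Y1)
        thus ?thesis using False by simp
      qed
    next
      show "eventually (\<lambda>k. \<forall>m\<in>UNIV. norm ((-1) powi m * q powi tri m / (1 - Y k * q powi (- m)) * (1 - Y k))
               \<le> norm q powi tri m * 1 powi m * B) sequentially"
        using evq
      proof (eventually_elim, intro ballI)
        fix k and m :: int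
        assume yq: "(1 + norm q) / 2 < norm (Y k)"
        have y1: "norm (1 - Y k) \<le> 1"
        proof -
          have "1 - Y k = complex_of_real (1 / real (k + 2))" by (simp add: Y_def)
          thus ?thesis by (simp only: norm_of_real) simp
        qed
        have "norm ((1 - Y k) / (1 - Y k * q powi (- m))) \<le> B"
        proof -
          consider "m = 0" | "m < 0" | "m > 0" by linarith
          thus ?thesis
          proof cases
            case 1
            thus ?thesis using X by (simp add: B_def norm_divide)
          next
            case 2
            then obtain n where m: "- m = int (Suc n)" by (metis neg_0_less_iff_less zero_less_imp_eq_int gr0_implies_Suc)
            have "norm (Y k * q powi (- m)) \<le> 1 * norm q"
            proof -
              have "norm (Y k) * norm q ^ Suc n \<le> 1 * norm q ^ 1"
                using X by (intro mult_mono power_decreasing) (auto simp: normY)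
              thus ?thesis by (simp only: m power_int_of_nat norm_mult norm_power) simp
            qed
            hence "1 - norm q \<le> norm (1 - Y k * q powi (- m))"
              using norm_triangle_ineq2[of 1 "Y k * q powi (- m)"] by simp
            hence "norm (1 - Y k) / norm (1 - Y k * q powi (- m)) \<le> 1 / (1 - norm q)"
              using y1 X by (intro frac_le) auto
            also have "\<dots> \<le> B" using X by (simp add: B_def divide_simps)
            finally show ?thesis by (simp add: norm_divide)
          next
            case 3
            then obtain n where m: "m = int (Suc n)" by (metis zero_less_imp_eq_int gr0_implies_Suc)
            have n: "norm (Y k * q powi (- m)) = norm (Y k) / norm q ^ Suc n"
              by (simp only: m norm_mult norm_inverse norm_power power_int_minus power_int_of_nat divide_inverse)
            have "norm q ^ Suc n \<le> norm q ^ 1" using X by (intro power_decreasing) auto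
            hence "(1 + norm q) / 2 / norm q \<le> norm (Y k) / norm q ^ Suc n"
              using yq X q by (intro frac_le) auto
            moreover have "(1 + norm q) / 2 / norm q - 1 \<ge> (1 - norm q) / 2"
            proof -
              have "norm q * (1 - norm q) \<le> 1 * (1 - norm q)" using X by (intro mult_right_mono) auto
              thus ?thesis using q by (simp add: field_simps)
            qed
            ultimately have "(1 - norm q) / 2 \<le> norm (Y k * q powi (- m)) - 1"
              unfolding n by linarith
            also have "\<dots> \<le> norm (1 - Y k * q powi (- m))"
              using norm_triangle_ineq2[of "Y k * q powi (- m)" 1] by (simp add: norm_minus_commute)
            finally have "norm (1 - Y k) / norm (1 - Y k * q powi (- m)) \<le> 1 / ((1 - norm q) / 2)"
              using y1 X by (intro frac_le) auto
            also have "\<dots> \<le> B" using X by (simp add: B_def)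
            finally show ?thesis by (simp add: norm_divide)
          qed
        qed
        hence "norm q powi tri m * norm ((1 - Y k) / (1 - Y k * q powi (- m))) \<le> norm q powi tri m * B"
          by (intro mult_left_mono) auto
        thus "norm ((-1) powi m * q powi tri m / (1 - Y k * q powi (- m)) * (1 - Y k)) \<le> norm q powi tri m * 1 powi m * B"
          by (simp add: norm_mult norm_divide norm_power_int)
      qed
      show "(\<lambda>m. norm q powi tri m * 1 powi m * B) summable_on UNIV"
        by (rule summable_on_cmult_left[OF theta_summable_real]) (use q X in auto)
    qed
    moreover have "infsum (\<lambda>m. (-1) powi m * q powi tri m / (1 - Y k * q powi (- m)) * (1 - Y k)) UNIV = u (Y k) * (1 - Y k)" for k
      unfolding u_def by (rule infsum_cmult_left')
    moreover have "infsum (\<lambda>m. if m = 0 then 1 else 0) (UNIV :: int set) = (1 :: complex)"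
      by (rule infsumI, rule has_sum_finite_neutralI[of "{0}"]) auto
    ultimately show ?thesis by simp
  qed
  \<comment> \<open>The factor 1 - y is split off the product form of theta, and the remaining three
    products are continuous at y = 1.\<close>
  have lim2: "(\<lambda>k. theta (Y k) q / (1 - Y k)) \<longlonglongrightarrow> qpoch_inf q q ^ 3"
  proof -
    have cont: "(\<lambda>k. qpoch_inf (f k) q) \<longlonglongrightarrow> qpoch_inf c q" if "f \<longlonglongrightarrow> c" for f c
      using continuous_on_tendsto_compose[OF qpoch_continuous[OF X(3)] that] by auto
    have "(\<lambda>k. qpoch_inf (Y k * q) q * qpoch_inf (q / Y k) q * qpoch_inf q q) \<longlonglongrightarrow>
        qpoch_inf (1 * q) q * qpoch_inf (q / 1) q * qpoch_inf q q"
      by (intro tendsto_intros cont Y1) auto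
    moreover have "qpoch_inf (Y k * q) q * qpoch_inf (q / Y k) q * qpoch_inf q q = theta (Y k) q / (1 - Y k)" for k
    proof -
      show ?thesis
        using Yne[of k] triple_product[OF X(3) q, of "Y k"] qpoch_split[OF X(3), of "Y k" 1] by simp
    qed
    ultimately show ?thesis by (simp add: power3_eq_cube)
  qed
  have "(\<lambda>k. u (Y k) * (1 - Y k) * (theta (Y k) q / (1 - Y k))) \<longlonglongrightarrow> 1 * qpoch_inf q q ^ 3"
    by (intro tendsto_mult lim1 lim2)
  moreover have "eventually (\<lambda>k. u (Y k) * (1 - Y k) * (theta (Y k) q / (1 - Y k)) = u x * theta x q) sequentially"
    using evA evne
  proof eventually_elim
    case (elim k)
    thus ?case using sym[OF x elim] Yne[of k] by simp
  qed
  ultimately have "(\<lambda>k. u x * theta x q) \<longlonglongrightarrow> qpoch_inf q q ^ 3"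
    by (simp add: Lim_transform_eventually)
  hence "u x * theta x q = qpoch_inf q q ^ 3" by (simp add: LIMSEQ_const_iff)
  thus ?thesis using K[OF x y] by (metis mult.assoc mult.commute)
qed

lemma theta_annulus_nonzero:
  assumes q: "q \<noteq> 0" and x: "x \<in> annulus q"
  shows "theta x q \<noteq> 0"
  using annulusD[OF x q] triple_product[of q x] q by (simp add: qpoch_nonzero')

lemma kron_eq_0:
  assumes q: "q \<noteq> 0" and x: "x \<in> annulus q" and y: "y \<in> annulus q" and xy: "x * y = q"
  shows "kron x y q = 0"
  using kron_eq[OF q x y] theta_annulus_nonzero[OF q x] theta_annulus_nonzero[OF q y]
    theta_nome[OF q] annulusD[OF x q] by (simp add: xy)

section \<open>Lambert series and the four-term relation for the Kronecker function\<close>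

definition lambert :: "complex \<Rightarrow> complex \<Rightarrow> complex" where
  "lambert x q = infsum (\<lambda>n::nat. x * q ^ n / (1 - x * q ^ n)) UNIV"

lemma lambert_has_sum:
  assumes "norm x < 1" "norm q < 1"
  shows "((\<lambda>n. x * q ^ n / (1 - x * q ^ n)) has_sum lambert x q) UNIV"
  unfolding lambert_def
proof (rule has_sum_infsum, rule summable_on_dominated)
  show "(\<lambda>n. norm x / (1 - norm x) * norm q ^ n) summable_on UNIV"
    using assms by (intro summable_on_cmult_right summable_nonneg_imp_summable_on summable_geometric) auto
  fix n
  have "norm x * norm q ^ n \<le> norm x * 1" using assms by (intro mult_left_mono power_le_one) auto
  hence "1 - norm x \<le> norm (1 - x * q ^ n)"
    using norm_triangle_ineq2[of 1 "x * q ^ n"] by (simp add: norm_mult norm_power)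
  hence "norm x * norm q ^ n / norm (1 - x * q ^ n) \<le> norm x * norm q ^ n / (1 - norm x)"
    using assms by (intro divide_left_mono) (auto intro!: mult_pos_pos)
  thus "norm (x * q ^ n / (1 - x * q ^ n)) \<le> norm x / (1 - norm x) * norm q ^ n"
    by (simp add: norm_divide norm_mult norm_power)
qed

text \<open>Up to sign the logarithmic derivative x d/dx log theta(x; q). It is odd under x ->
  q/x.\<close>

definition eis :: "complex \<Rightarrow> complex \<Rightarrow> complex" where
  "eis x q = lambert x q - lambert (q / x) q"

text \<open>A bilateral sum of 1/(1 - a q^n) alone diverges, since its terms tend to 1 as n grows;
  only differences converge.\<close>

lemma eis_diff_has_sum:
  assumes q: "q \<noteq> 0" and a: "a \<in> annulus q" and c: "c \<in> annulus q"
  shows "((\<lambda>n. 1 / (1 - a * q powi n) - 1 / (1 - c * q powi n)) has_sum eis a q - eis c q) UNIV"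
proof -
  note A = annulusD[OF a q] and C = annulusD[OF c q]
  have "((\<lambda>n. 1 / (1 - a * q powi int n) - 1 / (1 - c * q powi int n)) has_sum (lambert a q - lambert c q)) UNIV"
  proof -
    have "1 / (1 - a * q powi int n) - 1 / (1 - c * q powi int n) = a * q ^ n / (1 - a * q ^ n) + - (c * q ^ n / (1 - c * q ^ n))" for n
      using annulus_nonzero[OF a q, of "int n"] annulus_nonzero[OF c q, of "int n"] by (simp add: divide_simps) (simp add: algebra_simps)
    thus ?thesis
      using has_sum_add[OF lambert_has_sum[OF A(1,3)] has_sum_uminusI[OF lambert_has_sum[OF C(1,3)]]] by simp
  qed
  moreover have "((\<lambda>j. 1 / (1 - a * q powi (- 1 - int j)) - 1 / (1 - c * q powi (- 1 - int j))) has_sum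
      (- lambert (q / a) q + lambert (q / c) q)) UNIV"
  proof -
    have "1 / (1 - x * q powi (- 1 - int j)) = - (q / x * q ^ j / (1 - q / x * q ^ j))" if "x \<in> annulus q" for x j
      using inverse_neg_index[of x q j] annulus_nonzero[OF that q, of "- 1 - int j"] annulusD[OF that q] q by simp
    thus ?thesis
      using has_sum_add[OF has_sum_uminusI[OF lambert_has_sum[OF A(2,3)]] lambert_has_sum[OF C(2,3)]] a c by simp
  qed
  ultimately have "((\<lambda>n. 1 / (1 - a * q powi n) - 1 / (1 - c * q powi n)) has_sum
      ((lambert a q - lambert c q) + (- lambert (q / a) q + lambert (q / c) q))) UNIV"
    by (rule has_sum_split[OF int_split, where f = "\<lambda>n. 1 / (1 - a * q powi n) - 1 / (1 - c * q powi n)"])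
  thus ?thesis by (simp add: eis_def algebra_simps)
qed

text \<open>Both products are sorted by the power y^N and their coefficients split into partial
  fractions. As a b = c d, the factor 1/(1 - a b q^N) is common and the constants -1 cancel; the sum
  over n that remains does not depend on N.\<close>

lemma kron_four_term:
  assumes q: "q \<noteq> 0"
    and mem: "a \<in> annulus q" "b \<in> annulus q" "c \<in> annulus q" "d \<in> annulus q" "y \<in> annulus q" "a * b \<in> annulus q"
    and abcd: "a * b = c * d"
  shows "kron a y q * kron b y q - kron c y q * kron d y q =
           kron (a * b) y q * (eis a q + eis b q - eis c q - eis d q)"
proof -
  have y0: "y \<noteq> 0" using annulusD[OF mem(5) q] by simp
  have nz: "1 - x * q powi n \<noteq> 0" if "x \<in> annulus q" for x n by (rule annulus_nonzero[OF that q])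
  have bij: "bij (\<lambda>(N, n). (n, N - n :: int))"
    by (rule bij_betw_byWitness[of _ "\<lambda>(n, m). (n + m, n)"]) auto
  have prod: "((\<lambda>(N, n). y powi N * (1 / ((1 - a * q powi n) * (1 - b * q powi (N - n))))) has_sum kron a y q * kron b y q) UNIV"
    if "a \<in> annulus q" "b \<in> annulus q" for a b
  proof -
    have "((\<lambda>p. case (case p of (N, n) \<Rightarrow> (n, N - n)) of (n, m) \<Rightarrow> y powi n / (1 - a *
        q powi n) * (y powi m / (1 - b * q powi m)))
        has_sum kron a y q * kron b y q) UNIV"
      using has_sum_reindex_bij[OF has_sum_mult[OF kron_has_sum[OF q that(1) mem(5)] kron_has_sum[OF q that(2)
          mem(5)], unfolded UNIV_Times_UNIV] bij] .
    moreover have "(\<lambda>p. case (case p of (N, n) \<Rightarrow> (n, N - n)) of (n, m) \<Rightarrow> y powi n /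
        (1 - a * q powi n) * (y powi m / (1 - b * q powi m)))
       = (\<lambda>(N, n). y powi N * (1 / ((1 - a * q powi n) * (1 - b * q powi (N - n)))))"
      using y0 by (auto simp: power_int_diff)
    ultimately show ?thesis by simp
  qed
  have pf: "1 / ((1 - u) * (1 - v)) = (1 / (1 - u) + 1 / (1 - v) - 1) / (1 - u * v)"
    if "1 - u \<noteq> 0" "1 - v \<noteq> 0" "1 - u * v \<noteq> 0" for u v :: complex
    using that by (simp add: divide_simps) (simp add: algebra_simps)
  have pf': "1 / ((1 - x * q powi n) * (1 - z * q powi (N - n))) =
      (1 / (1 - x * q powi n) + 1 / (1 - z * q powi (N - n)) - 1) / (1 - a * b * q powi N)"
    if "x \<in> annulus q" "z \<in> annulus q" "x * z = a * b" for x z N n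
  proof -
    have "x * q powi n * (z * q powi (N - n)) = (x * z) * q powi N"
      using q by (simp add: power_int_diff)
    thus ?thesis
      using pf[of "x * q powi n" "z * q powi (N - n)"] nz[OF that(1)] nz[OF that(2)] nz[OF mem(6)] that(3) by simp
  qed
  define s where "s = eis a q - eis c q + (eis b q - eis d q)"
  have "((\<lambda>(N, n). y powi N * (1 / ((1 - a * q powi n) * (1 - b * q powi (N - n))))
        + - (y powi N * (1 / ((1 - c * q powi n) * (1 - d * q powi (N - n)))))) has_sum
      kron a y q * kron b y q + - (kron c y q * kron d y q)) UNIV"
    using has_sum_add[OF prod[OF mem(1,2)] has_sum_uminusI[OF prod[OF mem(3,4)]]] by (simp add: case_prod_unfold)
  hence "((\<lambda>N. y powi N / (1 - a * b * q powi N) * s) has_sum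
      kron a y q * kron b y q + - (kron c y q * kron d y q)) UNIV"
    unfolding UNIV_Times_UNIV[symmetric]
  proof (rule has_sum_SigmaD)
    fix N :: int
    \<comment> \<open>The terms in b and d carry the index N - n. Reflecting it shows that their sum
      is the same for every N.\<close>
    have "bij (\<lambda>n. N - n)" by (rule bij_betw_byWitness[of _ "\<lambda>n. N - n"]) auto
    from has_sum_reindex_bij[OF eis_diff_has_sum[OF q mem(2,4)] this]
    have "((\<lambda>n. (1 / (1 - a * q powi n) - 1 / (1 - c * q powi n)) +
              (1 / (1 - b * q powi (N - n)) - 1 / (1 - d * q powi (N - n)))) has_sum s) UNIV"
      unfolding s_def by (intro has_sum_add eis_diff_has_sum q mem)
    from has_sum_cmult_right[OF this, of "y powi N / (1 - a * b * q powi N)"]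
    have *: "((\<lambda>n. y powi N / (1 - a * b * q powi N) * ((1 / (1 - a * q powi n) - 1 / (1 - c * q powi n)) +
              (1 / (1 - b * q powi (N - n)) - 1 / (1 - d * q powi (N - n))))) has_sum
            y powi N / (1 - a * b * q powi N) * s) UNIV" .
    show "((\<lambda>n. case (N, n) of (N, n) \<Rightarrow> y powi N * (1 / ((1 - a * q powi n) * (1 - b * q powi (N - n))))
        + - (y powi N * (1 / ((1 - c * q powi n) * (1 - d * q powi (N - n)))))) has_sum
            y powi N / (1 - a * b * q powi N) * s) UNIV"
      unfolding prod.case pf'[OF mem(1,2) refl] pf'[OF mem(3,4) abcd[symmetric]]
      by (rule has_sum_cong[THEN iffD1, OF _ *]) (simp add: diff_divide_distrib add_divide_distrib algebra_simps)
  qed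
  moreover have "((\<lambda>N. y powi N / (1 - a * b * q powi N) * s) has_sum kron (a * b) y q * s) UNIV"
    by (rule has_sum_cmult_left[OF kron_has_sum[OF q mem(6,5)]])
  ultimately have "kron a y q * kron b y q + - (kron c y q * kron d y q) = kron (a * b) y q * s"
    by (rule has_sum_unique)
  thus ?thesis by (simp add: s_def algebra_simps)
qed

subsection \<open>Dissection of theta functions\<close>

text \<open>The index is written as 11 i + k - 4. The shift by 4 makes the inner argument x^11
  q^(11(k+1)); at an eleventh root of unity x the components are thus theta(Q^(k+1); Q^11) with Q =
  q^11 and k + 1 = 1, ..., 11.\<close>

lemma theta_dissection:
  assumes q: "q \<noteq> 0" "norm q < 1" and x: "x \<noteq> 0"
  shows "theta x q = (\<Sum>k<11. (-1) ^ k * q powi tri (int k - 4) * x powi (int k - 4) * theta (x ^ 11 * q ^ (11 + 11 * k)) (q ^ 121))"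
proof -
  define h where "h = (\<lambda>(k, i). 11 * i + int k - 4)"
  have h: "bij_betw h ({..<11} \<times> UNIV) UNIV"
  proof (rule bij_betw_byWitness[of _ "\<lambda>n. (nat ((n + 4) mod 11), (n + 4) div 11)"])
    show "\<forall>p\<in>{..<11} \<times> UNIV. (nat ((h p + 4) mod 11), (h p + 4) div 11) = p"
      by (auto simp: h_def)
    show "\<forall>n\<in>UNIV. h (nat ((n + 4) mod 11), (n + 4) div 11) = n"
      by (auto simp: h_def; presburger)
    show "h ` ({..<11} \<times> UNIV) \<subseteq> UNIV" by simp
    have "nat (n mod 11) < 11" for n :: int by (simp add: nat_less_iff)
    thus "(\<lambda>n. (nat ((n + 4) mod 11), (n + 4) div 11)) ` UNIV \<subseteq> {..<11} \<times> UNIV" by auto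
  qed
  have "((\<lambda>p. theta_term x q (h p)) has_sum theta x q) ({..<11} \<times> UNIV)"
    using has_sum_reindex_bij_betw[OF h] theta_has_sum[OF q x] by blast
  hence "((\<lambda>k. (-1) ^ k * q powi tri (int k - 4) * x powi (int k - 4) * theta (x ^ 11 * q ^ (11 + 11 * k)) (q
      ^ 121)) has_sum theta x q) {..<11}"
  proof (rule has_sum_SigmaD)
    fix k :: nat
    have "((\<lambda>i. (-1) ^ k * q powi tri (int k - 4) * x powi (int k - 4) * theta_term (x ^ 11 * q ^ (11 + 11 * k)) (q ^ 121) i) has_sum
        (-1) ^ k * q powi tri (int k - 4) * x powi (int k - 4) * theta (x ^ 11 * q ^ (11 + 11 * k)) (q ^ 121)) UNIV"
      using q x power_less_one_iff[of "norm q" 121]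
      by (intro has_sum_cmult_right theta_has_sum) (auto simp: norm_power)
    moreover have "(-1) ^ k * q powi tri (int k - 4) * x powi (int k - 4) * theta_term (x ^ 11 * q ^ (11 + 11 * k)) (q ^ 121) i
      = theta_term x q (h (k, i))" for i
    proof -
      have tr: "tri (11 * i + (int k - 4)) = 121 * tri i + (11 + 11 * int k) * i + tri (int k - 4)"
        using two_tri[of "11 * i + (int k - 4)"] two_tri[of i] two_tri[of "int k - 4"] by (auto simp: algebra_simps)
      have hk: "h (k, i) = 11 * i + (int k - 4)" by (simp add: h_def)
      have s: "(-1 :: complex) powi (11 * i + (int k - 4)) = (-1) ^ k * (-1) powi i"
        by (auto simp: power_int_minus_left minus_one_power_iff)
      have "(x ^ 11) powi i = x powi (11 * i)" "(q ^ 121) powi tri i = q powi (121 * tri i)"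
           "(q ^ (11 + 11 * k)) powi i = q powi ((11 + 11 * int k) * i)"
        using power_int_mult[of x 11 i] power_int_mult[of q 121 "tri i"] power_int_mult[of q "int (11 + 11 * k)" i]
        by (simp_all add: power_int_of_nat del: of_nat_add) (simp add: algebra_simps)
      thus ?thesis
        unfolding hk theta_term_def tr s power_int_mult_distrib using q x by (simp add: power_int_add)
    qed
    ultimately show "((\<lambda>i. theta_term x q (h (k, i))) has_sum
        (-1) ^ k * q powi tri (int k - 4) * x powi (int k - 4) * theta (x ^ 11 * q ^ (11 + 11 * k)) (q ^ 121)) UNIV"
      by simp
  qed
  thus ?thesis by (simp add: has_sum_finite_iff)
qed

subsection \<open>The crank generating function weighted by the number of ones\<close>

text \<open>This is t d/dt of the q-binomial theorem sum A_n t^n = (at; p)/(t; p). Without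
  differentiating, the sums F of A_n s^n and T of n A_n s^n are followed along s = t p^N, where they
  tend to 1 and 0.\<close>

lemma q_binomial:
  fixes a p t :: complex and A :: "nat \<Rightarrow> complex"
  defines "A \<equiv> (\<lambda>n. \<Prod>k<n. (1 - a * p ^ k) / (1 - p * p ^ k))"
  assumes p: "norm p < 1" and t: "norm t < 1" and at: "norm (a * t) < 1"
  shows "((\<lambda>n. of_nat n * A n * t ^ n) has_sum
           qpoch_inf (a * t) p / qpoch_inf t p * (lambert t p - lambert (a * t) p)) UNIV"
proof -
  have nz: "1 - x * p ^ k \<noteq> 0" if "norm x < 1" for x k
    using norm_mult_power_less_1[OF that p, of k] by force
  have Qp: "qpoch_inf x p \<noteq> 0" if "norm x < 1" for x by (rule qpoch_nonzero'[OF p that])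
  have "A \<longlonglongrightarrow> qpoch_inf a p / qpoch_inf p p"
    unfolding A_def prod_dividef by (intro tendsto_divide qpoch_LIMSEQ p Qp)
  hence "Bseq A" by (intro convergent_imp_Bseq convergentI)
  then obtain B where B: "B > 0" "\<And>n. norm (A n) \<le> B" by (auto simp: Bseq_def)
  have ASuc: "A (Suc n) * (1 - p ^ Suc n) = A n * (1 - a * p ^ n)" for n
    using nz[OF p, of n] by (simp add: A_def)
  have S1: "(\<lambda>n. B * norm t ^ n) summable_on UNIV"
    using t B by (intro summable_nonneg_imp_summable_on summable_mult summable_geometric) auto
  have S2: "(\<lambda>n. B * (real (Suc n) * norm t ^ n)) summable_on UNIV"
    using t B sums_summable[OF geometric_deriv_sums[of "norm t"]]
    by (intro summable_nonneg_imp_summable_on summable_mult) auto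
  define F where "F = (\<lambda>s. infsum (\<lambda>n. A n * s ^ n) UNIV)"
  define T where "T = (\<lambda>s. infsum (\<lambda>n. of_nat n * A n * s ^ n) UNIV)"
  have b1: "norm (A n * s ^ n) \<le> B * norm t ^ n" if "norm s \<le> norm t" for s n
    unfolding norm_mult norm_power using that B by (intro mult_mono power_mono) auto
  have b2: "norm (of_nat n * A n * s ^ n) \<le> B * (real (Suc n) * norm t ^ n)" if "norm s \<le> norm t" for s n
  proof -
    have "real n * norm (A n * s ^ n) \<le> real (Suc n) * (B * norm t ^ n)"
      using b1[OF that, of n] by (intro mult_mono) auto
    thus ?thesis by (simp add: norm_mult mult_ac)
  qed
  have F: "((\<lambda>n. A n * s ^ n) has_sum F s) UNIV" if "norm s \<le> norm t" for s
    unfolding F_def by (rule has_sum_infsum, rule summable_on_dominated[OF S1], rule b1[OF that])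
  have T: "((\<lambda>n. of_nat n * A n * s ^ n) has_sum T s) UNIV" if "norm s \<le> norm t" for s
    unfolding T_def by (rule has_sum_infsum, rule summable_on_dominated[OF S2], rule b2[OF that])
  have ps: "norm (p * s) \<le> norm t" if "norm s \<le> norm t" for s
    using that p mult_mono[of "norm p" 1 "norm s" "norm t"] by (simp add: norm_mult)
  have stepF: "(1 - s) * F s = (1 - a * s) * F (p * s)" if s: "norm s \<le> norm t" for s
  proof -
    have "(\<lambda>n. A n * s ^ n + - (A n * (p * s) ^ n)) sums (F s + - F (p * s))"
      by (intro has_sum_imp_sums has_sum_add has_sum_uminusI F s ps)
    hence "(\<lambda>n. A (Suc n) * s ^ Suc n + - (A (Suc n) * (p * s) ^ Suc n)) sums (F s + - F (p * s))"
      by (subst sums_Suc_iff) simp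
    moreover have "A (Suc n) * s ^ Suc n + - (A (Suc n) * (p * s) ^ Suc n) = s * (A n * s ^ n) + (- a * s) * (A n * (p * s) ^ n)" for n
    proof -
      have "A (Suc n) * s ^ Suc n + - (A (Suc n) * (p * s) ^ Suc n) = (A (Suc n) * (1 - p ^ Suc n)) * s ^ Suc n"
        unfolding power_mult_distrib by (simp add: algebra_simps del: power_Suc)
      also have "\<dots> = s * (A n * s ^ n) + (- a * s) * (A n * (p * s) ^ n)"
        unfolding ASuc power_mult_distrib by (simp add: algebra_simps)
      finally show ?thesis .
    qed
    ultimately have "(\<lambda>n. s * (A n * s ^ n) + (- a * s) * (A n * (p * s) ^ n)) sums (F s + - F (p * s))" by simp
    moreover have "(\<lambda>n. s * (A n * s ^ n) + (- a * s) * (A n * (p * s) ^ n)) sums (s * F s + (- a * s) * F (p * s))"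
      by (intro has_sum_imp_sums has_sum_add has_sum_cmult_right F s ps)
    ultimately have "F s + - F (p * s) = s * F s + (- a * s) * F (p * s)" by (rule sums_unique2)
    thus ?thesis by algebra
  qed
  \<comment> \<open>The derivative s d/ds of \<open>stepF\<close>, obtained coefficientwise from the
    same recurrence.\<close>
  have stepT: "(1 - s) * T s = (1 - a * s) * T (p * s) + s * F s - a * s * F (p * s)" if s: "norm s \<le> norm t" for s
  proof -
    have "(\<lambda>n. of_nat n * A n * s ^ n + - (of_nat n * A n * (p * s) ^ n)) sums (T s + - T (p * s))"
      by (intro has_sum_imp_sums has_sum_add has_sum_uminusI T s ps)
    hence "(\<lambda>n. of_nat (Suc n) * A (Suc n) * s ^ Suc n + - (of_nat (Suc n) * A (Suc n) * (p * s) ^ Suc n)) sums (T s + - T (p * s))"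
      by (subst sums_Suc_iff) simp
    moreover have "of_nat (Suc n) * A (Suc n) * s ^ Suc n + - (of_nat (Suc n) * A (Suc n) * (p * s) ^ Suc n) =
        s * (of_nat n * A n * s ^ n + A n * s ^ n) + (- a * s) * (of_nat n * A n * (p * s) ^ n + A n * (p * s) ^ n)" for n
    proof -
      have "of_nat (Suc n) * A (Suc n) * s ^ Suc n + - (of_nat (Suc n) * A (Suc n) * (p * s) ^ Suc n) =
          of_nat (Suc n) * (A (Suc n) * (1 - p ^ Suc n)) * s ^ Suc n"
        unfolding power_mult_distrib by (simp add: algebra_simps del: power_Suc)
      also have "\<dots> = s * (of_nat n * A n * s ^ n + A n * s ^ n) + (- a * s) * (of_nat n * A n * (p * s) ^ n + A n * (p * s) ^ n)"
        unfolding ASuc power_mult_distrib by (simp add: algebra_simps)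
      finally show ?thesis .
    qed
    ultimately have "(\<lambda>n. s * (of_nat n * A n * s ^ n + A n * s ^ n) + (- a * s) * (of_nat n * A n * (p * s) ^ n + A n * (p * s) ^ n))
       sums (T s + - T (p * s))" by simp
    moreover have "(\<lambda>n. s * (of_nat n * A n * s ^ n + A n * s ^ n) + (- a * s) * (of_nat n * A n * (p * s) ^ n + A n * (p * s) ^ n))
       sums (s * (T s + F s) + (- a * s) * (T (p * s) + F (p * s)))"
      by (intro has_sum_imp_sums has_sum_add has_sum_cmult_right F T s ps)
    ultimately have "T s + - T (p * s) = s * (T s + F s) + (- a * s) * (T (p * s) + F (p * s))" by (rule sums_unique2)
    thus ?thesis by algebra
  qed
  define P where "P = (\<lambda>N. \<Prod>k<N. (1 - a * t * p ^ k) / (1 - t * p ^ k))"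
  have tpN: "norm (t * p ^ N) \<le> norm t" for N
    using p by (simp add: norm_mult norm_power mult_left_le power_le_one)
  have iterF: "F t = P N * F (t * p ^ N)" for N
  proof (induction N)
    case (Suc N)
    have "F (t * p ^ N) = (1 - a * (t * p ^ N)) / (1 - t * p ^ N) * F (p * (t * p ^ N))"
      using stepF[OF tpN[of N]] nz[OF t, of N] by (simp add: field_simps)
    thus ?case using Suc by (simp add: P_def mult_ac)
  qed (simp add: P_def)
  \<comment> \<open>Each step adds the logarithmic derivative of one factor of \<open>P\<close>, so
    that both Lambert series build up term by term.\<close>
  have iterT: "T t = P N * T (t * p ^ N) + F t * (\<Sum>k<N. t * p ^ k / (1 - t * p ^ k) + - (a * t * p ^ k / (1 - a * t * p ^ k)))" for N
  proof (induction N)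
    case (Suc N)
    define s where "s = t * p ^ N"
    have n1: "1 - s \<noteq> 0" and n2: "1 - a * s \<noteq> 0"
      using nz[OF t, of N] nz[OF at, of N] by (simp_all add: s_def mult.assoc)
    have ns: "norm s \<le> norm t" unfolding s_def by (rule tpN)
    have "F (p * s) = (1 - s) / (1 - a * s) * F s"
      using stepF[OF ns] n2 by (simp add: field_simps)
    with stepT[OF ns] have "(1 - s) * T s = (1 - a * s) * T (p * s) + s * F s - a * s * ((1 - s) / (1 - a * s) * F s)"
      by simp
    hence "T s = ((1 - a * s) * T (p * s) + s * F s - a * s * ((1 - s) / (1 - a * s) * F s)) / (1 - s)"
      using n1 by (metis nonzero_mult_div_cancel_left)
    moreover have "(e * x + s * y - c * (d / e * y)) / d = e / d * x + y * (s / d + - (c / e))"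
      if "d \<noteq> 0" for c d e x y :: complex
      using that by (simp add: divide_inverse algebra_simps)
    ultimately have "T s = (1 - a * s) / (1 - s) * T (p * s) + F s * (s / (1 - s) + - (a * s / (1 - a * s)))"
      using n1 by simp
    from arg_cong[OF this, of "\<lambda>x. P N * x"]
    have h1: "P N * T s = P N * ((1 - a * s) / (1 - s)) * T (p * s) + P N * F s * (s / (1 - s) + - (a * s / (1 - a * s)))"
      by (simp only: distrib_left mult.assoc)
    have h2: "P N * F s = F t" using iterF[of N] by (simp add: s_def)
    have h3: "P N * ((1 - a * s) / (1 - s)) = P (Suc N)" "p * s = t * p ^ Suc N" "a * s = a * t * p ^ N"
      by (simp_all add: P_def s_def mult_ac)
    have "P N * T s = P (Suc N) * T (t * p ^ Suc N) + F t * (s / (1 - s) + - (a * t * p ^ N / (1 - a * t * p ^ N)))"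
      by (rule h1[unfolded h2 h3(1), unfolded h3(2,3)])
    thus ?case
      using Suc unfolding s_def sum.lessThan_Suc by (simp only: distrib_left add.assoc add.commute add.left_commute)
  qed (simp add: P_def)
  have limP: "P \<longlonglongrightarrow> qpoch_inf (a * t) p / qpoch_inf t p"
    unfolding P_def prod_dividef by (intro tendsto_divide qpoch_LIMSEQ p Qp t)
  have tp0: "(\<lambda>N. t * p ^ N) \<longlonglongrightarrow> 0"
    using tendsto_mult_left[OF LIMSEQ_power_zero[OF p], of t] by simp
  have limF: "(\<lambda>N. F (t * p ^ N)) \<longlonglongrightarrow> 1"
  proof -
    have "(\<lambda>N. F (t * p ^ N)) \<longlonglongrightarrow> infsum (\<lambda>n. A n * 0 ^ n) UNIV"
      unfolding F_def
      by (rule infsum_dominated_tendsto[OF _ _ S1]) (auto intro!: tendsto_intros tp0 always_eventually b1 tpN)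
    moreover have "infsum (\<lambda>n. A n * 0 ^ n) UNIV = 1"
      by (rule infsumI, rule has_sum_finite_neutralI[of "{0}"]) (auto simp: A_def)
    ultimately show ?thesis by simp
  qed
  have limT: "(\<lambda>N. T (t * p ^ N)) \<longlonglongrightarrow> 0"
  proof -
    have "(\<lambda>N. T (t * p ^ N)) \<longlonglongrightarrow> infsum (\<lambda>n. of_nat n * A n * 0 ^ n) UNIV"
      unfolding T_def
      by (rule infsum_dominated_tendsto[OF _ _ S2], intro tendsto_intros tp0, intro always_eventually allI ballI b2 tpN)
    moreover have "infsum (\<lambda>n. of_nat n * A n * 0 ^ n) UNIV = 0"
      by (rule infsumI, rule has_sum_finite_neutralI[of "{}"]) auto
    ultimately show ?thesis by simp
  qed
  have "(\<lambda>N. P N * F (t * p ^ N)) \<longlonglongrightarrow> qpoch_inf (a * t) p / qpoch_inf t p * 1"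
    by (intro tendsto_mult limP limF)
  hence Ft: "F t = qpoch_inf (a * t) p / qpoch_inf t p"
    unfolding iterF[symmetric] by (simp add: LIMSEQ_const_iff)
  have "(\<lambda>k. t * p ^ k / (1 - t * p ^ k) + - (a * t * p ^ k / (1 - a * t * p ^ k))) sums (lambert t p + - lambert (a * t) p)"
    by (intro has_sum_imp_sums has_sum_add has_sum_uminusI lambert_has_sum t at p)
  hence "(\<lambda>N. P N * T (t * p ^ N) + F t * (\<Sum>k<N. t * p ^ k / (1 - t * p ^ k) + - (a * t * p ^ k / (1 - a * t * p ^ k))))
     \<longlonglongrightarrow> qpoch_inf (a * t) p / qpoch_inf t p * 0 + F t * (lambert t p + - lambert (a * t) p)"
    unfolding sums_def by (intro tendsto_intros limP limT)
  hence "T t = F t * (lambert t p - lambert (a * t) p)"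
    unfolding iterT[symmetric] by (simp add: LIMSEQ_const_iff)
  thus ?thesis using T[of t] Ft by simp
qed

section \<open>Generating functions over multisets of parts\<close>

lemma multiset_gf_finite:
  fixes w :: "'a \<Rightarrow> complex"
  assumes "finite A" "\<And>k. k \<in> A \<Longrightarrow> norm (w k) < 1"
  shows "((\<lambda>s. \<Prod>k\<in>#s. w k) has_sum (\<Prod>k\<in>A. 1 / (1 - w k))) {s. set_mset s \<subseteq> A}"
  using assms
proof (induction A)
  case empty
  show ?case by (rule has_sum_finiteI) auto
next
  case (insert a A)
  have IH: "((\<lambda>s. \<Prod>k\<in>#s. w k) has_sum (\<Prod>k\<in>A. 1 / (1 - w k))) {s. set_mset s \<subseteq> A}"
    using insert by auto
  have "((\<lambda>n. w a ^ n) has_sum 1 / (1 - w a)) UNIV"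
    using insert.prems[of a] by (auto intro!: norm_summable_imp_has_sum geometric_sums simp: norm_power)
  from has_sum_mult[OF this IH]
  have 1: "((\<lambda>(n, s). w a ^ n * (\<Prod>k\<in>#s. w k)) has_sum 1 / (1 - w a) * (\<Prod>k\<in>A. 1 / (1 - w
      k))) (UNIV \<times> {s. set_mset s \<subseteq> A})" .
  have bij: "bij_betw (\<lambda>(n, s). replicate_mset n a + s) (UNIV \<times> {s. set_mset s \<subseteq> A}) {s. set_mset s \<subseteq> insert a A}"
  proof (rule bij_betw_byWitness[of _ "\<lambda>s. (count s a, filter_mset (\<lambda>x. x \<noteq> a) s)"])
    have "a \<notin># s" if "set_mset s \<subseteq> A" for s using insert that by auto
    thus "\<forall>p\<in>UNIV \<times> {s. set_mset s \<subseteq> A}. (count (case p of (n, s) \<Rightarrow> replicate_mset n a + s) a,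
        filter_mset (\<lambda>x. x \<noteq> a) (case p of (n, s) \<Rightarrow> replicate_mset n a + s)) = p"
      by (auto simp: count_eq_zero_iff multiset_eq_iff)
    show "\<forall>s\<in>{s. set_mset s \<subseteq> insert a A}.
        (case (count s a, filter_mset (\<lambda>x. x \<noteq> a) s) of (n, s) \<Rightarrow> replicate_mset n a + s) = s"
      by (auto simp: multiset_eq_iff)
  qed (auto split: if_splits)
  have "((\<lambda>p. case p of (n, s) \<Rightarrow> (\<Prod>k\<in>#replicate_mset n a + s. w k)) has_sum 1 / (1 - w
      a) * (\<Prod>k\<in>A. 1 / (1 - w k))) (UNIV \<times> {s. set_mset s \<subseteq> A})"
    using 1 by simp
  hence "((\<lambda>s. \<Prod>k\<in>#s. w k) has_sum 1 / (1 - w a) * (\<Prod>k\<in>A. 1 / (1 - w k))) {s. set_mset s \<subseteq> insert a A}"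
    using has_sum_reindex_bij_betw[OF bij, of "\<lambda>s. \<Prod>k\<in>#s. w k"] by (simp add: case_prod_unfold)
  thus ?case using insert by simp
qed

text \<open>What is left of a partition when its ones are removed.\<close>

definition big_parts :: "nat multiset set" where "big_parts = {s. \<forall>k\<in>#s. 2 \<le> k}"

text \<open>The parts are exhausted by 2, ..., n + 1. The bound r^k on the weights makes all finite
  sums of norms at most a convergent product of 1/(1 - r^k), which gives summability; dominated
  convergence then identifies the value with the limit V.\<close>

lemma multiset_gf_big_parts:
  fixes w :: "nat \<Rightarrow> complex"
  assumes r: "0 \<le> r" "r < 1" and w: "\<And>k. norm (w k) \<le> r ^ k"
    and lim: "(\<lambda>n. \<Prod>i<n. 1 / (1 - w (i + 2))) \<longlonglongrightarrow> V"
  shows "((\<lambda>s. \<Prod>k\<in>#s. w k) has_sum V) big_parts"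
    and "(\<lambda>s. norm (\<Prod>k\<in>#s. w k)) summable_on big_parts"
proof -
  define A where "A = (\<lambda>n. {s. set_mset s \<subseteq> {2..<n+2::nat}})"
  have r2: "r ^ (i + 2) < 1" for i using r by (simp add: power_less_one_iff del: power_Suc)
  have w1: "norm (w (i + 2)) < 1" for i using w[of "i + 2"] r2[of i] by linarith
  have shift: "(\<Prod>k\<in>{2..<n+2}. f k) = (\<Prod>i<n. f (i + 2))" for n and f :: "nat \<Rightarrow> 'b :: comm_monoid_mult"
    using prod.shift_bounds_nat_ivl[of f 0 2 n] by (simp only: lessThan_atLeast0 add_0)
  have fin: "((\<lambda>s. \<Prod>k\<in>#s. v k) has_sum (\<Prod>i<n. 1 / (1 - v (i + 2)))) (A n)"
    if "\<And>i. norm (v (i + 2)) < 1" for v :: "nat \<Rightarrow> complex" and n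
  proof -
    have "norm (v k) < 1" if "k \<in> {2..<n+2}" for k
      using \<open>\<And>i. norm (v (i + 2)) < 1\<close>[of "k - 2"] that by (metis atLeastLessThan_iff le_add_diff_inverse2)
    moreover have "(\<Prod>i<n. 1 / (1 - v (i + 2))) = (\<Prod>k\<in>{2..<n+2}. 1 / (1 - v k))"
      by (rule shift[symmetric])
    ultimately show ?thesis unfolding A_def by (simp only:) (intro multiset_gf_finite, auto)
  qed
  have np: "complex_of_real (norm (\<Prod>k\<in>#s. w k)) = (\<Prod>k\<in>#s. complex_of_real (norm (w k)))" for s
    by (induction s) (auto simp: norm_mult)
  have A_mono: "A m \<subseteq> A l" if "m \<le> l" for m l
  proof -
    have "{2..<m+2} \<subseteq> {2..<l+2}" using that by auto
    thus ?thesis unfolding A_def by blast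
  qed
  have cov: "\<exists>n. X \<subseteq> A n" if "finite X" "X \<subseteq> big_parts" for X
    using that
  proof (induction X)
    case (insert s X)
    then obtain n where n: "X \<subseteq> A n" by auto
    have "k < Max (insert 0 (set_mset s)) + 2" if "k \<in># s" for k
    proof -
      have "k \<le> Max (insert 0 (set_mset s))" using that by (intro Max_ge) auto
      thus ?thesis by simp
    qed
    hence "s \<in> A (Max (insert 0 (set_mset s)))" using insert by (auto simp: A_def big_parts_def)
    moreover have "A m \<subseteq> A (max m l)" "A l \<subseteq> A (max m l)" for m l
      by (simp_all add: A_mono)
    ultimately show ?case using n by blast
  qed auto
  obtain B where B: "\<And>n. (\<Prod>i<n. 1 / (1 - r ^ (i + 2))) \<le> B"
  proof -
    have nr: "norm (complex_of_real r) < 1" using r by simp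
    have "(\<lambda>n. 1 / (\<Prod>i<n. 1 - complex_of_real r ^ 2 * complex_of_real r ^ i)) \<longlonglongrightarrow>
        1 / qpoch_inf (complex_of_real r ^ 2) (of_real r)"
      using r by (intro tendsto_intros qpoch_LIMSEQ nr qpoch_nonzero') (auto simp: norm_power power_less_one_iff)
    hence "Bseq (\<lambda>n. 1 / (\<Prod>i<n. 1 - complex_of_real r ^ 2 * complex_of_real r ^ i))"
      by (intro convergent_imp_Bseq convergentI)
    then obtain B where B: "\<And>n. norm (1 / (\<Prod>i<n. 1 - complex_of_real r ^ 2 * complex_of_real r ^ i)) \<le> B"
      by (auto simp: Bseq_def)
    have "(\<Prod>i<n. 1 / (1 - r ^ (i + 2))) \<le> B" for n
    proof -
      have "1 / (\<Prod>i<n. 1 - complex_of_real r ^ 2 * complex_of_real r ^ i) = of_real (\<Prod>i<n. 1 / (1 - r ^ (i + 2)))"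
        by (simp add: prod_dividef power2_eq_square mult_ac)
      hence "norm (complex_of_real (\<Prod>i<n. 1 / (1 - r ^ (i + 2)))) \<le> B" using B[of n] by metis
      thus ?thesis by (simp only: norm_of_real)
    qed
    thus ?thesis using that by blast
  qed
  show summ: "(\<lambda>s. norm (\<Prod>k\<in>#s. w k)) summable_on big_parts"
  proof (rule nonneg_bdd_above_summable_on)
    show "bdd_above (sum (\<lambda>s. norm (\<Prod>k\<in>#s. w k)) ` {F. F \<subseteq> big_parts \<and> finite F})"
    proof (rule bdd_aboveI2)
      fix X assume X: "X \<in> {F. F \<subseteq> big_parts \<and> finite F}"
      then obtain n where n: "X \<subseteq> A n" using cov by blast
      have "((\<lambda>s. complex_of_real (norm (\<Prod>k\<in>#s. w k))) has_sum of_real (\<Prod>i<n. 1 / (1 - norm (w (i + 2))))) (A n)"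
        using fin[of "\<lambda>k. of_real (norm (w k))" n] w1 unfolding np by simp
      hence "((\<lambda>s. norm (\<Prod>k\<in>#s. w k)) has_sum (\<Prod>i<n. 1 / (1 - norm (w (i + 2))))) (A n)"
        by (subst (asm) has_sum_of_real_iff)
      hence "(\<Sum>s\<in>X. norm (\<Prod>k\<in>#s. w k)) \<le> (\<Prod>i<n. 1 / (1 - norm (w (i + 2))))"
        by (rule finite_sum_le_has_sum) (use X n in auto)
      also have "\<dots> \<le> (\<Prod>i<n. 1 / (1 - r ^ (i + 2)))"
      proof (rule prod_mono, intro conjI)
        fix i
        show "0 \<le> 1 / (1 - norm (w (i + 2)))" using w1[of i] by simp
        show "1 / (1 - norm (w (i + 2))) \<le> 1 / (1 - r ^ (i + 2))"
          using w[of "i + 2"] r2[of i] by (intro divide_left_mono) auto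
      qed
      also have "\<dots> \<le> B" by (rule B)
      finally show "(\<Sum>s\<in>X. norm (\<Prod>k\<in>#s. w k)) \<le> B" .
    qed
  qed auto
  have "(\<lambda>n. infsum (\<lambda>s. if s \<in> A n then \<Prod>k\<in>#s. w k else 0) big_parts)
      \<longlonglongrightarrow> infsum (\<lambda>s. \<Prod>k\<in>#s. w k) big_parts"
  proof (rule infsum_dominated_tendsto[OF _ _ summ])
    fix s assume "s \<in> big_parts"
    then obtain n where n: "s \<in> A n" using cov[of "{s}"] by auto
    have "eventually (\<lambda>m. (\<Prod>k\<in>#s. w k) = (if s \<in> A m then \<Prod>k\<in>#s. w k else 0)) sequentially"
      using eventually_ge_at_top[of n] by eventually_elim (use n A_mono in auto)
    thus "(\<lambda>n. if s \<in> A n then \<Prod>k\<in>#s. w k else 0) \<longlonglongrightarrow> (\<Prod>k\<in>#s. w k)"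
      by (rule Lim_transform_eventually[OF tendsto_const])
  qed auto
  moreover have "infsum (\<lambda>s. if s \<in> A n then \<Prod>k\<in>#s. w k else 0) big_parts = (\<Prod>i<n. 1 / (1 - w (i + 2)))" for n
  proof -
    have "infsum (\<lambda>s. if s \<in> A n then \<Prod>k\<in>#s. w k else 0) big_parts = infsum (\<lambda>s. \<Prod>k\<in>#s. w k) (A n)"
      by (rule infsum_cong_neutral) (auto simp: A_def big_parts_def)
    thus ?thesis using fin[of w n] w1 infsumI by metis
  qed
  ultimately have "infsum (\<lambda>s. \<Prod>k\<in>#s. w k) big_parts = V"
    using lim LIMSEQ_unique by force
  thus "((\<lambda>s. \<Prod>k\<in>#s. w k) has_sum V) big_parts"
    using abs_summable_summable[OF summ] by (metis has_sum_infsum)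
qed

text \<open>The classical product for the crank. It is symmetric under z -> 1/z.\<close>

definition crank_prod :: "complex \<Rightarrow> complex \<Rightarrow> complex" where
  "crank_prod z p = qpoch_inf p p / (qpoch_inf (z * p) p * qpoch_inf (p / z) p)"

text \<open>A partition consists of j ones and a multiset \<open>s\<close> from
  \<open>big_parts\<close>. For j \<ge> 1 its crank counts the parts above j and subtracts j, so a
  part k of \<open>s\<close> has weight z p^k if k > j and p^k otherwise, and the ones contribute
  (p/z)^j. The sum over \<open>s\<close> is an infinite product, the sum over j is
  \<open>q_binomial\<close> with a = z p and t = p/z; partitions without ones have weight 0.\<close>

lemma weighted_crank_has_sum:
  assumes p: "p \<noteq> 0" "norm p < 1" and z: "norm z = 1"
  shows "((\<lambda>s. of_nat (num_ones s) * z powi crank s * p ^ sum_mset s) has_sum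
            crank_prod z p * (lambert (p / z) p - lambert (p * p) p)) {s. 0 \<notin># s}"
proof -
  have z0: "z \<noteq> 0" using z by auto
  define w where "w = (\<lambda>j k. (if j < k then z else 1) * p ^ k)"
  define A where "A = (\<lambda>n. \<Prod>k<n. (1 - z * p * p ^ k) / (1 - p * p ^ k))"
  \<comment> \<open>For j \<ge> 1 this is the product of 1/(1 - p^k) over 2 \<le> k \<le> j and of
    1/(1 - z p^k) over k > j, completed to the factors that \<open>q_binomial\<close>
    expects.\<close>
  define V where "V = (\<lambda>j. (1 - p) / qpoch_inf (z * p) p * A j)"
  define c where "c = (\<lambda>j. of_nat j * (p / z) ^ j)"
  define f where "f = (\<lambda>(j, s). c j * (\<Prod>k\<in>#s. w j k))"
  have norms: "norm (z * p) < 1" "norm (p / z) < 1"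
    using p z by (simp_all add: norm_mult norm_divide)
  have nz: "1 - x * p ^ k \<noteq> 0" if "norm x < 1" for x k
    using norm_mult_power_less_1[OF that p(2), of k] by force
  have w: "norm (w j k) = norm p ^ k" for j k using z by (simp add: w_def norm_mult norm_power)
  have limV: "(\<lambda>n. \<Prod>i<n. 1 / (1 - w j (i + 2))) \<longlonglongrightarrow> V j" if j: "j \<ge> 1" for j
  proof -
    have *: "(\<Prod>k<N. 1 - w j (k + 1)) * (\<Prod>k<j. 1 - z * p * p ^ k) = (\<Prod>k<j. 1 - p * p ^ k) * (\<Prod>k<N. 1 - z * p * p ^ k)"
      if "N \<ge> j" for N
      using that
    proof (induction N rule: dec_induct)
      case base
      have "(\<Prod>k<j. 1 - w j (k + 1)) = (\<Prod>k<j. 1 - p * p ^ k)"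
        by (rule prod.cong) (auto simp: w_def)
      thus ?case by simp
    next
      case (step n)
      have "1 - w j (n + 1) = 1 - z * p * p ^ n" using step by (simp add: w_def mult.assoc)
      thus ?case using step by (simp add: mult_ac)
    qed
    have "(\<Prod>i<n. 1 / (1 - w j (i + 2))) = (1 - p) * A j / (\<Prod>k<Suc n. 1 - z * p * p ^ k)" if "n \<ge> j" for n
    proof -
      have "(\<Prod>k<Suc n. 1 - w j (k + 1)) = (1 - w j 1) * (\<Prod>i<n. 1 - w j (i + 2))"
        by (subst prod.lessThan_Suc_shift) simp
      moreover have "w j 1 = p" using j by (simp add: w_def)
      ultimately have e: "(1 - p) * (\<Prod>i<n. 1 - w j (i + 2)) * (\<Prod>k<j. 1 - z * p * p ^ k) =
          (\<Prod>k<j. 1 - p * p ^ k) * (\<Prod>k<Suc n. 1 - z * p * p ^ k)"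
        using *[of "Suc n"] that by simp
      have n1: "(\<Prod>k<j. 1 - p * p ^ k) \<noteq> 0" "(\<Prod>k<Suc n. 1 - z * p * p ^ k) \<noteq> 0"
        using nz[OF norms(1)] nz[OF p(2)] by (auto simp del: prod.lessThan_Suc)
      with e have n2: "(\<Prod>i<n. 1 - w j (i + 2)) \<noteq> 0" by (metis mult_eq_0_iff)
      have "1 / (\<Prod>i<n. 1 - w j (i + 2)) = (1 - p) * ((\<Prod>k<j. 1 - z * p * p ^ k) / (\<Prod>k<j. 1 - p * p ^
          k)) / (\<Prod>k<Suc n. 1 - z * p * p ^ k)"
      proof -
        have "1 / X = P * (Y / W) / Z" if "P * X * Y = W * Z" "X \<noteq> 0" "W \<noteq> 0" "Z \<noteq> 0" for P X Y W Z :: complex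
          using that by (simp add: divide_simps mult_ac)
        from this[OF e n2 n1] show ?thesis .
      qed
      thus ?thesis by (simp only: A_def prod_dividef prod.neutral_const)
    qed
    hence "eventually (\<lambda>n. (1 - p) * A j / (\<Prod>k<Suc n. 1 - z * p * p ^ k) = (\<Prod>i<n. 1 / (1 - w j (i + 2)))) sequentially"
      by (intro eventually_sequentiallyI[of j]) simp
    moreover have "(\<lambda>n. (1 - p) * A j / (\<Prod>k<Suc n. 1 - z * p * p ^ k)) \<longlonglongrightarrow> (1 - p) * A j / qpoch_inf (z * p) p"
      by (intro tendsto_intros LIMSEQ_Suc[OF qpoch_LIMSEQ] p qpoch_nonzero' norms)
    ultimately have "(\<lambda>n. \<Prod>i<n. 1 / (1 - w j (i + 2))) \<longlonglongrightarrow> (1 - p) * A j / qpoch_inf (z * p) p"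
      by (rule Lim_transform_eventually[rotated])
    thus ?thesis by (simp add: V_def)
  qed
  have inner: "((\<lambda>s. f (j, s)) has_sum c j * V j) big_parts" for j
  proof (cases "j = 0")
    case False
    hence "((\<lambda>s. \<Prod>k\<in>#s. w j k) has_sum V j) big_parts"
      by (intro multiset_gf_big_parts(1)[of "norm p"] limV) (use p w in auto)
    thus ?thesis unfolding f_def prod.case by (rule has_sum_cmult_right)
  qed (simp add: f_def c_def)
  have cV: "((\<lambda>j. c j * V j) has_sum crank_prod z p * (lambert (p / z) p - lambert (p * p) p)) UNIV"
  proof -
    have at: "z * p * (p / z) = p * p" using z0 by simp
    have pp: "norm (p * p) < 1" using p mult_strict_mono[of "norm p" 1 "norm p" 1] by (simp add: norm_mult)
    have "((\<lambda>n. of_nat n * A n * (p / z) ^ n) has_sum qpoch_inf (p * p) p / qpoch_inf (p / z) p * (lambert (p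
        / z) p - lambert (p * p) p)) UNIV"
      using q_binomial[of p "p / z" "z * p"] p norms pp unfolding at A_def by blast
    from has_sum_cmult_right[OF this, of "(1 - p) / qpoch_inf (z * p) p"]
    show ?thesis
      using qpoch_split[OF p(2), of p 1] by (simp add: c_def V_def crank_prod_def mult_ac)
  qed
  \<comment> \<open>Because |z| = 1, the norm of the weight of \<open>s\<close> does not depend on
    j, and the double family is dominated by a product of two summable ones.\<close>
  have summ: "f summable_on UNIV \<times> big_parts"
  proof -
    have "summable (\<lambda>n. norm (of_nat n * (p / z) ^ n))"
    proof (rule summable_comparison_test')
      show "summable (\<lambda>n. of_nat (Suc n) * norm p ^ n)"
        using geometric_deriv_sums[of "norm p"] p by (auto simp: sums_iff)
      show "norm (norm (of_nat n * (p / z) ^ n)) \<le> of_nat (Suc n) * norm p ^ n" for n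
        using z by (simp add: norm_mult norm_power norm_divide mult_right_mono)
    qed
    hence "c summable_on UNIV" unfolding c_def by (rule norm_summable_imp_summable_on)
    moreover have "(\<lambda>s. \<Prod>k\<in>#s. w 1 k) summable_on big_parts"
      using multiset_gf_big_parts(1)[of "norm p" "w 1", OF _ _ _ limV[of 1]] p w has_sum_imp_summable by fastforce
    ultimately have "(\<lambda>(j, s). c j * (\<Prod>k\<in>#s. w 1 k)) summable_on UNIV \<times> big_parts"
      using has_sum_imp_summable[OF has_sum_mult[OF has_sum_infsum has_sum_infsum]] by blast
    hence h: "(\<lambda>x. norm (case x of (j, s) \<Rightarrow> c j * (\<Prod>k\<in>#s. w 1 k))) summable_on UNIV \<times> big_parts"
      by (simp add: summable_on_iff_abs_summable_on_complex)
    have np: "norm (\<Prod>k\<in>#s. w j k) = norm p ^ sum_mset s" for j s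
      by (induction s) (auto simp: norm_mult w power_add)
    show ?thesis
      by (rule summable_on_dominated[OF h]) (auto simp: f_def norm_mult np)
  qed
  have sum_f: "(f has_sum crank_prod z p * (lambert (p / z) p - lambert (p * p) p)) (UNIV \<times> big_parts)"
    by (rule has_sum_SigmaI[OF inner cV summ])
  define h where "h = (\<lambda>(j, s). replicate_mset j (1::nat) + s)"
  have one: "(1::nat) \<notin># s" "(0::nat) \<notin># s" if "s \<in> big_parts" for s
    using that by (auto simp: big_parts_def)
  have bij: "bij_betw h (UNIV \<times> big_parts) {s. 0 \<notin># s}"
  proof (rule bij_betw_byWitness[of _ "\<lambda>s. (count s 1, filter_mset (\<lambda>k. k \<noteq> 1) s)"])
    show "\<forall>x\<in>UNIV \<times> big_parts. (count (h x) 1, filter_mset (\<lambda>k. k \<noteq> 1) (h x)) = x"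
      using one by (auto simp: h_def count_eq_zero_iff multiset_eq_iff)
    show "\<forall>s\<in>{s. 0 \<notin># s}. h (count s 1, filter_mset (\<lambda>k. k \<noteq> 1) s) = s"
      by (auto simp: h_def multiset_eq_iff)
    show "h ` (UNIV \<times> big_parts) \<subseteq> {s. 0 \<notin># s}"
      using one by (auto simp: h_def split: if_splits)
    have "2 \<le> k" if "k \<in># s" "0 \<notin># s" "k \<noteq> 1" for k :: nat and s
      using that by (cases "k = 0") auto
    thus "(\<lambda>s. (count s 1, filter_mset (\<lambda>k. k \<noteq> 1) s)) ` {s. 0 \<notin># s} \<subseteq> UNIV \<times> big_parts"
      by (auto simp: big_parts_def)
  qed
  have "of_nat (num_ones (h x)) * z powi crank (h x) * p ^ sum_mset (h x) = f x" if "x \<in> UNIV \<times> big_parts" for x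
  proof -
    obtain j s where x: "x = (j, s)" "s \<in> big_parts" using \<open>x \<in> UNIV \<times> big_parts\<close> by auto
    have ones: "num_ones (h x) = j" using one[OF x(2)] by (simp add: x h_def num_ones_def count_eq_zero_iff)
    have pr: "(\<Prod>k\<in>#s. w j k) = z ^ size {#k \<in># s. j < k#} * p ^ sum_mset s"
      by (induction s) (auto simp: w_def power_add)
    show ?thesis
    proof (cases "j = 0")
      case False
      have "{#k \<in># replicate_mset j 1. j < k#} = {#}" using False by (auto simp: filter_mset_eq_conv)
      hence "crank (h x) = int (size {#k \<in># s. j < k#}) - int j"
        unfolding crank_def ones using False by (simp add: x h_def)
      moreover have "sum_mset (h x) = j + sum_mset s" by (simp add: x h_def)
      ultimately show ?thesis
        unfolding ones unfolding f_def x prod.case pr using z0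
        by (simp add: c_def power_int_diff power_add power_divide)
    next
      case True
      hence n0: "num_ones (h x) = 0" using ones by simp
      show ?thesis unfolding n0 using True by (simp add: f_def x c_def)
    qed
  qed
  hence "((\<lambda>x. of_nat (num_ones (h x)) * z powi crank (h x) * p ^ sum_mset (h x)) has_sum
      crank_prod z p * (lambert (p / z) p - lambert (p * p) p)) (UNIV \<times> big_parts)"
    using sum_f by (subst has_sum_cong) auto
  thus ?thesis using has_sum_reindex_bij_betw[OF bij] by blast
qed

lemma weighted_crank_has_sum_nat:
  assumes p: "p \<noteq> 0" "norm p < 1" and z: "norm z = 1"
  shows "((\<lambda>n. (\<Sum>s\<in>partitions n. of_nat (num_ones s) * z powi crank s) * p ^ n) has_sum
            crank_prod z p * (lambert (p / z) p - lambert (p * p) p)) UNIV"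
proof -
  have bij: "bij_betw snd (Sigma UNIV partitions) {s. 0 \<notin># s}"
    by (rule bij_betw_byWitness[of _ "\<lambda>s. (sum_mset s, s)"]) (auto simp: partitions_def)
  have "((\<lambda>x. of_nat (num_ones (snd x)) * z powi crank (snd x) * p ^ sum_mset (snd x)) has_sum
            crank_prod z p * (lambert (p / z) p - lambert (p * p) p)) (Sigma UNIV partitions)"
    by (subst has_sum_reindex_bij_betw[OF bij, of "\<lambda>s. of_nat (num_ones s) * z powi crank s * p ^ sum_mset s"])
       (rule weighted_crank_has_sum[OF assms])
  thus ?thesis
  proof (rule has_sum_SigmaD)
    fix n :: nat
    show "((\<lambda>s. of_nat (num_ones (snd (n, s))) * z powi crank (snd (n, s)) * p ^ sum_mset (snd (n, s))) has_sum
        (\<Sum>s\<in>partitions n. of_nat (num_ones s) * z powi crank s) * p ^ n) (partitions n)"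
      by (rule has_sum_finiteI[OF finite_partitions]) (auto simp: sum_distrib_right partitions_def intro!: sum.cong)
  qed
qed

text \<open>The coefficients are at most the total number of ones in all partitions of n, and the
  series of these totals at |p| is the case z = 1 of the weighted crank series.\<close>

lemma M_omega_summable:
  fixes p :: complex
  assumes p: "norm p < 1"
  shows "summable (\<lambda>n. norm (of_nat (M_omega r m n) * p ^ n))"
proof (cases "p = 0")
  case True
  have "summable (\<lambda>n. norm (of_nat (M_omega r m n) * (0 :: complex) ^ n))"
    by (rule summable_finite[of "{0}"]) auto
  thus ?thesis using True by simp
next
  case False
  define q where "q = complex_of_real (norm p)"
  have "summable (\<lambda>n. norm ((\<Sum>s\<in>partitions n. of_nat (num_ones s) * 1 powi crank s) * q ^ n))"
  proof -
    have "(\<lambda>n. (\<Sum>s\<in>partitions n. of_nat (num_ones s) * 1 powi crank s) * q ^ n) summable_on UNIV"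
      by (rule has_sum_imp_summable, rule weighted_crank_has_sum_nat) (use False p in \<open>auto simp: q_def\<close>)
    thus ?thesis
      by (intro summable_on_imp_summable) (simp flip: summable_on_iff_abs_summable_on_complex)
  qed
  thus ?thesis
  proof (rule summable_comparison_test')
    fix n :: nat
    have "M_omega r m n \<le> (\<Sum>s\<in>partitions n. num_ones s)"
      unfolding M_omega_def by (rule sum_mono2) (auto simp: finite_partitions)
    hence "real (M_omega r m n) * norm p ^ n \<le> real (\<Sum>s\<in>partitions n. num_ones s) * norm p ^ n"
      by (intro mult_right_mono) (simp_all flip: of_nat_sum)
    moreover have N: "norm ((\<Sum>s\<in>partitions n. of_nat (num_ones s) * 1 powi crank s) * q ^ n) = real
        (\<Sum>s\<in>partitions n. num_ones s) * norm p ^ n"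
    proof -
      have "(\<Sum>s\<in>partitions n. of_nat (num_ones s) * 1 powi crank s) = (of_nat (\<Sum>s\<in>partitions n. num_ones s) :: complex)"
        by simp
      thus ?thesis by (simp only: norm_mult norm_of_nat norm_power q_def norm_of_real abs_norm_cancel)
    qed
    ultimately show "norm (norm (of_nat (M_omega r m n) * p ^ n)) \<le> norm ((\<Sum>s\<in>partitions n. of_nat
        (num_ones s) * 1 powi crank s) * q ^ n)"
      unfolding N by (simp add: norm_mult norm_power)
  qed
qed

section \<open>Differences of crank classes modulo 11\<close>

definition crank_diff :: "nat \<Rightarrow> nat \<Rightarrow> complex" where
  "crank_diff b n = of_int (int (M_omega (int b) 11 n) - int (M_omega (11 - int b) 11 n))"

lemma crank_diff_summable:
  assumes "norm p < 1"
  shows "summable (\<lambda>n. crank_diff b n * p ^ n)"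
proof -
  have "summable (\<lambda>n. of_nat (M_omega r 11 n) * p ^ n)" for r
    using M_omega_summable[OF assms] by (rule summable_norm_cancel)
  from summable_diff[OF this this] show ?thesis
    by (simp add: crank_diff_def left_diff_distrib)
qed

lemma crank_sum_residues:
  fixes z :: complex
  assumes z: "z ^ 11 = 1"
  shows "(\<Sum>s\<in>partitions n. of_nat (num_ones s) * z powi crank s) = (\<Sum>r<11. of_nat (M_omega (int r) 11 n) * z ^ r)"
proof -
  have z0: "z \<noteq> 0" using z by auto
  have "(\<Sum>r<11. of_nat (M_omega (int r) 11 n) * z ^ r) =
      (\<Sum>r<11. \<Sum>s\<in>partitions n. if [crank s = int r] (mod 11) then of_nat (num_ones s) * z ^ r else 0)"
    unfolding M_omega_def
    by (auto simp: sum_distrib_right sum.inter_filter finite_partitions intro!: sum.cong)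
  also have "\<dots> = (\<Sum>s\<in>partitions n. \<Sum>r<11. if [crank s = int r] (mod 11) then of_nat (num_ones s) * z ^ r else 0)"
    by (rule sum.swap)
  also have "\<dots> = (\<Sum>s\<in>partitions n. of_nat (num_ones s) * z powi crank s)"
  proof (rule sum.cong)
    fix s
    define r0 where "r0 = nat (crank s mod 11)"
    have r0: "r0 < 11" "int r0 = crank s mod 11" by (auto simp: r0_def nat_less_iff)
    have "[crank s = int r] (mod 11) \<longleftrightarrow> r = r0" if "r < 11" for r
      using r0 that by (auto simp: cong_def)
    hence "(\<Sum>r<11. if [crank s = int r] (mod 11) then of_nat (num_ones s) * z ^ r else 0) =
        (\<Sum>r<11. if r = r0 then of_nat (num_ones s) * z ^ r else 0)"
      by (intro sum.cong) auto
    also have "\<dots> = of_nat (num_ones s) * z ^ r0" using r0 by simp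
    also have "z ^ r0 = z powi crank s"
    proof -
      have "z powi crank s = z powi (11 * (crank s div 11) + crank s mod 11)" by simp
      also have "\<dots> = (z powi 11) powi (crank s div 11) * z powi (crank s mod 11)"
      proof -
        have "z powi (11 * c + d) = (z powi 11) powi c * z powi d" for c d
          using z0 by (simp add: power_int_add power_int_mult)
        thus ?thesis .
      qed
      also have "z powi 11 = 1" using z by simp
      also have "z powi (crank s mod 11) = z ^ r0"
        by (simp only: r0(2)[symmetric] power_int_of_nat)
      finally show ?thesis by simp
    qed
    finally show "(\<Sum>r<11. if [crank s = int r] (mod 11) then of_nat (num_ones s) * z ^ r else 0) = of_nat (num_ones s) * z powi crank s" .
  qed auto
  finally show ?thesis by simp
qed

text \<open>The weighted series at 1/z is subtracted from the one at z. The crank product is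
  symmetric, so the Lambert series at \<open>p * p\<close> cancels, and the residue classes r and 11
  - r combine.\<close>

lemma crank_diff_gf:
  assumes p: "p \<noteq> 0" "norm p < 1" and z: "z ^ 11 = 1"
  shows "(\<Sum>b=1..5. (\<Sum>n. crank_diff b n * p ^ n) * (z ^ b - z ^ (11 - b))) =
           crank_prod z p * (lambert (p / z) p - lambert (p * z) p)"
proof -
  have z0: "z \<noteq> 0" using z by auto
  have nz: "norm z = 1"
  proof -
    have "norm z ^ 11 = 1" using z by (metis norm_one norm_power)
    thus ?thesis by (metis norm_ge_zero power_eq_1_iff zero_less_numeral less_numeral_extra(3) norm_power power_eq_imp_eq_base power_one)
  qed
  define S where "S = (\<lambda>(z::complex) n. \<Sum>s\<in>partitions n. of_nat (num_ones s) * z powi crank s)"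
  have z': "(1 / z) ^ 11 = 1" "norm (1 / z) = 1" using z nz by (simp_all add: power_divide norm_divide)
  have "(\<lambda>n. S z n * p ^ n - S (1 / z) n * p ^ n) sums
      (crank_prod z p * (lambert (p / z) p - lambert (p * p) p) - crank_prod (1 / z) p * (lambert (p / (1 / z)) p - lambert (p * p) p))"
    unfolding S_def
    by (intro sums_diff has_sum_imp_sums weighted_crank_has_sum_nat p nz z')
  also have "crank_prod (1 / z) p = crank_prod z p"
    using z0 by (simp add: crank_prod_def mult_ac)
  also have "crank_prod z p * (lambert (p / z) p - lambert (p * p) p) - crank_prod z p * (lambert (p / (1 / z)) p - lambert (p * p) p)
     = crank_prod z p * (lambert (p / z) p - lambert (p * z) p)"
    by (simp add: algebra_simps)
  finally have 1: "(\<lambda>n. S z n * p ^ n - S (1 / z) n * p ^ n) sums (crank_prod z p * (lambert (p / z) p - lambert (p * z) p))" .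
  have "S z n * p ^ n - S (1 / z) n * p ^ n = (\<Sum>b=1..5. crank_diff b n * p ^ n * (z ^ b - z ^ (11 - b)))" for n
  proof -
    have inv: "(1 / z) ^ k = z ^ (11 - k)" if "k \<le> 11" for k
    proof -
      have "z ^ k * z ^ (11 - k) = 1" using that z by (simp flip: power_add)
      thus ?thesis using z0 by (simp add: power_divide divide_simps mult.commute)
    qed
    have "(\<Sum>r<11. of_nat (M_omega (int r) 11 n) * (1 / z) ^ r) = (\<Sum>r<11. of_nat (M_omega (int r) 11 n) * z ^ (11 - r))"
      by (rule sum.cong) (auto simp: inv)
    hence "S z n - S (1 / z) n = (\<Sum>r<11. of_nat (M_omega (int r) 11 n) * z ^ r) - (\<Sum>r<11. of_nat (M_omega (int r) 11 n) * z ^ (11 - r))"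
      unfolding S_def crank_sum_residues[OF z] crank_sum_residues[OF z'(1)] by simp
    also have "\<dots> = (\<Sum>b=1..5. crank_diff b n * (z ^ b - z ^ (11 - b)))"
      using z by (simp add: crank_diff_def lessThan_nat_numeral numeral_eq_Suc lessThan_Suc atLeastAtMostSuc_conv algebra_simps)
    finally have "(S z n - S (1 / z) n) * p ^ n = (\<Sum>b=1..5. crank_diff b n * (z ^ b - z ^ (11 - b))) * p ^ n" by simp
    moreover have "(\<Sum>b=1..5. crank_diff b n * (z ^ b - z ^ (11 - b))) * p ^ n = (\<Sum>b=1..5. crank_diff b n * p ^ n * (z ^ b - z ^ (11 - b)))"
      by (subst sum_distrib_right) (rule sum.cong, simp_all)
    ultimately show ?thesis by (simp only: left_diff_distrib)
  qed
  moreover have "(\<lambda>n. \<Sum>b=1..5. crank_diff b n * p ^ n * (z ^ b - z ^ (11 - b))) sums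
      (\<Sum>b=1..5. (\<Sum>n. crank_diff b n * p ^ n) * (z ^ b - z ^ (11 - b)))"
    by (intro sums_sum sums_mult2 summable_sums crank_diff_summable p)
  ultimately show ?thesis using 1 sums_unique2 by fastforce
qed

subsection \<open>Dissection of the Lambert series\<close>

lemma lambert_eq_geom2:
  assumes "norm x < 1" "norm q < 1"
  shows "lambert x q = x * geom2 x q q"
proof -
  have "((\<lambda>n. x * (q ^ n / (1 - x * q ^ n))) has_sum x * geom2 x q q) UNIV"
    by (intro has_sum_cmult_right geom2_has_sum1) (use assms in auto)
  thus ?thesis using lambert_has_sum[OF assms] has_sum_unique by fastforce
qed

text \<open>The part of the sum of p^(ij) over i, j \<ge> 1 in which i is congruent to r and j to s
  modulo 11, for r and s in 1..11.\<close>

definition dsum :: "complex \<Rightarrow> nat \<Rightarrow> nat \<Rightarrow> complex" where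
  "dsum p r s = p ^ (r * s) * geom2 ((p ^ 11) ^ s) ((p ^ 11) ^ r) ((p ^ 11) ^ 11)"

text \<open>\<open>lambert (p * u) p\<close> is the sum of u^i p^(ij) over i, j \<ge> 1, and u^i
  depends only on i modulo 11. The representatives are 1..11 because both indices start at
  1.\<close>

lemma lambert_dissection:
  assumes p: "norm p < 1" and u: "u ^ 11 = 1" "norm u = 1"
  shows "lambert (p * u) p = (\<Sum>r=1..11. \<Sum>s=1..11. u ^ r * dsum p r s)"
proof -
  have u0: "u \<noteq> 0" using u by auto
  have pu: "norm (p * u) < 1" using p u by (simp add: norm_mult)
  have pk: "norm (p ^ k) < 1" if "k > 0" for k using p that by (simp add: norm_power power_less_one_iff)
  define h :: "(nat \<times> nat) \<times> (nat \<times> nat) \<Rightarrow> nat \<times> nat" where "h =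
      (\<lambda>((r, s), (i, j)). (11 * i + r - 1, 11 * j + s - 1 :: nat))"
  define R where "R = {1..11::nat} \<times> {1..11::nat}"
  have h: "bij_betw h (R \<times> UNIV) UNIV"
  proof (rule bij_betw_byWitness[of _ "\<lambda>(a, b). ((a mod 11 + 1, b mod 11 + 1), (a div 11, b div 11))"])
    have d: "(11 * i + r - 1) mod 11 + 1 = r" "(11 * i + r - 1) div 11 = i" if "r \<in> {1..11}" for i r :: nat
    proof -
      have "r = (r - 1) + 1" "r - 1 < 11" using that by auto
      then obtain t where t: "r = t + 1" "t < 11" by blast
      thus "(11 * i + r - 1) mod 11 + 1 = r" "(11 * i + r - 1) div 11 = i" by simp_all
    qed
    show "\<forall>x\<in>R \<times> UNIV. (case h x of (a, b) \<Rightarrow> ((a mod 11 + 1, b mod 11 + 1), (a div 11, b div 11))) = x"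
      using d by (auto simp: h_def R_def)
    show "\<forall>x\<in>UNIV. h (case x of (a, b) \<Rightarrow> ((a mod 11 + 1, b mod 11 + 1), (a div 11, b div 11))) = x"
      by (auto simp: h_def)
    show "(\<lambda>(a, b). ((a mod 11 + 1, b mod 11 + 1), (a div 11, b div 11))) ` UNIV \<subseteq> R \<times> UNIV"
    proof -
      have "a mod 11 + 1 \<le> 11" for a :: nat
        using mod_less_divisor[of 11 a] by linarith
      thus ?thesis by (auto simp: R_def)
    qed
  qed auto
  define f where "f = (\<lambda>(i, j). u ^ (i + 1) * p ^ ((i + 1) * (j + 1)))"
  have "((\<lambda>x. p * u * (case x of (i, j) \<Rightarrow> (p * u) ^ i * p ^ j * p ^ (i * j))) has_sum p * u * geom2 (p * u) p p) UNIV"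
    by (intro has_sum_cmult_right geom2_has_sum pu p)
  also have "(\<lambda>x. p * u * (case x of (i, j) \<Rightarrow> (p * u) ^ i * p ^ j * p ^ (i * j))) = f"
    by (auto simp: f_def power_mult_distrib power_add mult_ac)
  finally have "(f has_sum lambert (p * u) p) UNIV" using lambert_eq_geom2[OF pu p] by simp
  hence "((\<lambda>x. f (h x)) has_sum lambert (p * u) p) (R \<times> UNIV)"
    using has_sum_reindex_bij_betw[OF h, of f] by simp
  hence "((\<lambda>(r, s). u ^ r * dsum p r s) has_sum lambert (p * u) p) R"
  proof (rule has_sum_SigmaD)
    fix x assume "x \<in> R"
    then obtain r s where x: "x = (r, s)" "r \<ge> 1" "s \<ge> 1" by (auto simp: R_def)
    have "((\<lambda>y. u ^ r * p ^ (r * s) * (case y of (i, j) \<Rightarrow> ((p ^ 11) ^ s) ^ i * ((p ^ 11) ^ r) ^ j * ((p ^ 11) ^ 11) ^ (i * j)))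
        has_sum u ^ r * p ^ (r * s) * geom2 ((p ^ 11) ^ s) ((p ^ 11) ^ r) ((p ^ 11) ^ 11)) UNIV"
      using x by (intro has_sum_cmult_right geom2_has_sum) (auto simp flip: power_mult intro!: pk)
    moreover have "u ^ r * p ^ (r * s) * (case y of (i, j) \<Rightarrow> ((p ^ 11) ^ s) ^ i * ((p ^ 11) ^ r) ^ j *
        ((p ^ 11) ^ 11) ^ (i * j)) = f (h (x, y))" for y
    proof -
      obtain i j where y: "y = (i, j)" by force
      have h: "h (x, y) = (11 * i + r - 1, 11 * j + s - 1)" by (simp add: h_def x y)
      have "u ^ (11 * i + r) = u ^ r" using u by (simp add: power_add power_mult)
      moreover have "(11 * i + r) * (11 * j + s) = r * s + 11 * s * i + 11 * r * j + 11 * 11 * (i * j)"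
        by (simp add: algebra_simps)
      moreover have "f (h (x, y)) = u ^ (11 * i + r) * p ^ ((11 * i + r) * (11 * j + s))"
      proof -
        have "11 * i + r - 1 + 1 = 11 * i + r" "11 * j + s - 1 + 1 = 11 * j + s" using x by auto
        thus ?thesis unfolding h f_def prod.case by (simp only:)
      qed
      ultimately show ?thesis
        unfolding y prod.case using u0 by (simp add: power_add flip: power_mult)
    qed
    ultimately show "((\<lambda>y. f (h (x, y))) has_sum (case x of (r, s) \<Rightarrow> u ^ r * dsum p r s)) UNIV"
      by (simp add: x dsum_def mult.assoc)
  qed
  hence "lambert (p * u) p = (\<Sum>(r, s)\<in>R. u ^ r * dsum p r s)"
    by (simp add: has_sum_finite_iff R_def)
  thus ?thesis by (simp add: R_def sum.cartesian_product)
qed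

lemma dsum_11:
  assumes "p \<noteq> 0" "norm p < 1" "r \<ge> 1"
  shows "dsum p r 11 = lambert ((p ^ 11) ^ r) ((p ^ 11) ^ 11)"
proof -
  have "norm ((p ^ 11) ^ r) < 1" "norm ((p ^ 11) ^ 11) < 1"
    using assms by (simp_all add: norm_power power_less_one_iff flip: power_mult)
  moreover have "p ^ (r * 11) = (p ^ 11) ^ r" by (simp add: mult.commute flip: power_mult)
  ultimately show ?thesis
    unfolding dsum_def by (simp only: lambert_eq_geom2 geom2_commute[of "(p ^ 11) ^ 11"])
qed

text \<open>The reflected class is the negative quadrant of the Kronecker series: r s + 121 = (11 -
  r)(11 - s) + 11(r + s) matches the prefactors.\<close>

lemma dsum_diff:
  assumes "p \<noteq> 0" "1 \<le> r" "r \<le> 10" "1 \<le> s" "s \<le> 10"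
  shows "dsum p r s - dsum p (11 - r) (11 - s) = p ^ (r * s) * kron ((p ^ 11) ^ s) ((p ^ 11) ^ r) ((p ^ 11) ^ 11)"
proof -
  define Q where "Q = p ^ 11"
  have Q: "Q \<noteq> 0" using assms by (simp add: Q_def)
  have pw: "Q ^ 11 / Q ^ k = Q ^ (11 - k)" if "k \<le> 10" for k
    using that Q by (simp add: power_diff)
  have "p ^ (r * s) * (Q ^ 11 / (Q ^ s * Q ^ r)) = p ^ ((11 - r) * (11 - s))"
  proof -
    have "r * s + 121 = (11 - r) * (11 - s) + 11 * (s + r)"
    proof -
      have c: "int (11 - r) = 11 - int r" "int (11 - s) = 11 - int s" using assms by auto
      have "int (r * s + 121) = int ((11 - r) * (11 - s) + 11 * (s + r))"
        unfolding of_nat_add of_nat_mult c by (simp add: algebra_simps)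
      thus ?thesis by (simp only: of_nat_eq_iff)
    qed
    hence "p ^ (r * s) * p ^ 121 = p ^ ((11 - r) * (11 - s)) * (Q ^ s * Q ^ r)"
      unfolding Q_def by (simp flip: power_add power_mult)
    moreover have "p ^ 121 = Q ^ 11" by (simp add: Q_def flip: power_mult)
    ultimately show ?thesis using Q by (simp add: divide_simps)
  qed
  note k = this
  show ?thesis
    unfolding dsum_def kron_def Q_def[symmetric] k[symmetric] pw[OF assms(3)] pw[OF assms(5)]
    by (simp only: right_diff_distrib mult.assoc)
qed

text \<open>Rows r and 11 - r of the dissection enter with opposite signs, row 11 with coefficient
  0. In such a pair of rows the column 11 yields \<open>eis\<close>, and column s matched with 11 -
  s yields \<open>kron\<close>.\<close>

lemma lambert_difference:
  assumes p: "p \<noteq> 0" "norm p < 1" and z: "z ^ 11 = 1" "norm z = 1"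
  shows "lambert (p / z) p - lambert (p * z) p =
    - (\<Sum>r=1..5. (z ^ r - z ^ (11 - r)) * (eis ((p ^ 11) ^ r) ((p ^ 11) ^ 11)
         + (\<Sum>s=1..10. p ^ (r * s) * kron ((p ^ 11) ^ s) ((p ^ 11) ^ r) ((p ^ 11) ^ 11))))"
proof -
  have z0: "z \<noteq> 0" using z by auto
  define U where "U = (\<lambda>r. \<Sum>s=1..11. dsum p r s)"
  have inv: "(1 / z) ^ k = z ^ (11 - k)" if "k \<le> 11" for k
  proof -
    have "z ^ k * z ^ (11 - k) = 1" using that z by (simp flip: power_add)
    thus ?thesis using z0 by (simp add: power_divide divide_simps mult.commute)
  qed
  have L: "lambert (p * u) p = (\<Sum>r=1..11. u ^ r * U r)" if "u ^ 11 = 1" "norm u = 1" for u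
    using lambert_dissection[OF p(2) that] by (simp add: U_def sum_distrib_left)
  have UU: "U r - U (11 - r) = eis ((p ^ 11) ^ r) ((p ^ 11) ^ 11)
         + (\<Sum>s=1..10. p ^ (r * s) * kron ((p ^ 11) ^ s) ((p ^ 11) ^ r) ((p ^ 11) ^ 11))" if r: "1 \<le> r" "r \<le> 10" for r
  proof -
    have U: "U k = dsum p k 11 + (\<Sum>s=1..10. dsum p k s)" for k
      using sum.atLeastAtMost_shift_0 by (simp add: U_def numeral_eq_Suc atLeastAtMostSuc_conv)
    have "(\<Sum>s=1..10. dsum p (11 - r) s) = (\<Sum>s=1..10. dsum p (11 - r) (11 - s))"
      by (rule sum.reindex_bij_witness[of _ "\<lambda>s. 11 - s" "\<lambda>s. 11 - s"]) auto
    hence "U r - U (11 - r) = (dsum p r 11 - dsum p (11 - r) 11) + (\<Sum>s=1..10. dsum p r s - dsum p (11 - r) (11 - s))"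
      unfolding U by (simp add: sum_subtractf)
    also have "(\<Sum>s=1..10. dsum p r s - dsum p (11 - r) (11 - s)) = (\<Sum>s=1..10. p ^ (r * s) * kron ((p ^ 11)
        ^ s) ((p ^ 11) ^ r) ((p ^ 11) ^ 11))"
      using r p by (intro sum.cong dsum_diff) auto
    also have "dsum p r 11 - dsum p (11 - r) 11 = eis ((p ^ 11) ^ r) ((p ^ 11) ^ 11)"
    proof -
      have "(p ^ 11) ^ 11 / (p ^ 11) ^ r = (p ^ 11) ^ (11 - r)"
        using r p by (subst power_diff) auto
      thus ?thesis using dsum_11[OF p, of r] dsum_11[OF p, of "11 - r"] r by (simp add: eis_def)
    qed
    finally show ?thesis .
  qed
  have "lambert (p / z) p = (\<Sum>r=1..11. z ^ (11 - r) * U r)"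
  proof -
    have "lambert (p / z) p = (\<Sum>r=1..11. (1 / z) ^ r * U r)"
      using L[of "1 / z"] z by (simp add: power_divide norm_divide)
    also have "\<dots> = (\<Sum>r=1..11. z ^ (11 - r) * U r)"
      by (intro sum.cong refl) (simp only: inv atLeastAtMost_iff)
    finally show ?thesis .
  qed
  hence "lambert (p / z) p - lambert (p * z) p = - (\<Sum>r=1..11. (z ^ r - z ^ (11 - r)) * U r)"
    using L[OF z] by (simp add: sum_subtractf left_diff_distrib flip: sum_negf)
  also have "(\<Sum>r=1..11. (z ^ r - z ^ (11 - r)) * U r) = (\<Sum>r=1..5. (z ^ r - z ^ (11 - r)) * (U r - U (11 - r)))"
    using z by (simp add: numeral_eq_Suc atLeastAtMostSuc_conv algebra_simps)
  also have "\<dots> = (\<Sum>r=1..5. (z ^ r - z ^ (11 - r)) * (eis ((p ^ 11) ^ r) ((p ^ 11) ^ 11)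
         + (\<Sum>s=1..10. p ^ (r * s) * kron ((p ^ 11) ^ s) ((p ^ 11) ^ r) ((p ^ 11) ^ 11))))"
    by (intro sum.cong) (auto simp: UU)
  finally show ?thesis .
qed

subsection \<open>Theta constants of level 11\<close>

lemma level11:
  fixes Q :: complex
  assumes "Q \<noteq> 0" "norm Q < 1"
  shows "Q ^ 11 \<noteq> 0" "norm (Q ^ 11) < 1"
  using assms by (simp_all add: norm_power power_less_one_iff)

lemma power_in_annulus:
  assumes Q: "Q \<noteq> 0" "norm Q < 1" and a: "1 \<le> a" "a \<le> 10"
  shows "Q ^ a \<in> annulus (Q ^ 11)"
proof -
  have "norm Q ^ 11 < norm Q ^ a" using Q a by (intro power_strict_decreasing) auto
  moreover have "norm Q ^ a < 1" using Q a by (simp add: power_less_one_iff)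
  ultimately show ?thesis by (simp add: annulus_def norm_power)
qed

lemma J2_eq_theta:
  assumes Q: "Q \<noteq> 0" "norm Q < 1" and a: "a \<le> 11"
  shows "J2 a 11 Q = theta (Q ^ a) (Q ^ 11)"
proof -
  have "Q ^ 11 / Q ^ a = Q ^ (11 - a)" using Q a by (subst power_diff) auto
  thus ?thesis
    using triple_product[of "Q ^ 11" "Q ^ a"] level11[OF Q] Q by (simp add: J2_def qpochs_inf_def)
qed

lemma J2_reflect: "a \<le> 11 \<Longrightarrow> J2 (11 - a) 11 Q = J2 a 11 Q"
  by (simp add: J2_def qpochs_inf_def)

lemma J2_nonzero:
  assumes "Q \<noteq> 0" "norm Q < 1" "1 \<le> a" "a \<le> 10"
  shows "J2 a 11 Q \<noteq> 0"
  using theta_annulus_nonzero[OF _ power_in_annulus[OF assms]] J2_eq_theta[OF assms(1,2), of a] assms by simp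

text \<open>Weierstrass' relation at powers of Q; the bound a \<le> 5 keeps all sums of indices
  below 11.\<close>

lemma J2_three_term:
  assumes Q: "Q \<noteq> 0" "norm Q < 1" and abc: "c < b" "b < a" "a \<le> 5"
  shows "Q ^ (b - c) * J2 (a + b) 11 Q * J2 (a - b) 11 Q * J2 c 11 Q ^ 2 =
    J2 (a + c) 11 Q * J2 (a - c) 11 Q * J2 b 11 Q ^ 2 - J2 a 11 Q ^ 2 * J2 (b + c) 11 Q * J2 (b - c) 11 Q"
proof -
  have d: "Q ^ m / Q ^ n = Q ^ (m - n)" if "n \<le> m" for m n using Q that by (subst power_diff) auto
  show ?thesis
    using theta_three_term[OF level11[OF Q], of "Q ^ a" "Q ^ b" "Q ^ c"] Q abc
    by (simp add: J2_eq_theta[OF Q] d mult.assoc flip: power_add)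
qed

text \<open>\<open>kron_eq\<close> at powers of Q. For r + s = 11 the numerator is theta at its own
  nome; beyond 11 one quasi-period is taken off, which costs a power of Q.\<close>

lemma kron_level11:
  assumes Q: "Q \<noteq> 0" "norm Q < 1" and rs: "1 \<le> r" "r \<le> 10" "1 \<le> s" "s \<le> 10"
  shows "kron (Q ^ s) (Q ^ r) (Q ^ 11) = J1 11 Q ^ 3 *
    (if r + s = 11 then 0 else if r + s < 11 then J2 (r + s) 11 Q else - J2 (r + s - 11) 11 Q / Q ^ (r + s - 11)) /
    (J2 r 11 Q * J2 s 11 Q)"
proof -
  have nz: "J2 r 11 Q \<noteq> 0" "J2 s 11 Q \<noteq> 0" using J2_nonzero[OF Q] rs by auto
  have "kron (Q ^ s) (Q ^ r) (Q ^ 11) * J2 s 11 Q * J2 r 11 Q = J1 11 Q ^ 3 * theta (Q ^ (r + s)) (Q ^ 11)"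
    using kron_eq[OF _ power_in_annulus[OF Q rs(3,4)] power_in_annulus[OF Q rs(1,2)]] Q rs
    by (simp add: J2_eq_theta[OF Q] J1_def power_add mult.commute)
  moreover have "theta (Q ^ (r + s)) (Q ^ 11) =
     (if r + s = 11 then 0 else if r + s < 11 then J2 (r + s) 11 Q else - J2 (r + s - 11) 11 Q / Q ^ (r + s - 11))"
  proof -
    consider "r + s = 11" | "r + s < 11" | "r + s > 11" by linarith
    thus ?thesis
    proof cases
      case 1 thus ?thesis using theta_nome[OF level11[OF Q]] by simp
    next
      case 2 thus ?thesis by (simp add: J2_eq_theta[OF Q])
    next
      case 3
      define k where "k = r + s - 11"
      have k: "r + s = k + 11" "k \<le> 11" using 3 rs by (auto simp: k_def)
      have "theta (Q ^ k * Q ^ 11) (Q ^ 11) = - theta (Q ^ k) (Q ^ 11) / Q ^ k"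
        by (rule theta_shift) (use level11[OF Q] Q in auto)
      thus ?thesis using 3 J2_eq_theta[OF Q k(2)] by (simp add: k power_add)
    qed
  qed
  ultimately show ?thesis using nz by (simp add: eq_divide_eq mult_ac)
qed

text \<open>The choice y = Q^(11 - c) makes Q^c y equal to the nome. The Kronecker value at c is
  then 0, and the second product disappears from the four-term relation.\<close>

lemma eis_level11:
  assumes Q: "Q \<noteq> 0" "norm Q < 1"
    and abcd: "1 \<le> a" "1 \<le> b" "1 \<le> c" "1 \<le> d" "a + b = c + d" "a + b \<le> 10"
  shows "kron (Q ^ a) (Q ^ (11 - c)) (Q ^ 11) * kron (Q ^ b) (Q ^ (11 - c)) (Q ^ 11) =
     kron (Q ^ (a + b)) (Q ^ (11 - c)) (Q ^ 11) *
       (eis (Q ^ a) (Q ^ 11) + eis (Q ^ b) (Q ^ 11) - eis (Q ^ c) (Q ^ 11) - eis (Q ^ d) (Q ^ 11))"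
proof -
  note A = power_in_annulus[OF Q]
  have "kron (Q ^ c) (Q ^ (11 - c)) (Q ^ 11) = 0"
    using abcd Q by (intro kron_eq_0 A) (auto simp flip: power_add)
  thus ?thesis
    using kron_four_term[of "Q ^ 11" "Q ^ a" "Q ^ b" "Q ^ c" "Q ^ d" "Q ^ (11 - c)"] abcd Q
      A[of a] A[of b] A[of c] A[of d] A[of "11 - c"] A[of "a + b"]
    by (simp flip: power_add)
qed

section \<open>Dissections of theta at roots of unity and of Euler's product\<close>

lemma lessThan_11: "{..<11::nat} = {0,1,2,3,4,5,6,7,8,9,10}"
  by (rule set_eqI) (simp; presburger)

text \<open>Of the eleven components the last is theta at its own nome, hence 0, and the reflection
  a -> 11 - a pairs the other ten.\<close>

lemma theta_root_dissection:
  assumes p: "p \<noteq> 0" "norm p < 1" and z: "z ^ 11 = 1"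
  defines "Q \<equiv> p ^ 11"
  shows "theta z p = (1 - z) * J2 5 11 Q + p * (z ^ 2 - z ^ 10) * J2 4 11 Q - p ^ 3 * (z ^ 3 - z ^ 9) * J2 3 11 Q
     + p ^ 6 * (z ^ 4 - z ^ 8) * J2 2 11 Q - p ^ 10 * (z ^ 5 - z ^ 7) * J2 1 11 Q"
proof -
  have z0: "z \<noteq> 0" using z by auto
  have Q: "Q \<noteq> 0" "norm Q < 1" using p by (simp_all add: Q_def norm_power power_less_one_iff)
  have "theta (z ^ 11 * p ^ (11 + 11 * k)) (p ^ 121) = theta (Q ^ (k + 1)) (Q ^ 11)" for k
    using z by (simp add: Q_def algebra_simps flip: power_mult power_Suc)
  hence th: "theta (z ^ 11 * p ^ (11 + 11 * k)) (p ^ 121) = J2 (k + 1) 11 Q" if "k < 11" for k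
    using that by (simp add: J2_eq_theta[OF Q])
  have zk: "z powi (int k - 4) = z ^ ((k + 7) mod 11)" for k
  proof -
    have "z powi (int k - 4) * z powi 11 = z powi ((int k - 4) + 11)"
      using z0 by (subst power_int_add) auto
    also have "(int k - 4) + 11 = int (k + 7)" by simp
    also have "z powi int (k + 7) = z ^ (k + 7)" by (rule power_int_of_nat)
    also have "z ^ (k + 7) = (z ^ 11) ^ ((k + 7) div 11) * z ^ ((k + 7) mod 11)"
      by (simp flip: power_mult power_add)
    finally show ?thesis using z by simp
  qed
  have "theta z p = (\<Sum>k<11. (-1) ^ k * p ^ nat (tri (int k - 4)) * z ^ ((k + 7) mod 11) * J2 (k + 1) 11 Q)"
    unfolding theta_dissection[OF p z0] zk
    by (rule sum.cong) (auto simp: th power_int_def tri_nonneg not_le)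
  moreover have "J2 11 11 Q = 0" using theta_nome[OF level11[OF Q]] J2_eq_theta[OF Q, of 11] by simp
  moreover have "J2 10 11 Q = J2 1 11 Q" "J2 9 11 Q = J2 2 11 Q" "J2 8 11 Q = J2 3 11 Q" "J2 7 11 Q = J2 4 11 Q" "J2 6 11 Q = J2 5 11 Q"
    using J2_reflect[of 1 Q] J2_reflect[of 2 Q] J2_reflect[of 3 Q] J2_reflect[of 4 Q] J2_reflect[of 5 Q] by simp_all
  ultimately show ?thesis
    by (simp add: lessThan_11 tri_def numeral_2_eq_2[symmetric] algebra_simps)
qed

text \<open>The quintuple product at x = Q^j and nome Q^11 merges two theta values of nome Q^33 into
  one quotient of level 11.\<close>

lemma quintuple_level11:
  assumes Q: "Q \<noteq> 0" "norm Q < 1" and j: "1 \<le> j" "j \<le> 5"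
  shows "theta (Q ^ (11 + 3 * j)) (Q ^ 33) + Q ^ j * theta (Q ^ 11 / Q ^ (3 * j)) (Q ^ 33) = J1 11 Q * J2 (2 * j) 11 Q / J2 j 11 Q"
proof -
  have "J2 j 11 Q \<noteq> 0" by (rule J2_nonzero[OF Q]) (use j in auto)
  moreover have "J1 11 Q * J2 (2 * j) 11 Q = J2 j 11 Q * (theta (Q ^ (11 + 3 * j)) (Q ^ 33) + Q ^ j * theta (Q ^ 11 / Q ^ (3 * j)) (Q ^ 33))"
  proof -
    have pw: "(Q ^ j) ^ 3 = Q ^ (3 * j)" "(Q ^ j) ^ 2 = Q ^ (2 * j)" "(Q ^ 11) ^ 3 = Q ^ 33"
      by (simp_all add: mult.commute flip: power_mult)
    show ?thesis
      using quintuple_product[OF level11[OF Q], of "Q ^ j"] Q j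
      unfolding pw power_add[symmetric] by (simp add: J2_eq_theta[OF Q] J1_def)
  qed
  ultimately show ?thesis by (simp add: eq_divide_eq mult.commute)
qed

text \<open>The pentagonal series is a theta series of nome p^3 and splits into eleven values of
  nome Q^33. Ten of them pair off through the quintuple product; the middle one,
  \<open>t 22\<close>, is the pentagonal series of Q^11 itself and gives the bare term p^5.\<close>

lemma qpoch_dissection:
  assumes p: "p \<noteq> 0" "norm p < 1"
  defines "Q \<equiv> p ^ 11"
  shows "qpoch_inf p p = J1 11 Q * (J2 4 11 Q / J2 2 11 Q - p * (J2 2 11 Q / J2 1 11 Q) - p ^ 2 * (J2 5 11 Q / J2 3 11 Q)
     - p ^ 15 * (J2 1 11 Q / J2 5 11 Q) + p ^ 5 + p ^ 7 * (J2 3 11 Q / J2 4 11 Q))"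
proof -
  have Q: "Q \<noteq> 0" "norm Q < 1" using p by (simp_all add: Q_def norm_power power_less_one_iff)
  have p3: "p ^ 3 \<noteq> 0" "norm (p ^ 3) < 1" using p by (simp_all add: norm_power power_less_one_iff)
  have Q33: "Q ^ 33 \<noteq> 0" "norm (Q ^ 33) < 1" using Q by (simp_all add: norm_power power_less_one_iff)
  define t where "t = (\<lambda>k. theta (Q ^ k) (Q ^ 33))"
  have th: "theta (p ^ 11 * (p ^ 3) ^ (11 + 11 * k)) ((p ^ 3) ^ 121) = t (4 + 3 * k)" for k
  proof -
    have "p ^ 11 * (p ^ 3) ^ (11 + 11 * k) = Q ^ (4 + 3 * k)"
      unfolding Q_def power_mult[symmetric] power_add[symmetric] by (rule arg_cong[of _ _ "\<lambda>n. p ^ n"]) simp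
    moreover have "(p ^ 3) ^ 121 = Q ^ 33" by (simp add: Q_def flip: power_mult)
    ultimately show ?thesis by (simp add: t_def)
  qed
  have ex: "(p ^ 3) powi tri (int k - 4) * p powi (int k - 4) = p ^ nat (3 * tri (int k - 4) + (int k - 4))" if "k < 11" for k
  proof -
    have "3 * tri (int k - 4) + (int k - 4) \<ge> 0"
    proof (cases "k \<ge> 4")
      case True thus ?thesis using tri_nonneg[of "int k - 4"] by simp
    next
      case False
      hence "k = 0 \<or> k = 1 \<or> k = 2 \<or> k = 3" by auto
      thus ?thesis by (auto simp: tri_def)
    qed
    moreover have "(p ^ 3) powi tri (int k - 4) * p powi (int k - 4) = p powi (3 * tri (int k - 4) + (int k - 4))"
      using p by (simp add: power_int_add power_int_mult)
    ultimately show ?thesis by (simp add: power_int_def)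
  qed
  have "qpoch_inf p p = (\<Sum>k<11. (-1) ^ k * p ^ nat (3 * tri (int k - 4) + (int k - 4)) * t (4 + 3 * k))"
    unfolding qpoch_eq_theta[OF p] theta_dissection[OF p3 p(1)] th
    by (rule sum.cong) (simp_all add: ex[symmetric] mult_ac)
  hence 1: "qpoch_inf p p = p ^ 26 * t 4 - p ^ 15 * t 7 + p ^ 7 * t 10 - p ^ 2 * t 13 + t 16 - p * t 19 + p ^ 5 * t 22
      - p ^ 12 * t 25 + p ^ 22 * t 28 - p ^ 35 * t 31 + p ^ 51 * t 34"
    by (simp add: lessThan_11 tri_def)
  have refl: "theta (Q ^ (33 - a)) (Q ^ 33) = t a" if "a \<le> 33" for a
  proof -
    have "Q ^ 33 / Q ^ a = Q ^ (33 - a)" using Q that by (subst power_diff) auto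
    thus ?thesis using theta_reflect[OF Q33, of "Q ^ a"] Q by (simp add: t_def)
  qed
  have q: "theta (Q ^ (11 + 3 * j)) (Q ^ 33) + Q ^ j * theta (Q ^ 11 / Q ^ (3 * j)) (Q ^ 33) = J1 11 Q * J2 (2 * j) 11 Q / J2 j 11 Q"
    if "1 \<le> j" "j \<le> 5" for j by (rule quintuple_level11[OF Q that])
  have d: "Q ^ m / Q ^ n = Q ^ (m - n)" if "n \<le> m" for m n using Q that by (subst power_diff) auto
  \<comment> \<open>For j = 4 and j = 5 the exponent 11 - 3j is negative, so these two pairs need
    \<open>theta_inverse\<close>.\<close>
  have d': "Q ^ m / Q ^ n = 1 / Q ^ (n - m)" if "m \<le> n" for m n using Q that by (simp add: power_diff divide_simps)
  have inv: "theta (1 / Q ^ k) (Q ^ 33) = - t k / Q ^ k" for k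
    using theta_inverse[OF Q33, of "Q ^ k"] Q by (simp add: t_def)
  have t34: "t 34 = - t 1 / Q"
    using theta_shift[OF Q33 Q(1)] by (simp add: t_def flip: power_Suc)
  have q1: "t 19 + Q * t 25 = J1 11 Q * J2 2 11 Q / J2 1 11 Q"
    using q[of 1] refl[of 14] refl[of 19] refl[of 25] by (simp add: d t_def)
  have q2: "t 16 + Q ^ 2 * t 28 = J1 11 Q * J2 4 11 Q / J2 2 11 Q"
    using q[of 2] refl[of 16] refl[of 28] by (simp add: d t_def)
  have q3: "t 13 + Q ^ 3 * t 31 = J1 11 Q * J2 5 11 Q / J2 3 11 Q"
    using q[of 3] refl[of 13] refl[of 31] J2_reflect[of 5 Q] by (simp add: d t_def)
  have q4: "t 10 + Q ^ 4 * t 34 = J1 11 Q * J2 3 11 Q / J2 4 11 Q"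
    using q[of 4] refl[of 10] J2_reflect[of 3 Q] inv[of 1] t34 by (simp add: d' t_def)
  have q5: "t 7 - Q * t 4 = J1 11 Q * J2 1 11 Q / J2 5 11 Q"
  proof -
    have "t 7 + Q ^ 5 * theta (Q ^ 11 / Q ^ 15) (Q ^ 33) = J1 11 Q * J2 1 11 Q / J2 5 11 Q"
      using q[of 5] refl[of 7] J2_reflect[of 1 Q] by (simp add: t_def)
    moreover have "theta (Q ^ 11 / Q ^ 15) (Q ^ 33) = - t 4 / Q ^ 4"
      using inv[of 4] by (simp add: d')
    moreover have "Q ^ 5 * (- t 4 / Q ^ 4) = - (Q * t 4)"
    proof -
      have "Q ^ 5 = Q * Q ^ 4" by (simp flip: power_Suc)
      thus ?thesis using Q by simp
    qed
    ultimately show ?thesis by simp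
  qed
  have q6: "t 22 = J1 11 Q"
  proof -
    have "t 22 = t 11" using refl[of 11] by (simp add: t_def)
    also have "\<dots> = qpoch_inf (Q ^ 11) (Q ^ 11)"
      using qpoch_eq_theta[OF level11[OF Q]] by (simp add: t_def flip: power_mult)
    finally show ?thesis by (simp add: J1_def)
  qed
  have "qpoch_inf p p = (t 16 + Q ^ 2 * t 28) - p * (t 19 + Q * t 25) - p ^ 2 * (t 13 + Q ^ 3 * t 31)
     - p ^ 15 * (t 7 - Q * t 4) + p ^ 5 * t 22 + p ^ 7 * (t 10 + Q ^ 4 * t 34)"
  proof -
    have "p ^ 12 = p * Q" "p ^ 22 = Q ^ 2" "p ^ 26 = p ^ 15 * Q" "p ^ 35 = p ^ 2 * Q ^ 3" "p ^ 51 = p ^ 7 * Q ^ 4"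
      by (simp_all add: Q_def flip: power_mult power_add power_Suc)
    thus ?thesis unfolding 1 by (simp add: algebra_simps)
  qed
  thus ?thesis unfolding q1 q2 q3 q4 q5 q6 by (simp add: algebra_simps)
qed

text \<open>Up to a factor z^6, these are the coefficients of z^k - z^(11-k), k = 1, ..., 5, in the
  proposed dissection of the crank product times that of theta(z; p). The target (1 - z)(p;p)^2
  involves only k = 5, with the square of the dissected Euler product.\<close>

lemma crank_dissection_algebra:
  fixes a1 a2 a3 a4 a5 p :: complex
  defines "Q \<equiv> p ^ 11"
  defines "X0 \<equiv> 1 / a1" and "X1 \<equiv> a5 / (a2 * a3)" and "X2 \<equiv> a3 / (a1 * a4)" and "X3 \<equiv> a2 / (a1 * a3)"
    and "X4 \<equiv> 1 / a2" and "X5 \<equiv> a4 / (a2 * a5)" and "X7 \<equiv> 1 / a3" and "X8 \<equiv> Q * a1 / (a4 * a5)"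
    and "X9 \<equiv> 1 / a4" and "X10 \<equiv> 1 / a5"
    and "e0 \<equiv> a4 / a2" and "e1 \<equiv> a2 / a1" and "e2 \<equiv> a5 / a3" and "e3 \<equiv> a1 / a5" and "e4
        \<equiv> 1" and "e5 \<equiv> a3 / a4"
  assumes nz: "a1 \<noteq> 0" "a2 \<noteq> 0" "a3 \<noteq> 0" "a4 \<noteq> 0" "a5 \<noteq> 0"
    and R0: "a2 * a3 * a4 ^ 2 - a1 * a4 * a5 ^ 2 - Q * a1 * a2 * a3 ^ 2 = 0" (is "?r0 = 0")
    and R4: "a3 ^ 2 * a4 * a5 - a2 * a4 * a5 ^ 2 - Q ^ 2 * a1 ^ 2 * a2 * a3 = 0" (is "?r4 = 0")
    and R5: "a2 ^ 2 * a4 * a5 - a1 * a3 * a5 ^ 2 - Q * a1 ^ 2 * a3 * a4 = 0" (is "?r5 = 0")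
    and R6: "a2 * a3 ^ 2 * a5 - a1 * a4 ^ 2 * a5 - Q * a1 * a2 ^ 2 * a4 = 0" (is "?r6 = 0")
    and R8: "a2 ^ 2 * a3 * a5 - a1 * a3 * a4 ^ 2 - Q * a1 ^ 2 * a2 * a5 = 0" (is "?r8 = 0")
  shows "p ^ 10 * X0 * a1 + p ^ 5 * X2 * a3 + p ^ 13 * X3 * a1 + p ^ 9 * X3 * a2 + p ^ 4 * X4 * a5 + p ^ 15 * X5 * a1
      + p ^ 7 * X7 * a5 + p ^ 8 * X8 * a5 + p ^ 12 * X9 * a3 + p ^ 11 * X10 * a4 - p ^ 11 * X1 * a1 - p ^ 7 * X1 * a2
      - p ^ 12 * X2 * a1 - p ^ 4 * X3 * a4 - p ^ 5 * X5 * a5 - p ^ 13 * X7 * a2 - p ^ 10 * X7 * a3 - p ^ 11 * X8 * a3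
      - p ^ 9 * X8 * a4 - p ^ 19 * X9 * a1 - p ^ 9 * X9 * a5 - p ^ 16 * X10 * a2 = 0" (is "?d1 = 0")
    and "p ^ 11 * X1 * a1 + p ^ 7 * X1 * a2 + p ^ 4 * X1 * a3 + p ^ 3 * X3 * a5 + p ^ 6 * X5 * a4 + p ^ 5 * X5 * a5 +
        p ^ 17 * X7 * a1 + p ^ 13 * X7 * a2 + p ^ 10 * X7 * a3 + p ^ 14 * X8 * a2 + p ^ 11 * X8 * a3 + p ^ 9 * X9 *
        a5 + p ^ 20 * X10 * a1 - p ^ 6 * X0 * a2 - p ^ 3 * X2 * a4 - p ^ 13 * X3 * a1 - p ^ 9 * X3 * a2 - p ^ 5 * X4
        * a4 - p ^ 4 * X4 * a5 - p ^ 11 * X5 * a2 - p ^ 7 * X7 * a5 - p ^ 10 * X10 * a5 = 0" (is "?d2 = 0")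
    and "p ^ 3 * X0 * a3 + p ^ 12 * X2 * a1 + p ^ 2 * X2 * a5 + p ^ 6 * X3 * a3 + p ^ 7 * X4 * a3 + p ^ 5 * X4 * a4 +
        p ^ 4 * X4 * a5 + p ^ 19 * X9 * a1 + p ^ 10 * X10 * a5 - p ^ 7 * X1 * a2 - p ^ 4 * X1 * a3 - p ^ 2 * X1 * a4
        - p ^ 3 * X3 * a5 - p ^ 6 * X5 * a4 - p ^ 5 * X5 * a5 - p ^ 17 * X7 * a1 - p ^ 13 * X7 * a2 - p ^ 18 * X8 *
        a1 - p ^ 14 * X8 * a2 - p ^ 8 * X8 * a5 - p ^ 12 * X9 * a3 - p ^ 10 * X9 * a4 = 0" (is "?d3 = 0")
    and "p ^ 4 * X1 * a3 + p ^ 2 * X1 * a4 + p * X1 * a5 + p ^ 13 * X3 * a1 + p ^ 11 * X5 * a2 + p ^ 8 * X5 * a3 + p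
        ^ 5 * X5 * a5 + p ^ 7 * X7 * a5 + p ^ 18 * X8 * a1 + p ^ 9 * X8 * a4 + p ^ 8 * X8 * a5 + p ^ 12 * X9 * a3 + p
        ^ 10 * X9 * a4 - p * X0 * a4 - p ^ 8 * X2 * a2 - p ^ 2 * X2 * a5 - p ^ 10 * X4 * a2 - p ^ 7 * X4 * a3 - p ^ 5
        * X4 * a4 - p ^ 4 * X4 * a5 - p ^ 20 * X10 * a1 - p ^ 11 * X10 * a4 = 0" (is "?d4 = 0")
    and "X0 * a5 + p ^ 5 * X2 * a3 + p ^ 3 * X2 * a4 + p ^ 3 * X3 * a5 + p ^ 14 * X4 * a1 + p ^ 10 * X4 * a2 + p ^ 7
        * X4 * a3 + p ^ 5 * X4 * a4 + p ^ 4 * X4 * a5 + p ^ 17 * X7 * a1 + p ^ 13 * X7 * a2 + p ^ 18 * X8 * a1 + p ^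
        16 * X10 * a2 + p ^ 13 * X10 * a3 - p ^ 2 * X1 * a4 - 2 * p * X1 * a5 - p ^ 9 * X3 * a2 - p ^ 6 * X3 * a3 - p
        ^ 15 * X5 * a1 - p ^ 11 * X5 * a2 - p ^ 8 * X5 * a3 - p ^ 6 * X5 * a4 - p ^ 8 * X7 * a4 - p ^ 7 * X7 * a5 - p
        ^ 11 * X8 * a3 - p ^ 9 * X8 * a4 - p ^ 8 * X8 * a5 - p ^ 19 * X9 * a1 - p ^ 15 * X9 * a2 - p ^ 9 * X9 * a5 =
        (e0 - p * e1 - p ^ 2 * e2 - p ^ 15 * e3 + p ^ 5 * e4 + p ^ 7 * e5) ^ 2" (is "?d5 = ?s")
proof -
  note defs = X0_def X1_def X2_def X3_def X4_def X5_def X7_def X8_def X9_def X10_def e0_def e1_def e2_def e3_def e4_def e5_def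
  \<comment> \<open>In \<open>Fj_c\<close> the j-th expression is restricted to exponents of p
    congruent to c modulo 11, with p^11 written as Q. Each is 0 either identically or because its
    numerator is a combination of the relations \<open>R0\<close> to \<open>R8\<close>.\<close>
  have "Q * X10 * a4 - Q * X1 * a1 - Q * X8 * a3 = Q * ?r0 / (a2 * a3 * a4 * a5)" (is "?f1_0 = _")
    unfolding defs using nz by (simp add: field_simps power2_eq_square)
  hence F1_0: "?f1_0 = 0" by (simp only: R0) simp
  have F1_1: "Q * X9 * a3 - Q * X2 * a1 = 0" (is "?f1_1 = 0")
    unfolding defs using nz by (simp add: field_simps)
  have F1_2: "Q * X3 * a1 - Q * X7 * a2 = 0" (is "?f1_2 = 0")
    unfolding defs using nz by (simp add: field_simps)
  have "X4 * a5 + Q * X5 * a1 - X3 * a4 = (- ?r5) / (a1 * a2 * a3 * a5)" (is "?f1_4 = _")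
    unfolding defs using nz by (simp add: field_simps power2_eq_square)
  hence F1_4: "?f1_4 = 0" by (simp only: R5) simp
  have "X2 * a3 - X5 * a5 - Q * X10 * a2 = ?r6 / (a1 * a2 * a4 * a5)" (is "?f1_5 = _")
    unfolding defs using nz by (simp add: field_simps power2_eq_square)
  hence F1_5: "?f1_5 = 0" by (simp only: R6) simp
  have F1_7: "X7 * a5 - X1 * a2 = 0" (is "?f1_7 = 0")
    unfolding defs using nz by (simp add: field_simps)
  have F1_8: "X8 * a5 - Q * X9 * a1 = 0" (is "?f1_8 = 0")
    unfolding defs using nz by (simp add: field_simps)
  have "X3 * a2 - X8 * a4 - X9 * a5 = ?r5 / (a1 * a3 * a4 * a5)" (is "?f1_9 = _")
    unfolding defs using nz by (simp add: field_simps power2_eq_square)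
  hence F1_9: "?f1_9 = 0" by (simp only: R5) simp
  have F1_10: "X0 * a1 - X7 * a3 = 0" (is "?f1_10 = 0")
    unfolding defs using nz by (simp add: field_simps)
  have "Q * X1 * a1 + Q * X8 * a3 - Q * X5 * a2 = Q * (- ?r0) / (a2 * a3 * a4 * a5)" (is "?f2_0 = _")
    unfolding defs using nz by (simp add: field_simps power2_eq_square)
  hence F2_0: "?f2_0 = 0" by (simp only: R0) simp
  have F2_2: "Q * X7 * a2 - Q * X3 * a1 = 0" (is "?f2_2 = 0")
    unfolding defs using nz by (simp add: field_simps)
  have "X3 * a5 + Q * X8 * a2 - X2 * a4 = (- ?r4) / (a1 * a3 * a4 * a5)" (is "?f2_3 = _")
    unfolding defs using nz by (simp add: field_simps power2_eq_square)
  hence F2_3: "?f2_3 = 0" by (simp only: R4) simp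
  have F2_4: "X1 * a3 - X4 * a5 = 0" (is "?f2_4 = 0")
    unfolding defs using nz by (simp add: field_simps)
  have F2_5: "X5 * a5 - X4 * a4 = 0" (is "?f2_5 = 0")
    unfolding defs using nz by (simp add: field_simps)
  have "X5 * a4 + Q * X7 * a1 - X0 * a2 = (- ?r8) / (a1 * a2 * a3 * a5)" (is "?f2_6 = _")
    unfolding defs using nz by (simp add: field_simps power2_eq_square)
  hence F2_6: "?f2_6 = 0" by (simp only: R8) simp
  have F2_7: "X1 * a2 - X7 * a5 = 0" (is "?f2_7 = 0")
    unfolding defs using nz by (simp add: field_simps)
  have "X9 * a5 + Q * X10 * a1 - X3 * a2 = (- ?r5) / (a1 * a3 * a4 * a5)" (is "?f2_9 = _")
    unfolding defs using nz by (simp add: field_simps power2_eq_square)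
  hence F2_9: "?f2_9 = 0" by (simp only: R5) simp
  have F2_10: "X7 * a3 - X10 * a5 = 0" (is "?f2_10 = 0")
    unfolding defs using nz by (simp add: field_simps)
  have F3_1: "Q * X2 * a1 - Q * X9 * a3 = 0" (is "?f3_1 = 0")
    unfolding defs using nz by (simp add: field_simps)
  have "X2 * a5 - X1 * a4 - Q * X7 * a2 = ?r6 / (a1 * a2 * a3 * a4)" (is "?f3_2 = _")
    unfolding defs using nz by (simp add: field_simps power2_eq_square)
  hence F3_2: "?f3_2 = 0" by (simp only: R6) simp
  have "X0 * a3 - X3 * a5 - Q * X8 * a2 = ?r4 / (a1 * a3 * a4 * a5)" (is "?f3_3 = _")
    unfolding defs using nz by (simp add: field_simps power2_eq_square)
  hence F3_3: "?f3_3 = 0" by (simp only: R4) simp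
  have F3_4: "X4 * a5 - X1 * a3 = 0" (is "?f3_4 = 0")
    unfolding defs using nz by (simp add: field_simps)
  have F3_5: "X4 * a4 - X5 * a5 = 0" (is "?f3_5 = 0")
    unfolding defs using nz by (simp add: field_simps)
  have "X3 * a3 - X5 * a4 - Q * X7 * a1 = ?r8 / (a1 * a2 * a3 * a5)" (is "?f3_6 = _")
    unfolding defs using nz by (simp add: field_simps power2_eq_square)
  hence F3_6: "?f3_6 = 0" by (simp only: R8) simp
  have "X4 * a3 - X1 * a2 - Q * X8 * a1 = ?r4 / (a2 * a3 * a4 * a5)" (is "?f3_7 = _")
    unfolding defs using nz by (simp add: field_simps power2_eq_square)
  hence F3_7: "?f3_7 = 0" by (simp only: R4) simp
  have F3_8: "Q * X9 * a1 - X8 * a5 = 0" (is "?f3_8 = 0")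
    unfolding defs using nz by (simp add: field_simps)
  have F3_10: "X10 * a5 - X9 * a4 = 0" (is "?f3_10 = 0")
    unfolding defs using nz by (simp add: field_simps)
  have F4_0: "Q * X5 * a2 - Q * X10 * a4 = 0" (is "?f4_0 = 0")
    unfolding defs using nz by (simp add: field_simps)
  have "X1 * a5 + Q * X9 * a3 - X0 * a4 = (- ?r0) / (a1 * a2 * a3 * a4)" (is "?f4_1 = _")
    unfolding defs using nz by (simp add: field_simps power2_eq_square)
  hence F4_1: "?f4_1 = 0" by (simp only: R0) simp
  have "X1 * a4 + Q * X3 * a1 - X2 * a5 = (- ?r6) / (a1 * a2 * a3 * a4)" (is "?f4_2 = _")
    unfolding defs using nz by (simp add: field_simps power2_eq_square)
  hence F4_2: "?f4_2 = 0" by (simp only: R6) simp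
  have F4_4: "X1 * a3 - X4 * a5 = 0" (is "?f4_4 = 0")
    unfolding defs using nz by (simp add: field_simps)
  have F4_5: "X5 * a5 - X4 * a4 = 0" (is "?f4_5 = 0")
    unfolding defs using nz by (simp add: field_simps)
  have "X7 * a5 + Q * X8 * a1 - X4 * a3 = (- ?r4) / (a2 * a3 * a4 * a5)" (is "?f4_7 = _")
    unfolding defs using nz by (simp add: field_simps power2_eq_square)
  hence F4_7: "?f4_7 = 0" by (simp only: R4) simp
  have "X5 * a3 + X8 * a5 - X2 * a2 = (- ?r8) / (a1 * a2 * a4 * a5)" (is "?f4_8 = _")
    unfolding defs using nz by (simp add: field_simps power2_eq_square)
  hence F4_8: "?f4_8 = 0" by (simp only: R8) simp
  have F4_9: "X8 * a4 - Q * X10 * a1 = 0" (is "?f4_9 = 0")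
    unfolding defs using nz by (simp add: field_simps)
  have F4_10: "X9 * a4 - X4 * a2 = 0" (is "?f4_10 = 0")
    unfolding defs using nz by (simp add: field_simps)
  have "X0 * a5 + 2 * Q ^ 2 * e3 * e5 - Q * X5 * a2 - Q * X8 * a3 - e0 * e0 = (- a2 * ?r4 + a4 * ?r6) / (a1 * a2 ^ 2 * a4 * a5)" (is "?f5_0 = _")
    unfolding defs using nz by (simp add: field_simps power2_eq_square)
  hence F5_0: "?f5_0 = 0" by (simp only: R4 R6) simp
  have "2 * e0 * e1 - 2 * X1 * a5 - 2 * Q * e4 * e5 = (2 * ?r0) / (a1 * a2 * a3 * a4)" (is "?f5_1 = _")
    unfolding defs using nz by (simp add: field_simps power2_eq_square)
  hence F5_1: "?f5_1 = 0" by (simp only: R0) simp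
  have "Q * X7 * a2 + Q * X10 * a3 + 2 * e0 * e2 - X1 * a4 - e1 * e1 = (- a1 * ?r0 - a2 * ?r8) / (a1 ^ 2 * a2 * a3 * a5)" (is "?f5_2 = _")
    unfolding defs using nz by (simp add: field_simps power2_eq_square)
  hence F5_2: "?f5_2 = 0" by (simp only: R0 R8) simp
  have "X2 * a4 + X3 * a5 + Q * X4 * a1 - 2 * e1 * e2 - Q * e5 * e5 = (a3 * ?r0 - a4 * ?r5) / (a1 * a2 * a3 * a4 ^ 2)" (is "?f5_3 = _")
    unfolding defs using nz by (simp add: field_simps power2_eq_square)
  hence F5_3: "?f5_3 = 0" by (simp only: R0 R5) simp
  have "X4 * a5 + 2 * Q * e0 * e3 - Q * X5 * a1 - Q * X9 * a2 - e2 * e2 = (a5 * ?r4 - Q * a3 * ?r8) / (a2 * a3 ^ 2 * a4 * a5)" (is "?f5_4 = _")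
    unfolding defs using nz by (simp add: field_simps power2_eq_square)
  hence F5_4: "?f5_4 = 0" by (simp only: R4 R8) simp
  have "X2 * a3 + X4 * a4 + Q * X10 * a2 - 2 * e0 * e4 - 2 * Q * e1 * e3 = ?r6 / (a1 * a2 * a4 * a5)" (is "?f5_5 = _")
    unfolding defs using nz by (simp add: field_simps power2_eq_square)
  hence F5_5: "?f5_5 = 0" by (simp only: R6) simp
  have "Q * X7 * a1 + 2 * e1 * e4 - X3 * a3 - X5 * a4 - 2 * Q * e2 * e3 = ?r8 / (a1 * a2 * a3 * a5)" (is "?f5_6 = _")
    unfolding defs using nz by (simp add: field_simps power2_eq_square)
  hence F5_6: "?f5_6 = 0" by (simp only: R8) simp
  have "X4 * a3 + Q * X8 * a1 + 2 * e2 * e4 - X7 * a5 - 2 * e0 * e5 = (- ?r4) / (a2 * a3 * a4 * a5)" (is "?f5_7 = _")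
    unfolding defs using nz by (simp add: field_simps power2_eq_square)
  hence F5_7: "?f5_7 = 0" by (simp only: R4) simp
  have "2 * e1 * e5 - X5 * a3 - X7 * a4 - X8 * a5 - Q * X9 * a1 - Q ^ 2 * e3 * e3 = (- a1 * a4 * ?r4 + 2 * Q * a1 *
      a2 * ?r5 + 2 * a2 * a5 * ?r6) / (a1 * a2 * a3 * a4 * a5 ^ 2)" (is "?f5_8 = _")
    unfolding defs using nz by (simp add: field_simps power2_eq_square)
  hence F5_8: "?f5_8 = 0" by (simp only: R4 R5 R6) simp
  have "2 * e2 * e5 + 2 * Q * e3 * e4 - X3 * a2 - X8 * a4 - X9 * a5 = (- ?r5) / (a1 * a3 * a4 * a5)" (is "?f5_9 = _")
    unfolding defs using nz by (simp add: field_simps power2_eq_square)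
  hence F5_9: "?f5_9 = 0" by (simp only: R5) simp
  have F5_10: "X4 * a2 - e4 * e4 = 0" (is "?f5_10 = 0")
    unfolding defs using nz by (simp add: field_simps)
  have "?d1 = ?f1_0 + p * ?f1_1 + p ^ 2 * ?f1_2 + p ^ 4 * ?f1_4 + p ^ 5 * ?f1_5 + p ^ 7 * ?f1_7 + p ^ 8 * ?f1_8 + p ^ 9 * ?f1_9 + p ^ 10 * ?f1_10"
    unfolding Q_def e4_def by algebra
  thus "?d1 = 0"
    unfolding F1_0 F1_1 F1_2 F1_4 F1_5 F1_7 F1_8 F1_9 F1_10 by simp
  have "?d2 = ?f2_0 + p ^ 2 * ?f2_2 + p ^ 3 * ?f2_3 + p ^ 4 * ?f2_4 + p ^ 5 * ?f2_5 + p ^ 6 * ?f2_6 + p ^ 7 * ?f2_7 + p ^ 9 * ?f2_9 + p ^ 10 * ?f2_10"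
    unfolding Q_def e4_def by algebra
  thus "?d2 = 0"
    unfolding F2_0 F2_2 F2_3 F2_4 F2_5 F2_6 F2_7 F2_9 F2_10 by simp
  have "?d3 = p * ?f3_1 + p ^ 2 * ?f3_2 + p ^ 3 * ?f3_3 + p ^ 4 * ?f3_4 + p ^ 5 * ?f3_5 + p ^ 6 * ?f3_6 + p ^ 7 *
      ?f3_7 + p ^ 8 * ?f3_8 + p ^ 10 * ?f3_10"
    unfolding Q_def e4_def by algebra
  thus "?d3 = 0"
    unfolding F3_1 F3_2 F3_3 F3_4 F3_5 F3_6 F3_7 F3_8 F3_10 by simp
  have "?d4 = ?f4_0 + p * ?f4_1 + p ^ 2 * ?f4_2 + p ^ 4 * ?f4_4 + p ^ 5 * ?f4_5 + p ^ 7 * ?f4_7 + p ^ 8 * ?f4_8 + p ^ 9 * ?f4_9 + p ^ 10 * ?f4_10"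
    unfolding Q_def e4_def by algebra
  thus "?d4 = 0"
    unfolding F4_0 F4_1 F4_2 F4_4 F4_5 F4_7 F4_8 F4_9 F4_10 by simp
  have "?d5 - ?s = ?f5_0 + p * ?f5_1 + p ^ 2 * ?f5_2 + p ^ 3 * ?f5_3 + p ^ 4 * ?f5_4 + p ^ 5 * ?f5_5 + p ^ 6 * ?f5_6
      + p ^ 7 * ?f5_7 + p ^ 8 * ?f5_8 + p ^ 9 * ?f5_9 + p ^ 10 * ?f5_10"
    unfolding Q_def e4_def by algebra
  thus "?d5 = ?s"
    unfolding F5_0 F5_1 F5_2 F5_3 F5_4 F5_5 F5_6 F5_7 F5_8 F5_9 F5_10 by simp
qed

subsection \<open>Eleventh roots of unity\<close>

definition root11 :: complex where "root11 = exp (2 * of_real pi * \<i> / 11)"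

lemma root11_power: "root11 ^ 11 = 1" "norm root11 = 1"
  using complex_root_unity[of 11 1] by (simp_all add: root11_def norm_exp_eq_Re)

lemma root11_filter: "(\<Sum>a<11. root11 ^ (a * m)) = (if 11 dvd m then 11 else 0)"
proof -
  have e: "root11 ^ m = exp (2 * of_real pi * \<i> * of_nat m / of_nat 11)"
    by (simp add: root11_def exp_of_nat_mult[symmetric] mult_ac)
  have one: "root11 ^ m = 1 \<longleftrightarrow> 11 dvd m"
    unfolding e by (subst complex_root_unity_eq_1) auto
  have "(\<Sum>a<11. root11 ^ (a * m)) = (\<Sum>a<11. (root11 ^ m) ^ a)"
    by (simp add: mult.commute flip: power_mult)
  also have "\<dots> = (if 11 dvd m then 11 else 0)"
  proof (cases "11 dvd m")
    case False
    have "(root11 ^ m) ^ 11 = (root11 ^ 11) ^ m" by (simp add: mult.commute flip: power_mult)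
    thus ?thesis using False one geometric_sum[of "root11 ^ m" 11] root11_power by simp
  next
    case True
    hence "root11 ^ m = 1" using one by simp
    thus ?thesis using True by simp
  qed
  finally show ?thesis .
qed

lemma dvd_11_shift:
  fixes m n :: nat
  assumes m: "m < 11"
  shows "11 dvd (11 - m + n) \<longleftrightarrow> n mod 11 = m"
proof -
  define r where "r = n mod 11"
  have r: "r < 11" by (simp add: r_def)
  have "(11 - m + n) mod 11 = (11 - m + r) mod 11" by (simp add: r_def mod_add_right_eq)
  also have "\<dots> = (if m \<le> r then r - m else 11 - m + r)"
  proof (cases "m \<le> r")
    case True
    hence "11 - m + r = 11 + (r - m)" using m by simp
    moreover have "(11 + (r - m)) mod 11 = (r - m) mod 11" by (rule mod_add_self1)
    moreover have "(r - m) mod 11 = r - m" using r by (intro mod_less) simp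
    ultimately show ?thesis using True by simp
  qed (use m in auto)
  finally show ?thesis using m r by (auto simp: dvd_eq_mod_eq_0 simp flip: r_def)
qed

definition sdiff :: "complex \<Rightarrow> nat \<Rightarrow> complex" where "sdiff z k = z ^ k - z ^ (11 - k)"

text \<open>Finite Fourier inversion: weighting the values at the powers of \<open>root11\<close>
  isolates \<open>u b\<close>. The exponents 11 - k do not interfere, as k + b lies strictly between
  0 and 11.\<close>

lemma sdiff_independent:
  assumes "\<And>z. z ^ 11 = 1 \<Longrightarrow> (\<Sum>k=1..5. u k * sdiff z k) = 0" and b: "b \<in> {1..5}"
  shows "u b = 0"
proof -
  have "0 = (\<Sum>a<11. root11 ^ (a * (11 - b)) * (\<Sum>k=1..5. u k * sdiff (root11 ^ a) k))"
  proof -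
    have "(root11 ^ a) ^ 11 = 1" for a
      by (metis mult.commute power_mult power_one root11_power(1))
    thus ?thesis using assms(1) by simp
  qed
  also have "\<dots> = (\<Sum>a<11. \<Sum>k=1..5. u k * (root11 ^ (a * (11 - b + k)) - root11 ^ (a * (11 - b + (11 - k)))))"
  proof (subst sum_distrib_left, intro sum.cong refl)
    fix a k :: nat
    have "A * (x * (B - C)) = x * (A * B - A * C)" for A B C x :: complex by algebra
    thus "root11 ^ (a * (11 - b)) * (u k * sdiff (root11 ^ a) k) =
        u k * (root11 ^ (a * (11 - b + k)) - root11 ^ (a * (11 - b + (11 - k))))"
      by (simp only: sdiff_def power_mult[symmetric] distrib_left power_add)
  qed
  also have "\<dots> = (\<Sum>k=1..5. u k * ((\<Sum>a<11. root11 ^ (a * (11 - b + k))) - (\<Sum>a<11. root11 ^ (a * (11 - b + (11 - k))))))"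
    by (subst sum.swap, intro sum.cong refl) (simp only: sum_distrib_left[symmetric] sum_subtractf)
  also have "\<dots> = (\<Sum>k=1..5. if k = b then 11 * u k else 0)"
  proof (intro sum.cong refl)
    fix k :: nat assume k: "k \<in> {1..5}"
    have "11 dvd (11 - b + k) \<longleftrightarrow> k = b" "\<not> 11 dvd (11 - b + (11 - k))"
      using b k by (subst dvd_11_shift; auto)+
    thus "u k * ((\<Sum>a<11. root11 ^ (a * (11 - b + k))) - (\<Sum>a<11. root11 ^ (a * (11 - b + (11 - k))))) =
        (if k = b then 11 * u k else 0)"
      unfolding root11_filter by simp
  qed
  also have "\<dots> = 11 * u b" using b by simp
  finally show ?thesis by simp
qed

text \<open>Averaging over p -> root11^j p keeps exactly the exponents congruent to m; the weight
  exponent 11 - m stands for -m.\<close>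

lemma section_series:
  fixes c :: "nat \<Rightarrow> complex"
  assumes sm: "\<And>x. norm x < 1 \<Longrightarrow> summable (\<lambda>n. c n * x ^ n)" and p: "p \<noteq> 0" "norm p < 1" and m: "m < 11"
  shows "(\<Sum>j<11. root11 ^ (j * (11 - m)) * (\<Sum>n. c n * (root11 ^ j * p) ^ n)) = 11 * p ^ m * (\<Sum>n. c (11 * n + m) * (p ^ 11) ^ n)"
proof -
  have np: "norm (root11 ^ j * p) < 1" for j using p root11_power by (simp add: norm_mult norm_power)
  have "(\<lambda>n. \<Sum>j<11. root11 ^ (j * (11 - m)) * (c n * (root11 ^ j * p) ^ n)) sums
      (\<Sum>j<11. root11 ^ (j * (11 - m)) * (\<Sum>n. c n * (root11 ^ j * p) ^ n))"
    by (intro sums_sum sums_mult summable_sums sm np)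
  also have "(\<lambda>n. \<Sum>j<11. root11 ^ (j * (11 - m)) * (c n * (root11 ^ j * p) ^ n)) =
      (\<lambda>n. if n mod 11 = m then 11 * (c n * p ^ n) else 0)"
  proof
    fix n
    have "(\<Sum>j<11. root11 ^ (j * (11 - m)) * (c n * (root11 ^ j * p) ^ n)) = c n * p ^ n * (\<Sum>j<11. root11 ^ (j * (11 - m + n)))"
      by (simp add: sum_distrib_left power_mult_distrib power_add algebra_simps flip: power_mult)
    moreover have "11 dvd (11 - m + n) \<longleftrightarrow> n mod 11 = m" by (rule dvd_11_shift[OF m])
    ultimately show "(\<Sum>j<11. root11 ^ (j * (11 - m)) * (c n * (root11 ^ j * p) ^ n)) = (if n mod 11 = m then 11 * (c n * p ^ n) else 0)"
      by (simp add: root11_filter)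
  qed
  finally have "(\<lambda>n. if n mod 11 = m then 11 * (c n * p ^ n) else 0) sums
      (\<Sum>j<11. root11 ^ (j * (11 - m)) * (\<Sum>n. c n * (root11 ^ j * p) ^ n))" .
  hence "(\<lambda>n. if (11 * n + m) mod 11 = m then 11 * (c (11 * n + m) * p ^ (11 * n + m)) else 0) sums
      (\<Sum>j<11. root11 ^ (j * (11 - m)) * (\<Sum>n. c n * (root11 ^ j * p) ^ n))"
  proof (subst sums_mono_reindex)
    show "strict_mono (\<lambda>n. 11 * n + m)" by (auto simp: strict_mono_def)
    fix n assume "n \<notin> range (\<lambda>n. 11 * n + m)"
    moreover have "n = 11 * (n div 11) + m" if "n mod 11 = m" using that by presburger
    ultimately show "(if n mod 11 = m then 11 * (c n * p ^ n) else 0) = 0" by auto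
  qed
  hence "(\<lambda>n. 11 * p ^ m * (c (11 * n + m) * (p ^ 11) ^ n)) sums
      (\<Sum>j<11. root11 ^ (j * (11 - m)) * (\<Sum>n. c n * (root11 ^ j * p) ^ n))"
    using m by (simp add: power_add mult_ac flip: power_mult)
  moreover have "summable (\<lambda>n. c (11 * n + m) * (p ^ 11) ^ n)"
    using summable_mult[OF sums_summable[OF calculation], of "1 / (11 * p ^ m)"] p by (simp add: field_simps)
  ultimately show ?thesis using sums_unique2 sums_mult[OF summable_sums] by blast
qed

subsection \<open>Dissection of the crank generating function\<close>

text \<open>The 11-dissection of the crank product at an eleventh root of unity \<open>z\<close>: row \<open>i\<close> of \<open>cyc\<close> lists the
coefficients of \<open>1\<close> and \<open>z^t + z^(-t)\<close>, \<open>t = 1,...,5\<close>, in the component of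
    \<open>p^i\<close>, and \<open>crank_part i\<close> is the
theta quotient they multiply.\<close>

definition cyc :: "nat \<Rightarrow> nat \<Rightarrow> int" where
  "cyc i t = [[1, 0, 0, 0, 0, 0], [-1, 1, 0, 0, 0, 0], [0, 0, 1, 0, 0, 0], [1, 0, 0, 1, 0, 0], [1, 0, 1, 0, 1, 0],
      [0, 0, -1, 0, -1, 0], [0, 0, 0, 0, 0, 0], [0, 1, 0, 0, 1, 0], [0, 1, 0, 1, 1, 0], [-1, 0, 0, 0, -1, 0], [0, 0, 0, -1, 0, 0]] ! i ! t"

definition cyc_poly :: "nat \<Rightarrow> complex \<Rightarrow> complex" where
  "cyc_poly i z = of_int (cyc i 0) + (\<Sum>t=1..5. of_int (cyc i t) * (z ^ t + z ^ (11 - t)))"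

text \<open>In (z^t + z^(-t))(z^r - z^(-r)) the function \<open>sdiff z k\<close> arises with sign +
  from t = |k - r| and with sign - from t = r + k, folded to 11 - (r + k) when it exceeds 5.\<close>

definition cyc_conv :: "nat \<Rightarrow> nat \<Rightarrow> nat \<Rightarrow> int" where
  "cyc_conv i r k = cyc i (if r \<le> k then k - r else r - k) - cyc i (if r + k \<le> 5 then r + k else 11 - (r + k))"

lemma atLeastAtMost_1_5: "{1..5::nat} = {1,2,3,4,5}" and atLeastAtMost_1_10: "{1..10::nat} = {1,2,3,4,5,6,7,8,9,10}"
  by (rule set_eqI, simp, presburger)+

lemma sum_1_5: "(\<Sum>k=1..5::nat. f k) = f 1 + f 2 + f 3 + f 4 + (f 5 :: complex)"
  by (simp add: atLeastAtMost_1_5 del: One_nat_def)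

lemma cyc_poly_mult_sdiff:
  assumes z: "z ^ 11 = 1" and r: "r \<in> {1..5}"
  shows "cyc_poly i z * sdiff z r = (\<Sum>k=1..5. of_int (cyc_conv i r k) * sdiff z k)"
proof -
  have pair: "(z ^ t + z ^ (11 - t)) * sdiff z r =
      (if r + t \<le> 5 then sdiff z (r + t) else - sdiff z (11 - (r + t))) + (if t \<le> r then sdiff z (r - t) else - sdiff z (t - r))"
    if t: "t \<in> {1..5}" for t
  proof -
    have e0: "(z ^ t + z ^ (11 - t)) * sdiff z r = (z ^ (r + t) - z ^ (11 - t + (11 - r))) + (z ^ (11 - t + r) - z ^ (t + (11 - r)))"
      by (simp only: sdiff_def power_add) algebra
    have e1: "z ^ (11 - t + (11 - r)) = z ^ (11 - (r + t))"
    proof -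
      have "11 - t + (11 - r) = 11 + (11 - (r + t))" using r t by auto
      thus ?thesis using z by (simp only: power_add mult_1)
    qed
    have e2: "z ^ (11 - t + r) = (if t \<le> r then z ^ (r - t) else z ^ (11 - (t - r)))"
    proof (cases "t \<le> r")
      case True
      have "11 - t + r = 11 + (r - t)" using True r t by auto
      thus ?thesis using True z by (simp only: power_add mult_1 if_True)
    qed (use r t in auto)
    have e3: "z ^ (t + (11 - r)) = (if t \<le> r then z ^ (11 - (r - t)) else z ^ (t - r))"
    proof (cases "t \<le> r")
      case False
      have "t + (11 - r) = 11 + (t - r)" using False r t by auto
      thus ?thesis using False z by (simp only: power_add mult_1 if_False)
    next
      case True
      have "t + (11 - r) = 11 - (r - t)" using True r t by auto
      thus ?thesis using True by (simp only: if_True)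
    qed
    have e4: "11 - (11 - (r + t)) = r + t" using r t by auto
    show ?thesis
      unfolding e0 e1 e2 e3
      by (cases "t \<le> r"; cases "r + t \<le> 5"; simp only: if_True if_False sdiff_def e4 minus_diff_eq)
  qed
  have s0: "sdiff z 0 = 0" using z by (simp add: sdiff_def)
  have "cyc_poly i z * sdiff z r = of_int (cyc i 0) * sdiff z r + (\<Sum>t=1..5. of_int (cyc i t) * ((z ^ t + z ^ (11 - t)) * sdiff z r))"
    by (simp only: cyc_poly_def distrib_right sum_distrib_right mult.assoc)
  also have "(\<Sum>t=1..5. of_int (cyc i t) * ((z ^ t + z ^ (11 - t)) * sdiff z r)) =
      (\<Sum>t=1..5. of_int (cyc i t) * ((if r + t \<le> 5 then sdiff z (r + t) else - sdiff z (11 - (r + t)))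
         + (if t \<le> r then sdiff z (r - t) else - sdiff z (t - r))))"
    by (intro sum.cong refl) (simp only: pair)
  also have "of_int (cyc i 0) * sdiff z r + \<dots> = (\<Sum>k=1..5. of_int (cyc_conv i r k) * sdiff z k)"
  proof -
    from r consider "r = 1" | "r = 2" | "r = 3" | "r = 4" | "r = 5" by fastforce
    thus ?thesis
      unfolding cyc_conv_def atLeastAtMost_1_5 by cases (simp_all add: s0 numeral_2_eq_2[symmetric] algebra_simps)
  qed
  finally show ?thesis .
qed

definition crank_part :: "nat \<Rightarrow> complex \<Rightarrow> complex" where
  "crank_part i Q = (let a = (\<lambda>k. J2 k 11 Q) in
     [1 / a 1, a 5 / (a 2 * a 3), a 3 / (a 1 * a 4), a 2 / (a 1 * a 3), 1 / a 2, a 4 / (a 2 * a 5), 0,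
      1 / a 3, Q * a 1 / (a 4 * a 5), 1 / a 4, 1 / a 5] ! i)"

text \<open>Eight instances of \<open>J2_three_term\<close>, with indices above 5 folded back by
  reflection.\<close>

lemma level11_relations:
  assumes Q: "Q \<noteq> 0" "norm Q < 1"
  defines "a1 \<equiv> J2 1 11 Q" and "a2 \<equiv> J2 2 11 Q" and "a3 \<equiv> J2 3 11 Q" and "a4 \<equiv> J2 4 11 Q" and "a5 \<equiv> J2 5 11 Q"
  shows "a2 * a3 * a4 ^ 2 - a1 * a4 * a5 ^ 2 - Q * a1 * a2 * a3 ^ 2 = 0"
    and "a3 * a4 ^ 3 - a2 * a5 ^ 3 - Q ^ 2 * a1 * a2 ^ 3 = 0"
    and "a4 ^ 3 * a5 - a3 * a5 ^ 3 - Q ^ 3 * a1 ^ 3 * a2 = 0"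
    and "a3 ^ 3 * a4 - a1 * a5 ^ 3 - Q * a2 ^ 3 * a3 = 0"
    and "a3 ^ 2 * a4 * a5 - a2 * a4 * a5 ^ 2 - Q ^ 2 * a1 ^ 2 * a2 * a3 = 0"
    and "a2 ^ 2 * a4 * a5 - a1 * a3 * a5 ^ 2 - Q * a1 ^ 2 * a3 * a4 = 0"
    and "a2 * a3 ^ 2 * a5 - a1 * a4 ^ 2 * a5 - Q * a1 * a2 ^ 2 * a4 = 0"
    and "a2 ^ 2 * a3 * a5 - a1 * a3 * a4 ^ 2 - Q * a1 ^ 2 * a2 * a5 = 0"
proof -
  have refl: "J2 6 11 Q = a5" "J2 7 11 Q = a4" "J2 8 11 Q = a3" "J2 9 11 Q = a2" "J2 10 11 Q = a1"
    using J2_reflect[of 1 Q] J2_reflect[of 2 Q] J2_reflect[of 3 Q] J2_reflect[of 4 Q] J2_reflect[of 5 Q]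
    by (simp_all add: a1_def a2_def a3_def a4_def a5_def)
  note fold = a1_def[symmetric] a2_def[symmetric] a3_def[symmetric] a4_def[symmetric] a5_def[symmetric]
  show "a2 * a3 * a4 ^ 2 - a1 * a4 * a5 ^ 2 - Q * a1 * a2 * a3 ^ 2 = 0"
    using J2_three_term[OF Q, of 3 4 5, simplified] unfolding refl fold One_nat_def[symmetric] Suc_1 by (simp add: fold) algebra
  show "a3 * a4 ^ 3 - a2 * a5 ^ 3 - Q ^ 2 * a1 * a2 ^ 3 = 0"
    using J2_three_term[OF Q, of 2 4 5, simplified] unfolding refl fold One_nat_def[symmetric] Suc_1 by (simp add: fold) algebra
  show "a4 ^ 3 * a5 - a3 * a5 ^ 3 - Q ^ 3 * a1 ^ 3 * a2 = 0"
    using J2_three_term[OF Q, of 1 4 5, simplified] unfolding refl fold One_nat_def[symmetric] Suc_1 by (simp add: fold) algebra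
  show "a3 ^ 3 * a4 - a1 * a5 ^ 3 - Q * a2 ^ 3 * a3 = 0"
    using J2_three_term[OF Q, of 2 3 5, simplified] unfolding refl fold One_nat_def[symmetric] Suc_1 by (simp add: fold) algebra
  show "a3 ^ 2 * a4 * a5 - a2 * a4 * a5 ^ 2 - Q ^ 2 * a1 ^ 2 * a2 * a3 = 0"
    using J2_three_term[OF Q, of 1 3 5, simplified] unfolding refl fold One_nat_def[symmetric] Suc_1 by (simp add: fold) algebra
  show "a2 ^ 2 * a4 * a5 - a1 * a3 * a5 ^ 2 - Q * a1 ^ 2 * a3 * a4 = 0"
    using J2_three_term[OF Q, of 1 2 5, simplified] unfolding refl fold One_nat_def[symmetric] Suc_1 by (simp add: fold) algebra
  show "a2 * a3 ^ 2 * a5 - a1 * a4 ^ 2 * a5 - Q * a1 * a2 ^ 2 * a4 = 0"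
    using J2_three_term[OF Q, of 2 3 4, simplified] unfolding refl fold One_nat_def[symmetric] Suc_1 by (simp add: fold) algebra
  show "a2 ^ 2 * a3 * a5 - a1 * a3 * a4 ^ 2 - Q * a1 ^ 2 * a2 * a5 = 0"
    using J2_three_term[OF Q, of 1 2 4, simplified] unfolding refl fold One_nat_def[symmetric] Suc_1 by (simp add: fold) algebra
qed

text \<open>Both sides are multiplied by theta(z; p), which is nonzero as z \<noteq> 1; the left
  side becomes (1 - z)(p;p)^2, and only known dissections have to be multiplied out. The empty
  component i = 6 reflects the equidistribution of the crank modulo 11 on partitions of 11n +
  6.\<close>

lemma crank_prod_dissection:
  assumes p: "p \<noteq> 0" "norm p < 1" and z: "z ^ 11 = 1" "z \<noteq> 1"
  shows "crank_prod z p = J1 11 (p ^ 11) ^ 2 * (\<Sum>i<11. p ^ i * crank_part i (p ^ 11) * cyc_poly i z)"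
proof -
  define Q where "Q = p ^ 11"
  have Q: "Q \<noteq> 0" "norm Q < 1" using p by (simp_all add: Q_def norm_power power_less_one_iff)
  define a where "a = (\<lambda>k. J2 k 11 Q)"
  have a: "a 1 \<noteq> 0" "a 2 \<noteq> 0" "a 3 \<noteq> 0" "a 4 \<noteq> 0" "a 5 \<noteq> 0"
    unfolding a_def by (intro J2_nonzero Q; simp)+
  have z0: "z \<noteq> 0" using z by auto
  have nz: "norm z = 1"
    using z by (metis norm_ge_zero norm_one norm_power power_eq_imp_eq_base power_one zero_le_one zero_less_numeral)
  have np: "norm (p / z) < 1" "norm (z * p) < 1" using p nz by (simp_all add: norm_mult norm_divide)
  have th: "crank_prod z p * theta z p = (1 - z) * qpoch_inf p p ^ 2"
    using triple_product[OF p(2,1) z0] qpoch_split[OF p(2), of z 1] qpoch_nonzero'[OF p(2) np(1)] qpoch_nonzero'[OF p(2) np(2)]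
    by (simp add: crank_prod_def power2_eq_square)
  have th0: "theta z p \<noteq> 0"
    using triple_product[OF p(2,1) z0] qpoch_split[OF p(2), of z 1] qpoch_nonzero'[OF p(2) np(1)] qpoch_nonzero'[OF p(2) np(2)]
      qpoch_nonzero'[OF p(2) p(2)] z by simp
  \<comment> \<open>Splitting off z^6 makes theta(z; p) a combination of the odd functions
    \<open>sdiff z r\<close>. The same factor turns \<open>sdiff z 5\<close> into 1 - z, so the
    target is a multiple of a single basis function.\<close>
  define y where "y = (\<lambda>r. [0, p ^ 10 * a 1, - (p ^ 6) * a 2, p ^ 3 * a 3, - p * a 4, a 5] ! r)"
  have red: "z ^ 12 = z" "z ^ 13 = z ^ 2" "z ^ 14 = z ^ 3" "z ^ 15 = z ^ 4" "z ^ 16 = z ^ 5"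
    using z power_add[of z 11 1] power_add[of z 11 2] power_add[of z 11 3] power_add[of z 11 4] power_add[of z 11 5] by simp_all
  have sd: "z ^ 6 * sdiff z 1 = z ^ 7 - z ^ 5" "z ^ 6 * sdiff z 2 = z ^ 8 - z ^ 4" "z ^ 6 * sdiff z 3 = z ^ 9 - z ^ 3"
     "z ^ 6 * sdiff z 4 = z ^ 10 - z ^ 2" "z ^ 6 * sdiff z 5 = 1 - z"
    using z red by (simp_all add: sdiff_def right_diff_distrib flip: power_add power_Suc power_Suc2)
  have "z ^ 6 * (\<Sum>r=1..5. sdiff z r * y r) = (\<Sum>r=1..5. (z ^ 6 * sdiff z r) * y r)"
    by (simp only: sum_distrib_left mult.assoc)
  also have "\<dots> = theta z p"
    unfolding theta_root_dissection[OF p z(1)] Q_def[symmetric] sum_1_5 sd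
    by (simp add: y_def a_def algebra_simps)
  finally have ty: "theta z p = z ^ 6 * (\<Sum>r=1..5. sdiff z r * y r)" by simp
  define X where "X = (\<lambda>i. crank_part i Q)"
  define W where "W = (\<lambda>k. \<Sum>i<11. \<Sum>r=1..5. of_int (cyc_conv i r k) * (p ^ i * X i * y r))"
  have Jk: "J2 k 11 Q = a k" for k by (simp add: a_def)
  have X: "1 / a 1 = X 0" "a 5 / (a 2 * a 3) = X 1" "a 3 / (a 1 * a 4) = X 2" "a 2 / (a 1 * a 3) = X 3" "1 / a 2 = X 4"
    "a 4 / (a 2 * a 5) = X 5" "1 / a 3 = X 7" "Q * a 1 / (a 4 * a 5) = X 8" "1 / a 4 = X 9" "1 / a 5 = X 10" and X6: "X 6 = 0"
    by (simp_all add: X_def crank_part_def Jk)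
  note rel = level11_relations[OF Q, unfolded Jk]
  note alg = crank_dissection_algebra[OF a, of p, folded Q_def, OF rel(1,5,6,7,8), unfolded X]
  have W1: "W 1 = 0"
    by (rule trans[OF _ alg(1)], unfold W_def Q_def lessThan_11 sum_1_5) (simp add: cyc_conv_def cyc_def y_def X6, algebra)
  have W2: "W 2 = 0"
    by (rule trans[OF _ alg(2)], unfold W_def Q_def lessThan_11 sum_1_5) (simp add: cyc_conv_def cyc_def y_def X6, algebra)
  have W3: "W 3 = 0"
    by (rule trans[OF _ alg(3)], unfold W_def Q_def lessThan_11 sum_1_5) (simp add: cyc_conv_def cyc_def y_def X6, algebra)
  have W4: "W 4 = 0"
    by (rule trans[OF _ alg(4)], unfold W_def Q_def lessThan_11 sum_1_5) (simp add: cyc_conv_def cyc_def y_def X6, algebra)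
  have W5: "W 5 = (a 4 / a 2 - p * (a 2 / a 1) - p ^ 2 * (a 5 / a 3) - p ^ 15 * (a 1 / a 5) + p ^ 5 * 1 + p ^ 7 * (a 3 / a 4)) ^ 2"
    by (rule trans[OF _ alg(5)], unfold W_def Q_def lessThan_11 sum_1_5) (simp add: cyc_conv_def cyc_def y_def X6, algebra)
  note W = W1 W2 W3 W4 W5
  have "(\<Sum>i<11. p ^ i * crank_part i Q * cyc_poly i z) * theta z p =
      z ^ 6 * (\<Sum>i<11. \<Sum>r=1..5. p ^ i * crank_part i Q * y r * (cyc_poly i z * sdiff z r))"
    unfolding ty sum_product mult.left_commute[of _ "z ^ 6"] by (simp add: mult_ac)
  also have "(\<Sum>i<11. \<Sum>r=1..5. p ^ i * crank_part i Q * y r * (cyc_poly i z * sdiff z r)) =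
      (\<Sum>i<11. \<Sum>r=1..5. \<Sum>k=1..5. of_int (cyc_conv i r k) * (p ^ i * crank_part i Q * y r) * sdiff z k)"
    by (intro sum.cong refl) (simp only: cyc_poly_mult_sdiff[OF z(1)] sum_distrib_left mult_ac)
  also have "\<dots> = (\<Sum>i<11. \<Sum>k=1..5. \<Sum>r=1..5. of_int (cyc_conv i r k) * (p ^ i * crank_part i Q * y r) * sdiff z k)"
    by (rule sum.cong[OF refl], rule sum.swap)
  also have "\<dots> = (\<Sum>k=1..5. \<Sum>i<11. \<Sum>r=1..5. of_int (cyc_conv i r k) * (p ^ i * crank_part i Q * y r) * sdiff z k)"
    by (rule sum.swap)
  also have "\<dots> = (\<Sum>k=1..5. W k * sdiff z k)"
    by (simp only: W_def X_def sum_distrib_right)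
  also have "z ^ 6 * \<dots> = W 5 * (1 - z)"
    unfolding sd(5)[symmetric] atLeastAtMost_1_5 using W by simp
  finally have "J1 11 Q ^ 2 * (\<Sum>i<11. p ^ i * crank_part i Q * cyc_poly i z) * theta z p = crank_prod z p * theta z p"
    unfolding th qpoch_dissection[OF p] Q_def[symmetric] Jk W(5)
    by (simp add: power_mult_distrib)
  thus ?thesis using th0 by (simp add: Q_def)
qed

subsection \<open>Residue classes of the weighted crank differences\<close>

text \<open>Both sides of \<open>crank_diff_gf\<close> are expanded in \<open>sdiff z k\<close> and
  compared for all z with z^11 = 1. At z = 1, which the crank dissection excludes, every
  \<open>sdiff\<close> is 0.\<close>

lemma crank_diff_expansion:
  assumes p: "p \<noteq> 0" "norm p < 1" and k: "k \<in> {1..5}"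
  defines "Q \<equiv> p ^ 11"
  shows "(\<Sum>n. crank_diff k n * p ^ n) = - (J1 11 Q ^ 2) *
    (\<Sum>i<11. \<Sum>r=1..5. of_int (cyc_conv i r k) * crank_part i Q *
       (p ^ i * eis (Q ^ r) (Q ^ 11) + (\<Sum>s=1..10. p ^ (i + r * s) * kron (Q ^ s) (Q ^ r) (Q ^ 11))))"
proof -
  define G where "G = (\<lambda>r. eis (Q ^ r) (Q ^ 11) + (\<Sum>s=1..10. p ^ (r * s) * kron (Q ^ s) (Q ^ r) (Q ^ 11)))"
  define D where "D = (\<lambda>k. \<Sum>n. crank_diff k n * p ^ n)"
  define H where "H = (\<lambda>k. \<Sum>i<11. \<Sum>r=1..5. of_int (cyc_conv i r k) * (p ^ i * crank_part i Q * G r))"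
  have "D k + J1 11 Q ^ 2 * H k = 0"
  proof (rule sdiff_independent[where u = "\<lambda>k. D k + J1 11 Q ^ 2 * H k", OF _ k])
    fix z :: complex assume z: "z ^ 11 = 1"
    show "(\<Sum>k=1..5. (D k + J1 11 Q ^ 2 * H k) * sdiff z k) = 0"
    proof (cases "z = 1")
      case True thus ?thesis by (simp add: sdiff_def)
    next
      case False
      have nz: "norm z = 1"
        using z by (metis norm_ge_zero norm_one norm_power power_eq_imp_eq_base power_one zero_le_one zero_less_numeral)
      have "(\<Sum>k=1..5. D k * sdiff z k) = crank_prod z p * (lambert (p / z) p - lambert (p * z) p)"
        unfolding D_def sdiff_def by (rule crank_diff_gf[OF p z])
      also have "lambert (p / z) p - lambert (p * z) p = - (\<Sum>r=1..5. sdiff z r * G r)"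
        unfolding lambert_difference[OF p z nz] sdiff_def G_def Q_def ..
      also have "crank_prod z p * - (\<Sum>r=1..5. sdiff z r * G r) =
          - (J1 11 Q ^ 2) * ((\<Sum>i<11. p ^ i * crank_part i Q * cyc_poly i z) * (\<Sum>r=1..5. sdiff z r * G r))"
        unfolding crank_prod_dissection[OF p z False] Q_def by simp
      also have "(\<Sum>i<11. p ^ i * crank_part i Q * cyc_poly i z) * (\<Sum>r=1..5. sdiff z r * G r) =
          (\<Sum>i<11. \<Sum>r=1..5. p ^ i * crank_part i Q * G r * (cyc_poly i z * sdiff z r))"
        unfolding sum_product by (simp add: mult_ac)
      also have "\<dots> = (\<Sum>i<11. \<Sum>r=1..5. \<Sum>k=1..5. of_int (cyc_conv i r k) * (p ^ i * crank_part i Q * G r) * sdiff z k)"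
        by (intro sum.cong refl) (simp only: cyc_poly_mult_sdiff[OF z] sum_distrib_left mult_ac)
      also have "\<dots> = (\<Sum>i<11. \<Sum>k=1..5. \<Sum>r=1..5. of_int (cyc_conv i r k) * (p ^ i * crank_part i Q * G r) * sdiff z k)"
        by (rule sum.cong[OF refl], rule sum.swap)
      also have "\<dots> = (\<Sum>k=1..5. \<Sum>i<11. \<Sum>r=1..5. of_int (cyc_conv i r k) * (p ^ i * crank_part i Q * G r) * sdiff z k)"
        by (rule sum.swap)
      also have "\<dots> = (\<Sum>k=1..5. H k * sdiff z k)"
        by (simp only: H_def sum_distrib_right)
      finally have "(\<Sum>k=1..5. D k * sdiff z k) + J1 11 Q ^ 2 * (\<Sum>k=1..5. H k * sdiff z k) = 0" by simp
      moreover have "(\<Sum>k=1..5. (D k + J1 11 Q ^ 2 * H k) * sdiff z k) =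
          (\<Sum>k=1..5. D k * sdiff z k) + J1 11 Q ^ 2 * (\<Sum>k=1..5. H k * sdiff z k)"
        by (simp only: distrib_right sum.distrib sum_distrib_left mult.assoc)
      ultimately show ?thesis by simp
    qed
  qed
  hence "D k = - (J1 11 Q ^ 2) * H k" by (simp add: add_eq_0_iff)
  moreover have "p ^ i * crank_part i Q * G r = crank_part i Q *
       (p ^ i * eis (Q ^ r) (Q ^ 11) + (\<Sum>s=1..10. p ^ (i + r * s) * kron (Q ^ s) (Q ^ r) (Q ^ 11)))" for i r
    by (simp add: G_def power_add sum_distrib_left algebra_simps)
  ultimately show ?thesis unfolding D_def H_def by (simp only: mult.assoc)
qed

text \<open>All points root11^j p have the same eleventh power Q, so the averaging acts only on the
  explicit powers of p. The \<open>eis\<close> terms carry p^i alone and survive just for i =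
  m.\<close>

lemma f11_expansion_aux:
  assumes p: "p \<noteq> 0" "norm p < 1" and k: "k \<in> {1..5}" and m: "m < 11"
  defines "Q \<equiv> p ^ 11"
  shows "f11 m (int k) Q = - (J1 11 Q ^ 2) *
    (\<Sum>i<11. \<Sum>r=1..5. of_int (cyc_conv i r k) * crank_part i Q *
       ((if i = m then eis (Q ^ r) (Q ^ 11) else 0) +
        (\<Sum>s=1..10. if (i + r * s) mod 11 = m then Q ^ ((i + r * s) div 11) * kron (Q ^ s) (Q ^ r) (Q ^ 11) else 0)))"
proof -
  have pj: "root11 ^ j * p \<noteq> 0" "norm (root11 ^ j * p) < 1" "(root11 ^ j * p) ^ 11 = Q" for j
  proof -
    have "(root11 ^ j) ^ 11 = 1" by (metis mult.commute power_mult power_one root11_power(1))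
    thus "(root11 ^ j * p) ^ 11 = Q" by (simp add: Q_def power_mult_distrib)
    show "norm (root11 ^ j * p) < 1" using p root11_power by (simp add: norm_mult norm_power)
    have "root11 \<noteq> 0" using root11_power by auto
    thus "root11 ^ j * p \<noteq> 0" using p by simp
  qed
  have sec: "(\<Sum>j<11. root11 ^ (j * (11 - m)) * (root11 ^ j * p) ^ e) = 11 * p ^ m * (if e mod 11 = m then Q ^ (e div 11) else 0)" for e
  proof -
    have "(\<Sum>j<11. root11 ^ (j * (11 - m)) * (root11 ^ j * p) ^ e) = p ^ e * (\<Sum>j<11. root11 ^ (j * (11 - m + e)))"
      by (simp add: sum_distrib_left power_mult_distrib power_add algebra_simps flip: power_mult)
    also have "\<dots> = (if e mod 11 = m then 11 * p ^ e else 0)"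
      unfolding root11_filter dvd_11_shift[OF m] by simp
    also have "p ^ e = Q ^ (e div 11) * p ^ (e mod 11)"
      by (simp add: Q_def flip: power_mult power_add)
    finally show ?thesis by (auto simp: mult_ac)
  qed
  define c where "c = (\<lambda>i r. of_int (cyc_conv i r k) * crank_part i Q)"
  define E where "E = (\<lambda>r. eis (Q ^ r) (Q ^ 11))"
  define K where "K = (\<lambda>r s. kron (Q ^ s) (Q ^ r) (Q ^ 11))"
  define A where "A = (\<lambda>e. if e mod 11 = m then Q ^ (e div 11) else 0)"
  have "11 * p ^ m * f11 m (int k) Q = (\<Sum>j<11. root11 ^ (j * (11 - m)) * (\<Sum>n. crank_diff k n * (root11 ^ j * p) ^ n))"
  proof -
    have "f11 m (int k) Q = (\<Sum>n. crank_diff k (11 * n + m) * (p ^ 11) ^ n)"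
      by (simp only: f11_def crank_diff_def Q_def)
    thus ?thesis by (simp only: section_series[of "crank_diff k", OF crank_diff_summable p m])
  qed
  also have "\<dots> = (\<Sum>j<11. root11 ^ (j * (11 - m)) * (- (J1 11 Q ^ 2) * (\<Sum>i<11. \<Sum>r=1..5. c i r *
       ((root11 ^ j * p) ^ i * E r + (\<Sum>s=1..10. (root11 ^ j * p) ^ (i + r * s) * K r s)))))"
    by (intro sum.cong refl) (simp only: crank_diff_expansion[OF pj(1,2) k] pj(3) c_def E_def K_def)
  also have "\<dots> = - (J1 11 Q ^ 2) * (\<Sum>i<11. \<Sum>r=1..5. c i r *
      ((\<Sum>j<11. root11 ^ (j * (11 - m)) * (root11 ^ j * p) ^ i) * E r +
       (\<Sum>s=1..10. (\<Sum>j<11. root11 ^ (j * (11 - m)) * (root11 ^ j * p) ^ (i + r * s)) * K r s)))"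
  proof -
    have sw: "(\<Sum>j<11. w j * (C * (\<Sum>i<11. \<Sum>r=1..5. c i r * (q j i * E r + (\<Sum>s=1..10. q j (i + r * s) * K r s))))) =
       C * (\<Sum>i<11. \<Sum>r=1..5. c i r * ((\<Sum>j<11. w j * q j i) * E r + (\<Sum>s=1..10. (\<Sum>j<11. w j * q j (i + r * s)) * K r s)))"
      for w :: "nat \<Rightarrow> complex" and q :: "nat \<Rightarrow> nat \<Rightarrow> complex" and C
    proof -
      have "(\<Sum>j<11. w j * (C * (\<Sum>i<11. \<Sum>r=1..5. c i r * (q j i * E r + (\<Sum>s=1..10. q j (i + r * s) * K r s))))) =
        C * (\<Sum>j<11. \<Sum>i<11. \<Sum>r=1..5. c i r * (w j * q j i * E r + (\<Sum>s=1..10. w j * q j (i + r * s) * K r s)))"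
        by (simp only: sum_distrib_left distrib_left mult_ac)
      also have "(\<Sum>j<11. \<Sum>i<11. \<Sum>r=1..5. c i r * (w j * q j i * E r + (\<Sum>s=1..10. w j * q j (i + r * s) * K r s))) =
          (\<Sum>i<11. \<Sum>j<11. \<Sum>r=1..5. c i r * (w j * q j i * E r + (\<Sum>s=1..10. w j * q j (i + r * s) * K r s)))"
        by (rule sum.swap)
      also have "\<dots> = (\<Sum>i<11. \<Sum>r=1..5. \<Sum>j<11. c i r * (w j * q j i * E r + (\<Sum>s=1..10. w j * q j (i + r * s) * K r s)))"
        by (rule sum.cong[OF refl], rule sum.swap)
      also have "\<dots> = (\<Sum>i<11. \<Sum>r=1..5. c i r * ((\<Sum>j<11. w j * q j i) * E r + (\<Sum>s=1..10.
          (\<Sum>j<11. w j * q j (i + r * s)) * K r s)))"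
      proof (intro sum.cong refl)
        fix i r
        have "(\<Sum>j<11. \<Sum>s=1..10. w j * q j (i + r * s) * K r s) = (\<Sum>s=1..10. (\<Sum>j<11. w j * q j (i + r * s)) * K r s)"
          by (subst sum.swap) (simp only: sum_distrib_right)
        thus "(\<Sum>j<11. c i r * (w j * q j i * E r + (\<Sum>s=1..10. w j * q j (i + r * s) * K r s))) =
            c i r * ((\<Sum>j<11. w j * q j i) * E r + (\<Sum>s=1..10. (\<Sum>j<11. w j * q j (i + r * s)) * K r s))"
          by (simp only: sum_distrib_left[symmetric] sum.distrib sum_distrib_right[symmetric])
      qed
      finally show ?thesis .
    qed
    show ?thesis by (rule sw)
  qed
  also have "\<dots> = - (J1 11 Q ^ 2) * (\<Sum>i<11. \<Sum>r=1..5. c i r *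
      (11 * p ^ m * A i * E r + (\<Sum>s=1..10. 11 * p ^ m * A (i + r * s) * K r s)))"
    by (simp only: sec A_def)
  also have "\<dots> = 11 * p ^ m * (- (J1 11 Q ^ 2) * (\<Sum>i<11. \<Sum>r=1..5. c i r * (A i * E r + (\<Sum>s=1..10. A (i + r * s) * K r s))))"
    by (simp only: sum_distrib_left distrib_left mult_ac)
  finally have "11 * p ^ m * f11 m (int k) Q =
      11 * p ^ m * (- (J1 11 Q ^ 2) * (\<Sum>i<11. \<Sum>r=1..5. c i r * (A i * E r + (\<Sum>s=1..10. A (i + r * s) * K r s))))" .
  moreover have "11 * p ^ m \<noteq> 0" using p by simp
  ultimately have "f11 m (int k) Q = - (J1 11 Q ^ 2) * (\<Sum>i<11. \<Sum>r=1..5. c i r * (A i * E r + (\<Sum>s=1..10. A (i + r * s) * K r s)))"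
    using mult_left_cancel by blast
  moreover have "A i * E r + (\<Sum>s=1..10. A (i + r * s) * K r s) =
       ((if i = m then E r else 0) + (\<Sum>s=1..10. if (i + r * s) mod 11 = m then Q ^ ((i + r * s) div 11) * K r s else 0))"
    if "i < 11" for i r
    using that by (auto simp: A_def if_distrib[of "\<lambda>x. x * _"] cong: if_cong)
  ultimately show ?thesis unfolding c_def E_def K_def by (simp cong: sum.cong_simp)
qed

text \<open>The Kronecker value of \<open>kron_level11\<close> without J1^3 and, for r + s > 11,
  without the negative power of Q, which \<open>f11_expansion\<close> absorbs into its
  exponents.\<close>

definition kron_part :: "nat \<Rightarrow> nat \<Rightarrow> complex \<Rightarrow> complex" where
  "kron_part r s Q = (if r + s = 11 then 0 else if r + s < 11 then J2 (r + s) 11 Q else - J2 (r + s - 11) 11 Q) / (J2 r 11 Q * J2 s 11 Q)"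

lemma f11_expansion:
  assumes Q: "Q \<noteq> 0" "norm Q < 1" and k: "k \<in> {1..5}" and m: "m < 11"
  shows "f11 m (int k) Q = - (J1 11 Q ^ 5) *
    (\<Sum>i<11. \<Sum>r=1..5. of_int (cyc_conv i r k) * crank_part i Q *
       ((if i = m then eis (Q ^ r) (Q ^ 11) / J1 11 Q ^ 3 else 0) +
        (\<Sum>s=1..10. if (i + r * s) mod 11 = m then Q ^ ((i + r * s) div 11 - (r + s - 11)) * kron_part r s Q else 0)))"
proof -
  obtain p where pQ: "Q = p ^ 11" using exists_complex_root[of 11 Q] by (metis zero_neq_numeral)
  have p: "p \<noteq> 0" using Q pQ by auto
  have "norm p < 1"
  proof (rule ccontr)
    assume "\<not> norm p < 1"
    hence "1 \<le> norm p ^ 11" by (intro one_le_power) auto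
    thus False using Q by (simp add: pQ norm_power)
  qed
  note exp = f11_expansion_aux[OF p this k m, folded pQ]
  have J: "J1 11 Q \<noteq> 0" unfolding J1_def using qpoch_nonzero' level11[OF Q] by blast
  have key: "(if (i + r * s) mod 11 = m then Q ^ ((i + r * s) div 11) * kron (Q ^ s) (Q ^ r) (Q ^ 11) else 0) =
        J1 11 Q ^ 3 * (if (i + r * s) mod 11 = m then Q ^ ((i + r * s) div 11 - (r + s - 11)) * kron_part r s Q else 0)"
    if "r \<in> {1..5}" "s \<in> {1..10}" for i r s
  proof -
    have "kron (Q ^ s) (Q ^ r) (Q ^ 11) = J1 11 Q ^ 3 *
      (if r + s = 11 then 0 else if r + s < 11 then J2 (r + s) 11 Q else - J2 (r + s - 11) 11 Q / Q ^ (r + s - 11)) / (J2 r 11 Q * J2 s 11 Q)"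
      using that by (intro kron_level11[OF Q]) auto
    hence kp: "Q ^ (r + s - 11) * kron (Q ^ s) (Q ^ r) (Q ^ 11) = J1 11 Q ^ 3 * kron_part r s Q"
      using Q by (auto simp: kron_part_def)
    \<comment> \<open>For r + s > 11 this rests on (11 - r)(11 - s) \<ge> 0. Hence the outer
      subtraction of naturals in the exponent does not truncate, and no negative power of Q
      remains.\<close>
    have le: "r + s - 11 \<le> (i + r * s) div 11"
    proof -
      have "11 * (r + s - 11) \<le> r * s"
      proof (cases "r + s \<le> 11")
        case False
        have "0 \<le> (11 - int r) * (11 - int s)" using that by (intro mult_nonneg_nonneg) auto
        hence "11 * (int r + int s - 11) \<le> int (r * s)" by (simp add: algebra_simps)
        hence "int (11 * (r + s - 11)) \<le> int (r * s)" using False by (simp add: of_nat_diff)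
        thus ?thesis by (simp only: of_nat_le_iff)
      qed auto
      hence "(11 * (r + s - 11)) div 11 \<le> (i + r * s) div 11" by (intro div_le_mono) simp
      thus ?thesis by simp
    qed
    hence "Q ^ ((i + r * s) div 11) = Q ^ ((i + r * s) div 11 - (r + s - 11)) * Q ^ (r + s - 11)"
      by (simp flip: power_add)
    thus ?thesis using kp by (simp add: mult.assoc mult.left_commute)
  qed
  have inner: "(if i = m then eis (Q ^ r) (Q ^ 11) else 0) +
        (\<Sum>s=1..10. if (i + r * s) mod 11 = m then Q ^ ((i + r * s) div 11) * kron (Q ^ s) (Q ^ r) (Q ^ 11) else 0) =
        J1 11 Q ^ 3 * ((if i = m then eis (Q ^ r) (Q ^ 11) / J1 11 Q ^ 3 else 0) +
        (\<Sum>s=1..10. if (i + r * s) mod 11 = m then Q ^ ((i + r * s) div 11 - (r + s - 11)) * kron_part r s Q else 0))"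
    if "r \<in> {1..5}" for i r
  proof -
    have "(\<Sum>s=1..10. if (i + r * s) mod 11 = m then Q ^ ((i + r * s) div 11) * kron (Q ^ s) (Q ^ r) (Q ^ 11) else 0) =
        (\<Sum>s=1..10. J1 11 Q ^ 3 * (if (i + r * s) mod 11 = m then Q ^ ((i + r * s) div 11 - (r + s - 11)) * kron_part r s Q else 0))"
      by (intro sum.cong refl key that)
    moreover have "(if i = m then eis (Q ^ r) (Q ^ 11) else 0) = J1 11 Q ^ 3 * (if i = m then eis (Q ^ r) (Q ^ 11) / J1 11 Q ^ 3 else 0)"
      using J by simp
    ultimately show ?thesis by (simp only: distrib_left sum_distrib_left)
  qed
  have "f11 m (int k) Q = - (J1 11 Q ^ 2) *
    (\<Sum>i<11. \<Sum>r=1..5. of_int (cyc_conv i r k) * crank_part i Q * (J1 11 Q ^ 3 *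
       ((if i = m then eis (Q ^ r) (Q ^ 11) / J1 11 Q ^ 3 else 0) +
        (\<Sum>s=1..10. if (i + r * s) mod 11 = m then Q ^ ((i + r * s) div 11 - (r + s - 11)) * kron_part r s Q else 0))))"
    unfolding exp by (intro arg_cong[of _ _ "\<lambda>x. - (J1 11 Q ^ 2) * x"] sum.cong refl) (simp only: inner)
  also have "\<dots> = - (J1 11 Q ^ 2) * (J1 11 Q ^ 3 * (\<Sum>i<11. \<Sum>r=1..5. of_int (cyc_conv i r k) * crank_part i Q *
       ((if i = m then eis (Q ^ r) (Q ^ 11) / J1 11 Q ^ 3 else 0) +
        (\<Sum>s=1..10. if (i + r * s) mod 11 = m then Q ^ ((i + r * s) div 11 - (r + s - 11)) * kron_part r s Q else 0))))"
    by (simp only: sum_distrib_left[of "J1 11 Q ^ 3"] mult.left_commute[of _ "J1 11 Q ^ 3"])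
  also have "\<dots> = - (J1 11 Q ^ 5) * (\<Sum>i<11. \<Sum>r=1..5. of_int (cyc_conv i r k) * crank_part i Q *
       ((if i = m then eis (Q ^ r) (Q ^ 11) / J1 11 Q ^ 3 else 0) +
        (\<Sum>s=1..10. if (i + r * s) mod 11 = m then Q ^ ((i + r * s) div 11 - (r + s - 11)) * kron_part r s Q else 0)))"
    by (simp add: mult.assoc[symmetric] flip: power_add)
  finally show ?thesis .
qed

lemma f11_combination:
  assumes Q: "Q \<noteq> 0" "norm Q < 1" and m: "m < 11"
  shows "(\<Sum>k=1..5. of_int (w k) * f11 m (int k) Q) = - (J1 11 Q ^ 5) *
    (\<Sum>i<11. \<Sum>r=1..5. of_int (\<Sum>k=1..5. w k * cyc_conv i r k) * (crank_part i Q *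
       ((if i = m then eis (Q ^ r) (Q ^ 11) / J1 11 Q ^ 3 else 0) +
        (\<Sum>s=1..10. if (i + r * s) mod 11 = m then Q ^ ((i + r * s) div 11 - (r + s - 11)) * kron_part r s Q else 0))))"
proof -
  define Y where "Y = (\<lambda>i r. crank_part i Q *
       ((if i = m then eis (Q ^ r) (Q ^ 11) / J1 11 Q ^ 3 else 0) +
        (\<Sum>s=1..10. if (i + r * s) mod 11 = m then Q ^ ((i + r * s) div 11 - (r + s - 11)) * kron_part r s Q else 0)))"
  have "(\<Sum>k=1..5. of_int (w k) * f11 m (int k) Q) =
      (\<Sum>k=1..5. of_int (w k) * (- (J1 11 Q ^ 5) * (\<Sum>i<11. \<Sum>r=1..5. of_int (cyc_conv i r k) * Y i r)))"
    by (intro sum.cong refl) (simp only: f11_expansion[OF Q _ m] Y_def mult.assoc)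
  also have "\<dots> = - (J1 11 Q ^ 5) * (\<Sum>k=1..5. \<Sum>i<11. \<Sum>r=1..5. of_int (w k * cyc_conv i r k) * Y i r)"
    by (simp only: sum_distrib_left of_int_mult mult_ac)
  also have "(\<Sum>k=1..5. \<Sum>i<11. \<Sum>r=1..5. of_int (w k * cyc_conv i r k) * Y i r) =
      (\<Sum>i<11. \<Sum>k=1..5. \<Sum>r=1..5. of_int (w k * cyc_conv i r k) * Y i r)"
    by (rule sum.swap)
  also have "\<dots> = (\<Sum>i<11. \<Sum>r=1..5. \<Sum>k=1..5. of_int (w k * cyc_conv i r k) * Y i r)"
    by (rule sum.cong[OF refl], rule sum.swap)
  also have "\<dots> = (\<Sum>i<11. \<Sum>r=1..5. of_int (\<Sum>k=1..5. w k * cyc_conv i r k) * Y i r)"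
    by (simp only: sum_distrib_right of_int_sum)
  finally show ?thesis unfolding Y_def .
qed

section \<open>Limits at nome 0\<close>

lemma theta_tendsto_1:
  assumes "0 < a" "a < b"
  shows "((\<lambda>q. theta (q ^ a) (q ^ b)) \<longlongrightarrow> 1) (at 0)"
proof -
  define d where "d = (\<lambda>n. nat (int b * tri n + int a * n))"
  \<comment> \<open>Only the term n = 0 survives at nome 0: for 0 < a < b all other exponents of q
    are positive.\<close>
  have pos: "int b * tri n + int a * n > 0" if "n \<noteq> 0" for n
  proof -
    have "2 * (int b * tri n + int a * n) = int b * (2 * tri n) + 2 * int a * n"
      by (simp add: algebra_simps)
    also have "\<dots> = n * (int b * (n - 1) + 2 * int a)"
      unfolding two_tri by (simp add: algebra_simps)
    finally have "2 * (int b * tri n + int a * n) = n * (int b * (n - 1) + 2 * int a)" .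
    moreover have "n * (int b * (n - 1) + 2 * int a) > 0"
    proof (cases "n > 0")
      case True
      hence "int b * (n - 1) \<ge> 0" by simp
      hence "0 < int b * (n - 1) + 2 * int a" using assms by linarith
      thus ?thesis using True by (intro mult_pos_pos)
    next
      case False
      hence "int b * (n - 1) \<le> int b * (- 2)" using that by (intro mult_left_mono) auto
      hence "int b * (n - 1) + 2 * int a < 0" using assms by linarith
      moreover have "n < 0" using False that by simp
      ultimately show ?thesis by (intro mult_neg_neg)
    qed
    ultimately have "0 < 2 * (int b * tri n + int a * n)" by metis
    thus ?thesis by (simp only: zero_less_mult_iff) simp
  qed
  have theta_term: "theta_term (q ^ a) (q ^ b) n = (-1) powi n * q ^ d n" if "q \<noteq> 0" for q n
  proof -
    have "(q ^ b) powi tri n * (q ^ a) powi n = q powi (int b * tri n + int a * n)"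
      using that by (simp add: power_int_add power_int_mult)
    moreover have "int b * tri n + int a * n \<ge> 0" using pos[of n] by (cases "n = 0") (auto simp: tri_def)
    ultimately show ?thesis by (simp add: theta_term_def power_int_def d_def)
  qed
  have "((\<lambda>q. infsum (\<lambda>n. (-1) powi n * q ^ d n) UNIV) \<longlongrightarrow> infsum (\<lambda>n. if n
      = 0 then 1 else 0) (UNIV :: int set)) (at (0::complex))"
  proof (rule infsum_dominated_tendsto)
    fix n :: int
    have "((\<lambda>q. (-1) powi n * q ^ d n) \<longlongrightarrow> (-1) powi n * 0 ^ d n) (at (0::complex))"
      by (intro tendsto_intros)
    moreover have "(-1) powi n * 0 ^ d n = (if n = 0 then 1 else 0 :: complex)"
      using pos[of n] by (auto simp: d_def tri_def)
    ultimately show "((\<lambda>q. (-1) powi n * q ^ d n) \<longlongrightarrow> (if n = 0 then 1 else 0)) (at (0::complex))" by simp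
  next
    \<comment> \<open>For |q| \<le> 1/2 the terms are dominated by those at 1/2, which belong to a
      convergent theta series.\<close>
    have "eventually (\<lambda>q. norm q \<le> 1 / 2) (at (0::complex))"
      unfolding eventually_at by (rule exI[of _ "1 / 2"]) (auto simp: dist_norm)
    thus "\<forall>\<^sub>F q in at (0::complex). \<forall>n\<in>UNIV. norm ((-1) powi n * q ^ d n) \<le> (1 / 2) ^ d n"
      by eventually_elim (auto simp: norm_mult norm_power norm_power_int intro!: power_mono)
    have h: "(1 / 2 :: complex) \<noteq> 0" by simp
    have "norm (theta_term ((1 / 2) ^ a) ((1 / 2) ^ b) n) = (1 / 2) ^ d n" for n
      unfolding theta_term[OF h] by (simp add: norm_mult norm_power norm_power_int norm_divide)
    moreover have "(\<lambda>n. norm (theta_term ((1 / 2) ^ a) ((1 / 2) ^ b) n)) summable_on UNIV"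
      using assms by (intro theta_term_abs_summable) (auto simp: norm_power power_less_one_iff norm_divide)
    ultimately show "(\<lambda>n. (1 / 2 :: real) ^ d n) summable_on UNIV" by simp
  qed
  moreover have "infsum (\<lambda>n. if n = 0 then 1 else 0) (UNIV :: int set) = (1 :: complex)"
    by (rule infsumI, rule has_sum_finite_neutralI[of "{0}"]) auto
  moreover have "eventually (\<lambda>q. infsum (\<lambda>n. (-1) powi n * q ^ d n) UNIV = theta (q ^ a) (q ^ b)) (at (0::complex))"
    unfolding eventually_at theta_def by (rule exI[of _ 1]) (auto simp: theta_term intro!: infsum_cong)
  ultimately show ?thesis using Lim_transform_eventually by fastforce
qed

lemma eventually_punctured_disc: "eventually (\<lambda>q::complex. q \<noteq> 0 \<and> norm q < 1) (at 0)"
  unfolding eventually_at by (rule exI[of _ 1]) (auto simp: dist_norm)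

lemma J2_tendsto:
  assumes "0 < a" "a < 11"
  shows "((\<lambda>q. J2 a 11 q) \<longlongrightarrow> J2 a 11 0) (at 0)"
proof -
  have "eventually (\<lambda>q. theta (q ^ a) (q ^ 11) = J2 a 11 q) (at 0)"
    using eventually_punctured_disc by eventually_elim (use assms in \<open>simp add: J2_eq_theta\<close>)
  moreover have "J2 a 11 0 = 1" using assms by (simp add: J2_def qpochs_inf_def power_0_left)
  ultimately show ?thesis using theta_tendsto_1[OF assms] Lim_transform_eventually by fastforce
qed

lemma J1_tendsto: "((\<lambda>q. J1 11 q) \<longlongrightarrow> J1 11 0) (at 0)"
proof -
  have "eventually (\<lambda>q. theta (q ^ 11) (q ^ 33) = J1 11 q) (at 0)"
    using eventually_punctured_disc
    by eventually_elim (simp add: J1_def qpoch_eq_theta[OF level11] flip: power_mult)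
  moreover have "J1 11 0 = 1" by (simp add: J1_def)
  ultimately show ?thesis using theta_tendsto_1[of 11 33] Lim_transform_eventually by fastforce
qed

lemma J2_0: "0 < a \<Longrightarrow> a < 11 \<Longrightarrow> J2 a 11 0 = 1"
  by (simp add: J2_def qpochs_inf_def power_0_left)

text \<open>A power series with positive radius of convergence is continuous at 0. Convergence at
  1/2 bounds crank_diff b n / 2^n, and the additional factor 1/2 in \<open>y\<close> makes the
  series of one residue class converge geometrically.\<close>

lemma f11_tendsto:
  assumes "b \<in> {1..5}"
  shows "((\<lambda>q. f11 m (int b) q) \<longlongrightarrow> f11 m (int b) 0) (at 0)"
proof -
  have f: "f11 m (int b) q = (\<Sum>n. crank_diff b (11 * n + m) * q ^ n)" for q
    by (simp only: f11_def crank_diff_def)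
  define x where "x = (1 / 2 :: complex)"
  have "summable (\<lambda>n. crank_diff b n * x ^ n)"
    by (rule crank_diff_summable) (simp add: x_def norm_divide)
  hence "(\<lambda>n. crank_diff b n * x ^ n) \<longlonglongrightarrow> 0" by (rule summable_LIMSEQ_zero)
  hence "Bseq (\<lambda>n. crank_diff b n * x ^ n)" by (intro convergent_imp_Bseq convergentI)
  then obtain B where B: "\<And>n. norm (crank_diff b n * x ^ n) \<le> B" by (auto simp: Bseq_def)
  have x0: "x \<noteq> 0" by (simp add: x_def)
  define y where "y = x ^ 11 / 2"
  have "summable (\<lambda>n. crank_diff b (11 * n + m) * y ^ n)"
  proof (rule summable_comparison_test')
    show "summable (\<lambda>n. B / norm (x ^ m) * (1 / 2) ^ n)" by (intro summable_mult summable_geometric) auto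
    fix n
    have "crank_diff b (11 * n + m) * y ^ n = crank_diff b (11 * n + m) * x ^ (11 * n + m) / x ^ m * (1 / 2) ^ n"
      by (simp add: y_def power_add power_divide x0 flip: power_mult)
    hence "norm (crank_diff b (11 * n + m) * y ^ n) = norm (crank_diff b (11 * n + m) * x ^ (11 * n + m)) / norm (x ^ m) * (1 / 2) ^ n"
      by (simp only: norm_mult norm_divide norm_power) simp
    also have "\<dots> \<le> B / norm (x ^ m) * (1 / 2) ^ n"
      by (intro mult_right_mono divide_right_mono B) auto
    finally show "norm (crank_diff b (11 * n + m) * y ^ n) \<le> B / norm (x ^ m) * (1 / 2) ^ n" .
  qed
  hence "isCont (\<lambda>q. \<Sum>n. crank_diff b (11 * n + m) * q ^ n) 0"
    by (rule isCont_powser) (simp add: y_def x_def norm_divide norm_power)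
  thus ?thesis unfolding f isCont_def by simp
qed

subsection \<open>The five identities\<close>

lemma power_5_6_7: "u ^ 5 = u * u * u * u * (u :: complex)" "u ^ 6 = u * u * u * u * u * u" "u ^ 7 = u * u * u * u * u * u * u"
  by (simp_all add: eval_nat_numeral mult.assoc)

lemmas small_powers = power2_eq_square power3_eq_cube power4_eq_xxxx power_5_6_7

text \<open>Multiplication by \<open>A\<close> and its powers clears all denominators. The cofactors of the relations
\<open>rel i = 0\<close> in the identities below were found by linear algebra.\<close>

locale level11_point =
  fixes Q :: complex
  assumes Q: "Q \<noteq> 0" "norm Q < 1"
begin

definition a :: "nat \<Rightarrow> complex" where "a k = J2 k 11 Q"
definition A :: complex where "A = a 1 * a 2 * a 3 * a 4 * a 5"
definition x :: "nat \<Rightarrow> complex" where "x i = A * crank_part i Q"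
definition y :: "nat \<Rightarrow> nat \<Rightarrow> complex" where "y r s = A ^ 2 * kron_part r s Q"
definition e :: "nat \<Rightarrow> complex" where "e r = A ^ 2 * (eis (Q ^ r) (Q ^ 11) / J1 11 Q ^ 3)"

definition rel :: "nat \<Rightarrow> complex" where
  "rel i = [a 2 * a 3 * a 4 ^ 2 - a 1 * a 4 * a 5 ^ 2 - Q * a 1 * a 2 * a 3 ^ 2,
     a 3 * a 4 ^ 3 - a 2 * a 5 ^ 3 - Q ^ 2 * a 1 * a 2 ^ 3,
     a 4 ^ 3 * a 5 - a 3 * a 5 ^ 3 - Q ^ 3 * a 1 ^ 3 * a 2,
     a 3 ^ 3 * a 4 - a 1 * a 5 ^ 3 - Q * a 2 ^ 3 * a 3,
     a 3 ^ 2 * a 4 * a 5 - a 2 * a 4 * a 5 ^ 2 - Q ^ 2 * a 1 ^ 2 * a 2 * a 3,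
     a 2 ^ 2 * a 4 * a 5 - a 1 * a 3 * a 5 ^ 2 - Q * a 1 ^ 2 * a 3 * a 4,
     a 2 * a 3 ^ 2 * a 5 - a 1 * a 4 ^ 2 * a 5 - Q * a 1 * a 2 ^ 2 * a 4,
     a 2 ^ 2 * a 3 * a 5 - a 1 * a 3 * a 4 ^ 2 - Q * a 1 ^ 2 * a 2 * a 5] ! i"

text \<open>\<open>A ^ 3\<close> times the double sum of \<open>f11_combination\<close>. Entry k of
  \<open>w\<close> is the coefficient of \<open>f11 m k\<close> for k = 1, ..., 5, so the lists
  below start with a 0 in front.\<close>

definition comb :: "nat \<Rightarrow> int list \<Rightarrow> complex" where
  "comb m w = (\<Sum>i<11. \<Sum>r=1..5. of_int (\<Sum>k=1..5. w ! k * cyc_conv i r k) * (x i *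
     ((if i = m then e r else 0) +
      (\<Sum>s=1..10. if (i + r * s) mod 11 = m then Q ^ ((i + r * s) div 11 - (r + s - 11)) * y r s else 0))))"

lemma a_nonzero: "a 1 \<noteq> 0" "a 2 \<noteq> 0" "a 3 \<noteq> 0" "a 4 \<noteq> 0" "a 5 \<noteq> 0"
  unfolding a_def by (intro J2_nonzero Q; simp)+

lemma a_reflect: "a 6 = a 5" "a 7 = a 4" "a 8 = a 3" "a 9 = a 2" "a 10 = a 1"
  using J2_reflect[of 1 Q] J2_reflect[of 2 Q] J2_reflect[of 3 Q] J2_reflect[of 4 Q] J2_reflect[of 5 Q]
  by (simp_all add: a_def)

lemma a_Suc_0: "a (Suc 0) = a 1"
  by (simp only: One_nat_def)

lemma A_nonzero: "A \<noteq> 0"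
  using a_nonzero by (simp add: A_def)

lemma rel_eq_0: "rel 0 = 0" "rel 1 = 0" "rel 2 = 0" "rel 3 = 0" "rel 4 = 0" "rel 5 = 0" "rel 6 = 0" "rel 7 = 0"
  using level11_relations[OF Q, folded a_def] by (simp_all add: rel_def)

lemma x_values:
  "x 0 = a 2 * a 3 * a 4 * a 5" "x 1 = a 1 * a 4 * a 5 ^ 2" "x 2 = a 2 * a 3 ^ 2 * a 5" "x 3 = a 2 ^ 2 * a 4 * a 5"
      "x 4 = a 1 * a 3 * a 4 * a 5" "x 5 = a 1 * a 3 * a 4 ^ 2" "x 6 = 0" "x 7 = a 1 * a 2 * a 4 * a 5" "x 8 = Q * a
      1 ^ 2 * a 2 * a 3" "x 9 = a 1 * a 2 * a 3 * a 5" "x 10 = a 1 * a 2 * a 3 * a 4"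
  using a_nonzero by (simp_all add: x_def A_def crank_part_def Let_def a_Suc_0 small_powers flip: a_def del: One_nat_def)

text \<open>The square \<open>A ^ 2\<close> is forced by s = r, where \<open>kron_part r r Q\<close>
  has \<open>a r ^ 2\<close> in its denominator. With this table \<open>comb\<close> is polynomial
  in Q, the \<open>a k\<close> and the \<open>e r\<close>.\<close>

lemma y_values:
  "y 1 1 = a 2 ^ 3 * a 3 ^ 2 * a 4 ^ 2 * a 5 ^ 2" "y 1 2 = a 1 * a 2 * a 3 ^ 3 * a 4 ^ 2 * a 5 ^ 2" "y 1 3 = a 1 * a
      2 ^ 2 * a 3 * a 4 ^ 3 * a 5 ^ 2" "y 1 4 = a 1 * a 2 ^ 2 * a 3 ^ 2 * a 4 * a 5 ^ 3" "y 1 5 = a 1 * a 2 ^ 2 * a 3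
      ^ 2 * a 4 ^ 2 * a 5 ^ 2" "y 1 6 = a 1 * a 2 ^ 2 * a 3 ^ 2 * a 4 ^ 3 * a 5" "y 1 7 = a 1 * a 2 ^ 2 * a 3 ^ 3 * a
      4 * a 5 ^ 2" "y 1 8 = a 1 * a 2 ^ 3 * a 3 * a 4 ^ 2 * a 5 ^ 2" "y 1 9 = a 1 ^ 2 * a 2 * a 3 ^ 2 * a 4 ^ 2 * a 5
      ^ 2" "y 2 1 = a 1 * a 2 * a 3 ^ 3 * a 4 ^ 2 * a 5 ^ 2" "y 2 2 = a 1 ^ 2 * a 3 ^ 2 * a 4 ^ 3 * a 5 ^ 2" "y 2 3 =
      a 1 ^ 2 * a 2 * a 3 * a 4 ^ 2 * a 5 ^ 3" "y 2 4 = a 1 ^ 2 * a 2 * a 3 ^ 2 * a 4 * a 5 ^ 3" "y 2 5 = a 1 ^ 2 * a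
      2 * a 3 ^ 2 * a 4 ^ 3 * a 5" "y 2 6 = a 1 ^ 2 * a 2 * a 3 ^ 3 * a 4 ^ 2 * a 5" "y 2 7 = a 1 ^ 2 * a 2 ^ 2 * a 3
      ^ 2 * a 4 * a 5 ^ 2" "y 2 8 = a 1 ^ 3 * a 2 * a 3 * a 4 ^ 2 * a 5 ^ 2" "y 2 10 = - (a 1 ^ 2 * a 2 * a 3 ^ 2 * a
      4 ^ 2 * a 5 ^ 2)" "y 3 1 = a 1 * a 2 ^ 2 * a 3 * a 4 ^ 3 * a 5 ^ 2" "y 3 2 = a 1 ^ 2 * a 2 * a 3 * a 4 ^ 2 * a
      5 ^ 3" "y 3 3 = a 1 ^ 2 * a 2 ^ 2 * a 4 ^ 2 * a 5 ^ 3" "y 3 4 = a 1 ^ 2 * a 2 ^ 2 * a 3 * a 4 ^ 2 * a 5 ^ 2" "y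
      3 5 = a 1 ^ 2 * a 2 ^ 2 * a 3 ^ 2 * a 4 ^ 2 * a 5" "y 3 6 = a 1 ^ 2 * a 2 ^ 3 * a 3 * a 4 ^ 2 * a 5" "y 3 7 = a
      1 ^ 3 * a 2 ^ 2 * a 3 * a 4 * a 5 ^ 2" "y 3 9 = - (a 1 ^ 3 * a 2 * a 3 * a 4 ^ 2 * a 5 ^ 2)" "y 3 10 = - (a 1 *
      a 2 ^ 3 * a 3 * a 4 ^ 2 * a 5 ^ 2)" "y 4 1 = a 1 * a 2 ^ 2 * a 3 ^ 2 * a 4 * a 5 ^ 3" "y 4 2 = a 1 ^ 2 * a 2 *
      a 3 ^ 2 * a 4 * a 5 ^ 3" "y 4 3 = a 1 ^ 2 * a 2 ^ 2 * a 3 * a 4 ^ 2 * a 5 ^ 2" "y 4 4 = a 1 ^ 2 * a 2 ^ 2 * a 3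
      ^ 3 * a 5 ^ 2" "y 4 5 = a 1 ^ 2 * a 2 ^ 3 * a 3 ^ 2 * a 4 * a 5" "y 4 6 = a 1 ^ 3 * a 2 ^ 2 * a 3 ^ 2 * a 4 * a
      5" "y 4 8 = - (a 1 ^ 3 * a 2 ^ 2 * a 3 * a 4 * a 5 ^ 2)" "y 4 9 = - (a 1 ^ 2 * a 2 ^ 2 * a 3 ^ 2 * a 4 * a 5 ^
      2)" "y 4 10 = - (a 1 * a 2 ^ 2 * a 3 ^ 3 * a 4 * a 5 ^ 2)" "y 5 1 = a 1 * a 2 ^ 2 * a 3 ^ 2 * a 4 ^ 2 * a 5 ^
      2" "y 5 2 = a 1 ^ 2 * a 2 * a 3 ^ 2 * a 4 ^ 3 * a 5" "y 5 3 = a 1 ^ 2 * a 2 ^ 2 * a 3 ^ 2 * a 4 ^ 2 * a 5" "y 5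
      4 = a 1 ^ 2 * a 2 ^ 3 * a 3 ^ 2 * a 4 * a 5" "y 5 5 = a 1 ^ 3 * a 2 ^ 2 * a 3 ^ 2 * a 4 ^ 2" "y 5 7 = - (a 1 ^
      3 * a 2 ^ 2 * a 3 ^ 2 * a 4 * a 5)" "y 5 8 = - (a 1 ^ 2 * a 2 ^ 3 * a 3 * a 4 ^ 2 * a 5)" "y 5 9 = - (a 1 ^ 2 *
      a 2 * a 3 ^ 3 * a 4 ^ 2 * a 5)" "y 5 10 = - (a 1 * a 2 ^ 2 * a 3 ^ 2 * a 4 ^ 3 * a 5)"
  using a_nonzero
  by (simp_all add: y_def A_def kron_part_def a_reflect a_Suc_0 small_powers field_simps flip: a_def del: One_nat_def)

lemma y_eq_0: "r + s = 11 \<Longrightarrow> y r s = 0"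
  by (simp add: y_def kron_part_def)

text \<open>Relations of the shape E(s) + E(t) - E(u) - E(v) = theta quotient, for (s,t;u,v) =
  (1,5;2,4), (3,4;2,5), (2,6;3,5), (4,4;1,7), (3,6;4,5), rewritten with E(6) = - E(5) and E(7) = -
  E(4). The fourth keeps a factor \<open>a 4\<close>: its quotient has \<open>a 4 ^ 3\<close> in the
  denominator, and \<open>A ^ 2\<close> clears only two of these.\<close>

lemma e_relations:
  "e 1 = e 2 + e 4 - e 5 + Q * a 1 ^ 2 * a 2 * a 3 ^ 3 * a 4 * a 5 ^ 2"
  "e 3 = e 2 + e 5 - e 4 - Q ^ 2 * a 1 ^ 3 * a 2 ^ 2 * a 3 * a 4 ^ 2 * a 5"
  "e 2 = e 3 + 2 * e 5 + Q ^ 2 * a 1 ^ 3 * a 2 * a 3 ^ 3 * a 4 ^ 2"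
  "a 4 * e 1 = a 4 * (3 * e 4) + Q * a 1 * a 2 ^ 2 * a 3 ^ 5 * a 5 ^ 2"
  "e 3 = e 4 + 2 * e 5 + Q ^ 3 * a 1 ^ 3 * a 2 ^ 4 * a 3 * a 4"
proof -
  define E where "E = (\<lambda>r. eis (Q ^ r) (Q ^ 11) / J1 11 Q ^ 3)"
  have e: "e r = A ^ 2 * E r" for r by (simp add: e_def E_def)
  have J: "J1 11 Q \<noteq> 0" unfolding J1_def using qpoch_nonzero' level11[OF Q] by blast
  have d: "Q ^ 11 / Q ^ k = Q ^ (11 - k)" if "k \<le> 10" for k using Q that by (subst power_diff) auto
  have E: "eis (Q ^ r) (Q ^ 11) = J1 11 Q ^ 3 * E r" for r using J by (simp add: E_def)
  have Er: "E 6 = - E 5" "E 7 = - E 4"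
    by (simp_all add: E_def eis_def d diff_divide_distrib)
  \<comment> \<open>Kronecker values divided by \<open>J1 11 Q ^ 3\<close>. Both sides of the
    four-term relation contain this factor twice, so it cancels.\<close>
  define \<kappa> where "\<kappa> = (\<lambda>s r. (if r + s = 11 then 0 else if r + s < 11 then a (r + s) else - a
      (r + s - 11) / Q ^ (r + s - 11)) / (a r * a s))"
  have four: "\<kappa> s (11 - u) * \<kappa> t (11 - u) = \<kappa> (s + t) (11 - u) * (E s + E t - E u - E v)"
    if stuv: "1 \<le> s" "1 \<le> t" "1 \<le> u" "1 \<le> v" "s + t = u + v" "s + t \<le> 10" for s t u v
  proof -
    have k: "kron (Q ^ s) (Q ^ r) (Q ^ 11) = J1 11 Q ^ 3 * \<kappa> s r" if "1 \<le> r" "r \<le> 10" "1 \<le> s" "s \<le> 10" for r s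
      using kron_level11[OF Q that] by (simp add: \<kappa>_def a_def)
    have "(J1 11 Q ^ 3 * J1 11 Q ^ 3) * (\<kappa> s (11 - u) * \<kappa> t (11 - u)) =
        (J1 11 Q ^ 3 * J1 11 Q ^ 3) * (\<kappa> (s + t) (11 - u) * (E s + E t - E u - E v))"
      using eis_level11[OF Q stuv] stuv by (simp add: k E algebra_simps)
    thus ?thesis using J by simp
  qed
  have E1524: "E 1 + E 5 - E 2 - E 4 = Q * a 3 / (a 2 * a 4)"
    using four[of 1 5 2 4] a_nonzero Q
    by (simp add: \<kappa>_def a_reflect Er a_Suc_0 field_simps small_powers del: One_nat_def)
  have "A ^ 2 * (E 1 + E 5 - E 2 - E 4) = Q * a 1 ^ 2 * a 2 * a 3 ^ 3 * a 4 * a 5 ^ 2"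
    unfolding E1524 using a_nonzero by (simp add: A_def field_simps small_powers a_Suc_0 del: One_nat_def)
  thus "e 1 = e 2 + e 4 - e 5 + Q * a 1 ^ 2 * a 2 * a 3 ^ 3 * a 4 * a 5 ^ 2" unfolding e by algebra
  have E3425: "E 3 + E 4 - E 2 - E 5 = - (Q ^ 2 * a 1 / (a 3 * a 5))"
    using four[of 3 4 2 5] a_nonzero Q
    by (simp add: \<kappa>_def a_reflect Er a_Suc_0 field_simps small_powers del: One_nat_def)
  have "A ^ 2 * (E 3 + E 4 - E 2 - E 5) = - (Q ^ 2 * a 1 ^ 3 * a 2 ^ 2 * a 3 * a 4 ^ 2 * a 5)"
    unfolding E3425 using a_nonzero by (simp add: A_def field_simps small_powers a_Suc_0 del: One_nat_def)
  thus "e 3 = e 2 + e 5 - e 4 - Q ^ 2 * a 1 ^ 3 * a 2 ^ 2 * a 3 * a 4 ^ 2 * a 5" unfolding e by algebra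
  have E2635: "E 2 - E 3 - 2 * E 5 = Q ^ 2 * a 1 * a 3 / (a 2 * a 5 ^ 2)"
    using four[of 2 6 3 5] a_nonzero Q
    by (simp add: \<kappa>_def a_reflect Er a_Suc_0 field_simps small_powers del: One_nat_def)
  have "A ^ 2 * (E 2 - E 3 - 2 * E 5) = Q ^ 2 * a 1 ^ 3 * a 2 * a 3 ^ 3 * a 4 ^ 2"
    unfolding E2635 using a_nonzero by (simp add: A_def field_simps small_powers a_Suc_0 del: One_nat_def)
  thus "e 2 = e 3 + 2 * e 5 + Q ^ 2 * a 1 ^ 3 * a 2 * a 3 ^ 3 * a 4 ^ 2" unfolding e by algebra
  have E4417: "3 * E 4 - E 1 = - (Q * a 3 ^ 3 / (a 1 * a 4 ^ 3))"
    using four[of 4 4 1 7] a_nonzero Q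
    by (simp add: \<kappa>_def a_reflect Er a_Suc_0 field_simps small_powers del: One_nat_def)
  have "a 4 * (A ^ 2 * (3 * E 4 - E 1)) = - (Q * a 1 * a 2 ^ 2 * a 3 ^ 5 * a 5 ^ 2)"
    unfolding E4417 using a_nonzero by (simp add: A_def field_simps small_powers a_Suc_0 del: One_nat_def)
  thus "a 4 * e 1 = a 4 * (3 * e 4) + Q * a 1 * a 2 ^ 2 * a 3 ^ 5 * a 5 ^ 2" unfolding e by algebra
  have E3645: "E 3 - E 4 - 2 * E 5 = Q ^ 3 * a 1 * a 2 ^ 2 / (a 3 * a 4 * a 5 ^ 2)"
    using four[of 3 6 4 5] a_nonzero Q
    by (simp add: \<kappa>_def a_reflect Er a_Suc_0 field_simps small_powers del: One_nat_def)
  have "A ^ 2 * (E 3 - E 4 - 2 * E 5) = Q ^ 3 * a 1 ^ 3 * a 2 ^ 4 * a 3 * a 4"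
    unfolding E3645 using a_nonzero by (simp add: A_def field_simps small_powers a_Suc_0 del: One_nat_def)
  thus "e 3 = e 4 + 2 * e 5 + Q ^ 3 * a 1 ^ 3 * a 2 ^ 4 * a 3 * a 4" unfolding e by algebra
qed

lemma f11_comb:
  assumes m: "m < 11"
  shows "A ^ 3 * (\<Sum>k=1..5. of_int (w ! k) * f11 m (int k) Q) = - (J1 11 Q ^ 5) * comb m w"
proof -
  have "x i * ((if i = m then e r else 0) + (\<Sum>s=1..10. if c s then p s * y r s else 0)) =
      A ^ 3 * (crank_part i Q * ((if i = m then eis (Q ^ r) (Q ^ 11) / J1 11 Q ^ 3 else 0) +
        (\<Sum>s=1..10. if c s then p s * kron_part r s Q else 0)))" for i r c and p :: "nat \<Rightarrow> complex"
  proof -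
    have "(\<Sum>s=1..10. if c s then p s * y r s else 0) = A ^ 2 * (\<Sum>s=1..10. if c s then p s * kron_part r s Q else 0)"
      unfolding sum_distrib_left by (intro sum.cong) (auto simp: y_def)
    moreover have "(if i = m then e r else 0) = A ^ 2 * (if i = m then eis (Q ^ r) (Q ^ 11) / J1 11 Q ^ 3 else 0)"
      by (simp add: e_def)
    ultimately show ?thesis by (simp add: x_def power2_eq_square power3_eq_cube distrib_left mult_ac)
  qed
  hence "comb m w = A ^ 3 * (\<Sum>i<11. \<Sum>r=1..5. of_int (\<Sum>k=1..5. w ! k * cyc_conv i r k) * (crank_part i Q *
     ((if i = m then eis (Q ^ r) (Q ^ 11) / J1 11 Q ^ 3 else 0) +
      (\<Sum>s=1..10. if (i + r * s) mod 11 = m then Q ^ ((i + r * s) div 11 - (r + s - 11)) * kron_part r s Q else 0))))"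
    unfolding comb_def sum_distrib_left by (simp only: sum_distrib_left mult.left_commute[of _ "A ^ 3"])
  thus ?thesis unfolding f11_combination[OF Q m] by (simp only: mult.left_commute)
qed

lemma f11_identity:
  assumes m: "m < 11" and "comb m w = A ^ 3 * (11 * t)"
  shows "(\<Sum>k=1..5. of_int (w ! k) * f11 m (int k) Q) = - 11 * (t * J1 11 Q ^ 5)"
proof -
  have "A ^ 3 * (\<Sum>k=1..5. of_int (w ! k) * f11 m (int k) Q) = A ^ 3 * (- 11 * (t * J1 11 Q ^ 5))"
    unfolding f11_comb[OF m] assms(2) by (simp add: mult_ac)
  thus ?thesis using A_nonzero by (simp only: mult_cancel_left) simp
qed

text \<open>Here E(1) - E(3) - 2 E(4) + 2 E(5) occurs, the difference of E(1) - 3 E(4) and E(3) -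
  E(4) - 2 E(5), so two of the \<open>e_relations\<close> are needed.\<close>

lemma f11_identity_0:
  "f11 0 1 Q - f11 0 3 Q - 2 * f11 0 4 Q + 2 * f11 0 5 Q = - 11 * Q * (J2 5 11 Q * J1 11 Q ^ 5 / (J2 1 11 Q * J2 3 11 Q * J2 4 11 Q))"
proof -
  have "comb 0 [0, 1, 0, -1, -2, 2] = 11 * (Q * a 1 ^ 2 * a 2 ^ 3 * a 3 ^ 2 * a 4 ^ 2 * a 5 ^ 4) +
      Q * a 1 * a 2 * a 3 * (2 * a 2 ^ 2 * a 3 * a 4 * a 5 ^ 2 * rel 0 + Q * a 2 ^ 3 * a 3 ^ 3 * rel 0 + 2 * Q * a 2
          ^ 4 * a 3 * a 5 * rel 0 + 2 * a 1 * a 3 * a 4 ^ 3 * a 5 * rel 0 + 8 * Q * a 1 * a 2 ^ 2 * a 3 * a 4 ^ 2 *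
          rel 0 + 2 * Q * a 1 ^ 2 * a 2 * a 4 * a 5 ^ 2 * rel 0 + 2 * a 1 ^ 2 * a 4 * a 5 ^ 3 * rel 1 + 2 * a 2 ^ 3 *
          a 3 ^ 2 * a 5 * rel 2 + 2 * a 2 ^ 4 * a 5 ^ 2 * rel 2 + 2 * a 1 * a 2 * a 3 ^ 2 * a 4 ^ 2 * rel 2 + a 2 * a
          3 ^ 3 * a 4 ^ 2 * rel 3 + 2 * a 2 ^ 2 * a 3 * a 4 ^ 2 * a 5 * rel 3 + 8 * a 1 * a 3 * a 4 ^ 4 * rel 3 + 2 *
          Q * a 1 * a 2 ^ 3 * a 5 ^ 2 * rel 3 + 2 * Q * a 1 ^ 2 * a 2 * a 4 ^ 2 * a 5 * rel 3 - 2 * Q ^ 2 * a 1 ^ 2 *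
          a 2 ^ 3 * a 5 * rel 0 - a 2 * a 3 ^ 5 * rel 1 - 2 * a 2 ^ 2 * a 3 ^ 3 * a 5 * rel 1 - 2 * a 2 ^ 3 * a 3 * a
          5 ^ 2 * rel 1 - 8 * a 1 * a 3 ^ 3 * a 4 ^ 2 * rel 1 - 3 * a 1 * a 2 * a 3 * a 4 ^ 2 * a 5 * rel 1 - 2 * Q *
          a 1 ^ 2 * a 2 ^ 2 * a 5 ^ 2 * rel 1 - 2 * a 1 * a 2 * a 4 * a 5 ^ 3 * rel 3)"
    \<comment> \<open>The fifth relation rewrites \<open>e 3\<close>. The fourth determines
      \<open>e 1\<close> only after multiplication by \<open>a 4\<close>, so it enters as a
      hypothesis of the ideal membership; its coefficient \<open>x 0\<close> contains
      \<open>a 4\<close>.\<close>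
    unfolding comb_def lessThan_11 atLeastAtMost_1_10 atLeastAtMost_1_5
    by (simp add: cyc_conv_def cyc_def x_values y_values y_eq_0 e_relations(5) rel_def del: One_nat_def,
        use e_relations(4) in algebra)
  also have "Q * a 1 ^ 2 * a 2 ^ 3 * a 3 ^ 2 * a 4 ^ 2 * a 5 ^ 4 = A ^ 3 * (Q * a 5 / (a 1 * a 3 * a 4))"
    using a_nonzero by (simp add: A_def field_simps small_powers a_Suc_0 del: One_nat_def)
  finally have "comb 0 [0, 1, 0, -1, -2, 2] = A ^ 3 * (11 * (Q * a 5 / (a 1 * a 3 * a 4)))"
    by (simp only: rel_eq_0) simp
  from f11_identity[OF _ this] show ?thesis by (simp add: sum_1_5 a_def del: One_nat_def)
qed

text \<open>The Lambert part is E(3) + 2 E(5) - E(2), the pattern with 2 + 6 = 3 + 5.\<close>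

lemma f11_identity_2:
  "f11 2 1 Q + f11 2 3 Q - f11 2 4 Q = - 11 * Q * (J1 11 Q ^ 5 / J2 2 11 Q ^ 2)"
proof -
  have "comb 2 [0, 1, 0, 1, -1, 0] = 11 * (Q * a 1 ^ 3 * a 2 * a 3 ^ 3 * a 4 ^ 3 * a 5 ^ 3) +
      a 1 * a 2 * a 3 * (4 * a 3 ^ 2 * a 4 * a 5 ^ 3 * rel 0 + Q * a 1 * a 3 ^ 2 * a 4 ^ 2 * a 5 * rel 0 + 4 * Q ^ 2
          * a 1 * a 2 ^ 2 * a 3 ^ 2 * a 4 * rel 0 + 2 * a 3 ^ 3 * a 4 ^ 3 * rel 1 + 2 * a 3 ^ 4 * a 5 ^ 2 * rel 1 + a
          2 * a 3 * a 4 ^ 3 * a 5 * rel 1 + 4 * Q * a 1 * a 3 ^ 2 * a 4 ^ 3 * rel 3 - 2 * Q * a 2 ^ 2 * a 3 * a 4 ^ 3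
          * rel 0 - 2 * Q * a 2 ^ 2 * a 3 ^ 2 * a 5 ^ 2 * rel 0 - 2 * Q * a 1 * a 2 * a 4 ^ 2 * a 5 ^ 2 * rel 0 - 4 *
          Q * a 1 * a 3 ^ 4 * a 4 * rel 1 - a 2 * a 3 ^ 2 * a 4 ^ 3 * rel 2 - 2 * a 2 * a 3 ^ 3 * a 5 ^ 2 * rel 2 - 2
          * a 1 * a 3 * a 4 ^ 2 * a 5 ^ 2 * rel 2 - 2 * a 3 * a 4 ^ 5 * rel 3 - 2 * a 3 ^ 2 * a 4 ^ 2 * a 5 ^ 2 * rel
          3 - Q * a 1 * a 2 * a 4 ^ 3 * a 5 * rel 3)"
    unfolding comb_def lessThan_11 atLeastAtMost_1_10 atLeastAtMost_1_5
    by (simp add: cyc_conv_def cyc_def x_values y_values y_eq_0 e_relations(3) rel_def del: One_nat_def, algebra)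
  also have "Q * a 1 ^ 3 * a 2 * a 3 ^ 3 * a 4 ^ 3 * a 5 ^ 3 = A ^ 3 * (Q / (a 2 ^ 2))"
    using a_nonzero by (simp add: A_def field_simps small_powers a_Suc_0 del: One_nat_def)
  finally have "comb 2 [0, 1, 0, 1, -1, 0] = A ^ 3 * (11 * (Q / (a 2 ^ 2)))"
    by (simp only: rel_eq_0) simp
  from f11_identity[OF _ this] show ?thesis by (simp add: sum_1_5 a_def del: One_nat_def)
qed

text \<open>The Lambert part is E(2) + E(5) - E(3) - E(4).\<close>

lemma f11_identity_5:
  "f11 5 1 Q - 2 * f11 5 3 Q + f11 5 5 Q = - 11 * Q * (J2 3 11 Q * J1 11 Q ^ 5 / (J2 1 11 Q * J2 4 11 Q ^ 2))"
proof -
  have "comb 5 [0, 1, 0, -2, 0, 1] = 11 * (Q * a 1 ^ 2 * a 2 ^ 3 * a 3 ^ 4 * a 4 * a 5 ^ 3) +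
      a 1 * a 4 * a 5 * (12 * a 2 ^ 2 * a 3 ^ 2 * a 5 ^ 2 * rel 0 + a 1 * a 3 ^ 2 * a 4 ^ 2 * a 5 * rel 0 + Q * a 1 *
          a 2 ^ 2 * a 3 ^ 2 * a 4 * rel 0 + 10 * Q * a 1 * a 2 ^ 3 * a 4 * a 5 * rel 0 + 9 * a 2 ^ 3 * a 3 * a 4 ^ 2
          * rel 1 + a 1 * a 3 ^ 4 * a 4 * rel 1 + Q ^ 2 * a 1 ^ 3 * a 2 ^ 2 * a 3 * rel 1 + 9 * a 1 * a 2 * a 4 ^ 3 *
          a 5 * rel 3 + a 1 * a 2 * a 3 * a 5 ^ 3 * rel 3 - 9 * a 2 ^ 2 * a 3 * a 4 ^ 3 * rel 0 - 9 * a 1 * a 2 * a 4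
          ^ 2 * a 5 ^ 2 * rel 0 - 10 * a 1 * a 2 * a 3 ^ 2 * a 4 * a 5 * rel 1 - a 1 ^ 2 * a 3 * a 5 ^ 3 * rel 1 - Q
          * a 1 * a 2 ^ 4 * a 3 * rel 2 - a 1 * a 3 ^ 2 * a 4 ^ 3 * rel 3 - 9 * Q * a 1 * a 2 ^ 3 * a 4 ^ 2 * rel 3 -
          9 * a 2 ^ 3 * a 3 * a 4 * a 5 * rel 4)"
    unfolding comb_def lessThan_11 atLeastAtMost_1_10 atLeastAtMost_1_5
    by (simp add: cyc_conv_def cyc_def x_values y_values y_eq_0 e_relations(2) rel_def del: One_nat_def, algebra)
  also have "Q * a 1 ^ 2 * a 2 ^ 3 * a 3 ^ 4 * a 4 * a 5 ^ 3 = A ^ 3 * (Q * a 3 / (a 1 * a 4 ^ 2))"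
    using a_nonzero by (simp add: A_def field_simps small_powers a_Suc_0 del: One_nat_def)
  finally have "comb 5 [0, 1, 0, -2, 0, 1] = A ^ 3 * (11 * (Q * a 3 / (a 1 * a 4 ^ 2)))"
    by (simp only: rel_eq_0) simp
  from f11_identity[OF _ this] show ?thesis by (simp add: sum_1_5 a_def del: One_nat_def)
qed

text \<open>The Lambert part is E(2) + E(4) - E(1) - E(5).\<close>

lemma f11_identity_7:
  "2 * f11 7 3 Q + f11 7 5 Q = - 11 * (J2 3 11 Q * J2 4 11 Q * J1 11 Q ^ 5 / (J2 1 11 Q * J2 2 11 Q ^ 2 * J2 5 11 Q))"
proof -
  have "comb 7 [0, 0, 0, 2, 0, 1] = 11 * (a 1 ^ 2 * a 2 * a 3 ^ 4 * a 4 ^ 4 * a 5 ^ 2) +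
      a 1 * a 2 * a 3 * a 5 * (a 2 * a 3 ^ 2 * a 5 ^ 2 * rel 0 + 7 * a 2 ^ 2 * a 5 ^ 3 * rel 0 + 8 * a 1 * a 4 ^ 2 *
          a 5 ^ 2 * rel 0 + 7 * Q ^ 2 * a 1 * a 2 ^ 4 * rel 0 + 4 * a 2 ^ 2 * a 3 * a 4 ^ 2 * rel 1 + 7 * Q ^ 2 * a 1
          ^ 3 * a 2 * a 3 * rel 1 + 2 * a 1 * a 2 * a 3 * a 4 * a 5 * rel 2 + 3 * Q * a 1 * a 2 ^ 2 * a 4 ^ 2 * rel 3
          + 3 * a 2 ^ 2 * a 3 * a 4 * a 5 * rel 4 - 4 * a 2 * a 3 * a 4 ^ 3 * rel 0 - 7 * Q * a 1 * a 2 * a 3 ^ 2 * a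
          4 * rel 0 - Q * a 1 * a 2 ^ 2 * a 4 * a 5 * rel 0 - 3 * a 1 * a 3 ^ 2 * a 4 * a 5 * rel 1 - 7 * a 1 * a 2 *
          a 4 * a 5 ^ 2 * rel 1 - 7 * Q * a 1 * a 2 ^ 3 * a 3 * rel 2 - 8 * a 1 * a 4 ^ 3 * a 5 * rel 3 - 7 * Q ^ 2 *
          a 1 ^ 2 * a 2 ^ 2 * a 3 * rel 3)"
    unfolding comb_def lessThan_11 atLeastAtMost_1_10 atLeastAtMost_1_5
    by (simp add: cyc_conv_def cyc_def x_values y_values y_eq_0 e_relations(1) rel_def del: One_nat_def, algebra)
  also have "a 1 ^ 2 * a 2 * a 3 ^ 4 * a 4 ^ 4 * a 5 ^ 2 = A ^ 3 * (a 3 * a 4 / (a 1 * a 2 ^ 2 * a 5))"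
    using a_nonzero by (simp add: A_def field_simps small_powers a_Suc_0 del: One_nat_def)
  finally have "comb 7 [0, 0, 0, 2, 0, 1] = A ^ 3 * (11 * (a 3 * a 4 / (a 1 * a 2 ^ 2 * a 5)))"
    by (simp only: rel_eq_0) simp
  from f11_identity[OF _ this] show ?thesis by (simp add: sum_1_5 a_def del: One_nat_def)
qed

text \<open>The Lambert part is E(2) + E(4) - E(1) - E(5) as for m = 7, multiplied by a different
  component of the crank product.\<close>

lemma f11_identity_10:
  "f11 10 1 Q + f11 10 2 Q + 2 * f11 10 4 Q = - 11 * (J2 5 11 Q * J1 11 Q ^ 5 / (J2 2 11 Q ^ 2 * J2 3 11 Q))"
proof -
  have "comb 10 [0, 1, 1, 0, 2, 0] = 11 * (a 1 ^ 3 * a 2 * a 3 ^ 2 * a 4 ^ 3 * a 5 ^ 4) +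
      a 1 * a 2 * a 4 * a 5 * (4 * a 1 * a 3 ^ 2 * a 4 * a 5 * rel 0 + 7 * Q * a 1 * a 2 ^ 2 * a 3 ^ 2 * rel 0 + 2 *
          Q * a 1 * a 2 ^ 3 * a 5 * rel 0 + 2 * a 2 ^ 3 * a 3 * a 4 * rel 1 + 4 * a 1 * a 2 * a 3 ^ 3 * rel 2 + 3 * a
          1 * a 2 ^ 2 * a 3 * a 5 * rel 2 + 7 * a 1 * a 3 ^ 2 * a 4 ^ 2 * rel 3 + 3 * a 1 * a 2 * a 4 ^ 2 * a 5 * rel
          3 + 3 * Q * a 1 ^ 2 * a 2 * a 3 * a 5 * rel 3 - 2 * a 2 ^ 2 * a 3 * a 4 ^ 2 * rel 0 - 6 * a 1 * a 2 * a 4 *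
          a 5 ^ 2 * rel 0 - 7 * a 1 * a 3 ^ 4 * rel 1 - 3 * a 1 * a 2 * a 3 ^ 2 * a 5 * rel 1 - 3 * Q * a 1 ^ 3 * a 3
          * a 5 * rel 1 - 2 * Q * a 1 * a 2 ^ 3 * a 4 * rel 3 - 2 * a 2 ^ 3 * a 3 * a 5 * rel 4 - 2 * a 1 * a 2 * a 3 * a 4 ^ 2 * rel 4)"
    unfolding comb_def lessThan_11 atLeastAtMost_1_10 atLeastAtMost_1_5
    by (simp add: cyc_conv_def cyc_def x_values y_values y_eq_0 e_relations(1) rel_def del: One_nat_def, algebra)
  also have "a 1 ^ 3 * a 2 * a 3 ^ 2 * a 4 ^ 3 * a 5 ^ 4 = A ^ 3 * (a 5 / (a 2 ^ 2 * a 3))"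
    using a_nonzero by (simp add: A_def field_simps small_powers a_Suc_0 del: One_nat_def)
  finally have "comb 10 [0, 1, 1, 0, 2, 0] = A ^ 3 * (11 * (a 5 / (a 2 ^ 2 * a 3)))"
    by (simp only: rel_eq_0) simp
  from f11_identity[OF _ this] show ?thesis by (simp add: sum_1_5 a_def del: One_nat_def)
qed

end

theorem corollary1p2:
  fixes q :: complex
  assumes "norm q < 1"
  shows "(f11 0 1 q - f11 0 3 q - 2 * f11 0 4 q + 2 * f11 0 5 q =
            - 11 * q * (J2 5 11 q * J1 11 q ^ 5 / (J2 1 11 q * J2 3 11 q * J2 4 11 q))) \<and>
         (f11 2 1 q + f11 2 3 q - f11 2 4 q =
            - 11 * q * (J1 11 q ^ 5 / J2 2 11 q ^ 2)) \<and>
         (f11 5 1 q - 2 * f11 5 3 q + f11 5 5 q =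
            - 11 * q * (J2 3 11 q * J1 11 q ^ 5 / (J2 1 11 q * J2 4 11 q ^ 2))) \<and>
         (2 * f11 7 3 q + f11 7 5 q =
            - 11 * (J2 3 11 q * J2 4 11 q * J1 11 q ^ 5 / (J2 1 11 q * J2 2 11 q ^ 2 * J2 5 11 q))) \<and>
         (f11 10 1 q + f11 10 2 q + 2 * f11 10 4 q =
            - 11 * (J2 5 11 q * J1 11 q ^ 5 / (J2 2 11 q ^ 2 * J2 3 11 q)))"
proof (cases "q = 0")
  case False
  then interpret level11_point q using assms by unfold_locales auto
  show ?thesis
    using f11_identity_0 f11_identity_2 f11_identity_5 f11_identity_7 f11_identity_10 by blast
next
  case True
  note ids = level11_point.f11_identity_0 level11_point.f11_identity_2 level11_point.f11_identity_5
    level11_point.f11_identity_7 level11_point.f11_identity_10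
  have eq0: "F 0 = G 0" if "\<And>Q. Q \<noteq> 0 \<Longrightarrow> norm Q < 1 \<Longrightarrow> F Q = G Q"
    "(F \<longlongrightarrow> F 0) (at 0)" "(G \<longlongrightarrow> G 0) (at 0)" for F G :: "complex \<Rightarrow> complex"
  proof -
    have "eventually (\<lambda>Q. F Q = G Q) (at 0)"
      using eventually_punctured_disc by eventually_elim (use that(1) in blast)
    hence "(G \<longlongrightarrow> F 0) (at 0)" using that(2) by (rule Lim_transform_eventually[rotated])
    thus ?thesis using that(3) by (intro tendsto_unique[of "at 0" G]) auto
  qed
  have f: "((\<lambda>q. f11 m 1 q) \<longlongrightarrow> f11 m 1 0) (at 0)" "((\<lambda>q. f11 m 2 q) \<longlongrightarrow> f11 m 2 0) (at 0)"
    "((\<lambda>q. f11 m 3 q) \<longlongrightarrow> f11 m 3 0) (at 0)" "((\<lambda>q. f11 m 4 q) \<longlongrightarrow> f11 m 4 0) (at 0)"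
    "((\<lambda>q. f11 m 5 q) \<longlongrightarrow> f11 m 5 0) (at 0)" for m
    using f11_tendsto[of 1 m] f11_tendsto[of 2 m] f11_tendsto[of 3 m] f11_tendsto[of 4 m] f11_tendsto[of 5 m]
    by simp_all
  have J: "((\<lambda>q. J2 1 11 q) \<longlongrightarrow> J2 1 11 0) (at 0)" "((\<lambda>q. J2 2 11 q) \<longlongrightarrow> J2 2 11 0) (at 0)"
    "((\<lambda>q. J2 3 11 q) \<longlongrightarrow> J2 3 11 0) (at 0)" "((\<lambda>q. J2 4 11 q) \<longlongrightarrow> J2 4 11 0) (at 0)"
    "((\<lambda>q. J2 5 11 q) \<longlongrightarrow> J2 5 11 0) (at 0)"
    by (intro J2_tendsto; simp)+
  \<comment> \<open>At q = 0 every one of these J equals 1, so the right-hand sides are continuous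
    there and agree with their limits.\<close>
  have nz: "J2 1 11 0 \<noteq> 0" "J2 2 11 0 \<noteq> 0" "J2 3 11 0 \<noteq> 0" "J2 4 11 0 \<noteq> 0" "J2 5 11 0 \<noteq> 0"
    using J2_0[of 1] J2_0[of 2] J2_0[of 3] J2_0[of 4] J2_0[of 5] by simp_all
  show ?thesis unfolding True
    by (intro conjI ids[OF level11_point.intro, THEN eq0] tendsto_intros f J J1_tendsto;
        simp add: nz del: One_nat_def)
qed

end
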